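(* Let $\{X_n\}_{n\in\mathbb Z}\subset L_H^4$ be $L^4$--$m$-approximable, where each $X_n$ is jointly measurable in $(t,\omega)$ and $\sup_{t\in[0,1]}E|X_1(t)|^2<\infty$. Write $X_n(t)=\mu(t)+Y_n(t)$ with $EY_n(t)=0$. Let $C$ be the covariance operator of $X_1$, with eigenvalues $\lambda_1\ge\lambda_2\ge\cdots$ and orthonormal eigenfunctions $v_1,v_2,\ldots$, and assume $\lambda_1>\lambda_2>\cdots>\lambda_d>\lambda_{d+1}$. Let $\hat v_1,\ldots,\hat v_d$ be the first $d$ orthonormal eigenfunctions of the empirical covariance operator $\hat C$ computed from $X_1,\ldots,X_N$, and let $\hat{\mathbf C}=\mathrm{diag}(\hat c_1,\ldots,\hat c_d)$ with $\hat c_i=\mathrm{sign}(\langle v_i,\hat v_i\rangle)$. Assume that the bandwidth $q=q(N)$ and weights satisfy $q\to\infty$, $q^4/N\to0$, $\omega_q(j)=\omega_q(-j)$, $|\omega_q(j)|\le b$ for some constant $b$ and all $q,j$, and $\omega_q(j)\to1$ for every fixed $j$. For $1\le\ell\le d$ and $1\le n\le N$ let $$\beta_{\ell n}=\int Y_n(t)v_\ell(t)\,dt,\quad \hat\beta_{\ell n}=\int Y_n(t)\hat v_\ell(t)\,dt,\quad \hat\eta_{\ell n}=\int\bigl(X_n(t)-\bar X_N(t)\bigr)\hat v_\ell(t)\,dt,$$ and let $\boldsymbol\beta_n,\hat{\boldsymbol\beta}_n,\hat{\boldsymbol\eta}_n\in\mathbb R^d$ be the corresponding vectors. Then, as $N\to\infty$,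 $$\bigl|\hat{\mathbf\Sigma}(\boldsymbol\beta)-\hat{\mathbf\Sigma}(\hat{\mathbf C}\hat{\boldsymbol\beta})\bigr|=o_P(1)\quad\text{and}\quad \bigl|\hat{\mathbf\Sigma}(\hat{\boldsymbol\eta})-\hat{\mathbf\Sigma}(\hat{\boldsymbol\beta})\bigr|=o_P(1).$$
   Context: $H=L^2([0,1],\mathcal B_{[0,1]},\lambda)$ with inner product $\langle\cdot,\cdot\rangle$ and norm $\|f\|^2=\int_0^1|f(t)|^2dt$. $L_H^p$ is the space of $H$-valued random elements $X$ with $\nu_p(X)=(E\|X\|^p)^{1/p}<\infty$. $|\cdot|$ denotes a matrix norm. $L^p$--$m$-approximability: a sequence $\{X_n\}_{n\in\mathbb Z}\subset L_H^p$ is $L^p$--$m$-approximable if $X_n=f(\varepsilon_n,\varepsilon_{n-1},\ldots)$ for all $n$, where $\{\varepsilon_i\}_{i\in\mathbb Z}$ are i.i.d. elements with values in a measurable space $S$ and $f:S^\infty\to H$ is measurable, and moreover $\sum_{m=1}^\infty\nu_p(X_m-X_m^{(m)})<\infty$, where $$X_n^{(m)}=f\bigl(\varepsilon_n,\ldots,\varepsilon_{n-m+1},\varepsilon_{n-m}^{(n)},\varepsilon_{n-m-1}^{(n)},\ldots\bigr)$$ and, for each $n$, $\{\varepsilon_k^{(n)}\}_{k}$ is an independent copy of $\{\varepsilon_k\}_k$ (these copies for different $n$ being independent of each other and of $\{\varepsilon_k\}$). The covariance operator $C$ is the integral operator with kernel $c(t,s)=\mathrm{Cov}(X_1(t),X_1(s))$;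 the empirical covariance operator $\hat C$ is the integral operator with kernel $\hat c(t,s)=N^{-1}\sum_{n=1}^N(X_n(t)-\bar X_N(t))(X_n(s)-\bar X_N(s))$, with $\bar X_N=N^{-1}\sum_{n=1}^NX_n$. Kernel estimator: for a sequence of $\mathbb R^d$-valued vectors $\boldsymbol\xi=(\boldsymbol\xi_1,\ldots,\boldsymbol\xi_N)$, $\hat{\mathbf\Sigma}(\boldsymbol\xi)=\sum_{|r|\le q}\omega_q(r)\hat{\mathbf\Gamma}_r$, where $\hat{\mathbf\Gamma}_r=N^{-1}\sum_{n=1}^{N-r}\boldsymbol\xi_n\boldsymbol\xi_{n+r}^T$ for $r\ge0$ and $\hat{\mathbf\Gamma}_r=N^{-1}\sum_{n=1}^{N-|r|}\boldsymbol\xi_{n+|r|}\boldsymbol\xi_n^T$ for $r<0$. $\hat{\mathbf C}\hat{\boldsymbol\beta}$ denotes the sequence $\hat{\mathbf C}\hat{\boldsymbol\beta}_n$. *)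

theory Defs
  imports "HOL-Probability.Probability" "Jordan_Normal_Form.Matrix"
begin

no_notation vec_nth (infixl \<open>$\<close> 90)

text \<open>
  Elements of \<open>H = L\<^sup>2([0,1])\<close> are handled through representatives \<open>real \<Rightarrow> real\<close>, of which only the
  values on \<open>[0,1]\<close> matter; equality in \<open>H\<close> is equality almost everywhere on \<open>[0,1]\<close>.
\<close>

abbreviation I01 :: "real measure" where
  "I01 \<equiv> restrict_space lborel {0..1}"

definition L2 :: "(real \<Rightarrow> real) set" where
  "L2 = {g \<in> borel_measurable I01. integrable I01 (\<lambda>t. (g t)\<^sup>2)}"

definition ip :: "(real \<Rightarrow> real) \<Rightarrow> (real \<Rightarrow> real) \<Rightarrow> real" where
  "ip g h = (\<integral>t. g t * h t \<partial>I01)"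

definition L2norm :: "(real \<Rightarrow> real) \<Rightarrow> real" where
  "L2norm g = sqrt (\<integral>t. (g t)\<^sup>2 \<partial>I01)"

text \<open>
  The sets \<open>U\<close> below are exactly the preimages, under passage to almost-everywhere classes, of the
  norm-open subsets of \<open>H\<close>; so this is the Borel \<open>\<sigma>\<close>-algebra of \<open>H\<close> read on representatives.
\<close>

definition borel_L2 :: "(real \<Rightarrow> real) measure" where
  "borel_L2 = sigma L2
     {U. U \<subseteq> L2 \<and> (\<forall>g\<in>U. \<exists>e>0. \<forall>h\<in>L2. L2norm (\<lambda>t. h t - g t) < e \<longrightarrow> h \<in> U)}"

text \<open>\<open>nu M p X\<close> is \<open>(E \<parallel>X\<parallel>\<^sup>p)\<^bsup>1/p\<^esup>\<close>, with value \<open>\<infinity>\<close> when the moment is infinite.\<close>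

definition nu :: "'w measure \<Rightarrow> real \<Rightarrow> ('w \<Rightarrow> real \<Rightarrow> real) \<Rightarrow> ennreal" where
  "nu M p X = (let m = (\<integral>\<^sup>+w. ennreal (L2norm (X w) powr p) \<partial>M)
               in if m = \<infinity> then \<infinity> else ennreal (enn2real m powr (1 / p)))"

definition Lp_H :: "'w measure \<Rightarrow> real \<Rightarrow> ('w \<Rightarrow> real \<Rightarrow> real) set" where
  "Lp_H M p = {X \<in> measurable M borel_L2. nu M p X < \<infinity>}"

text \<open>
  \<open>eps' n\<close> is the independent copy \<open>\<epsilon>\<^bsup>(n)\<^esup>\<close>. In the joint independence statement the index \<open>None\<close>
  stands for the original innovation sequence and \<open>Some n\<close> for the \<open>n\<close>-th copy.
  The argument \<open>j\<close> of an element of \<open>S\<^sup>\<infinity>\<close> is the lag, so \<open>eps (n - j)\<close> sits in position \<open>j\<close>.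
\<close>

definition Lp_m_approximable ::
    "'w measure \<Rightarrow> 's measure \<Rightarrow> real \<Rightarrow> (int \<Rightarrow> 'w \<Rightarrow> real \<Rightarrow> real) \<Rightarrow> bool" where
  "Lp_m_approximable M S p X \<longleftrightarrow>
     (\<forall>n. X n \<in> Lp_H M p) \<and>
     (\<exists>(f :: (nat \<Rightarrow> 's) \<Rightarrow> real \<Rightarrow> real) (eps :: int \<Rightarrow> 'w \<Rightarrow> 's) (eps' :: int \<Rightarrow> int \<Rightarrow> 'w \<Rightarrow> 's).
        f \<in> measurable (PiM UNIV (\<lambda>_. S)) borel_L2 \<and>
        prob_space.indep_vars M (\<lambda>_. S) eps UNIV \<and>
        (\<forall>i. distr M S (eps i) = distr M S (eps 0)) \<and>
        (\<forall>n. distr M (PiM UNIV (\<lambda>_. S)) (\<lambda>w k. eps' n k w)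
           = distr M (PiM UNIV (\<lambda>_. S)) (\<lambda>w k. eps k w)) \<and>
        prob_space.indep_vars M (\<lambda>_. PiM UNIV (\<lambda>_. S))
          (\<lambda>j w k. case j of None \<Rightarrow> eps k w | Some n \<Rightarrow> eps' n k w) (UNIV :: int option set) \<and>
        (\<forall>n. AE w in M. AE t in I01. X n w t = f (\<lambda>j. eps (n - int j) w) t) \<and>
        (\<Sum>k. let m = Suc k in
           nu M p (\<lambda>w t. X (int m) w t
             - f (\<lambda>j. if j < m then eps (int m - int j) w
                       else eps' (int m) (int m - int j) w) t)) < \<infinity>)"

definition cov_kernel :: "'w measure \<Rightarrow> ('w \<Rightarrow> real \<Rightarrow> real) \<Rightarrow> real \<Rightarrow> real \<Rightarrow> real" where
  "cov_kernel M X t s =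
     (\<integral>w. (X w t - (\<integral>w'. X w' t \<partial>M)) * (X w s - (\<integral>w'. X w' s \<partial>M)) \<partial>M)"

definition sample_mean :: "(int \<Rightarrow> 'w \<Rightarrow> real \<Rightarrow> real) \<Rightarrow> nat \<Rightarrow> 'w \<Rightarrow> real \<Rightarrow> real" where
  "sample_mean X N w t = (\<Sum>n=1..N. X (int n) w t) / real N"

definition emp_cov_kernel ::
    "(int \<Rightarrow> 'w \<Rightarrow> real \<Rightarrow> real) \<Rightarrow> nat \<Rightarrow> 'w \<Rightarrow> real \<Rightarrow> real \<Rightarrow> real" where
  "emp_cov_kernel X N w t s =
     (\<Sum>n=1..N. (X (int n) w t - sample_mean X N w t) * (X (int n) w s - sample_mean X N w s))
       / real N"

definition int_op :: "(real \<Rightarrow> real \<Rightarrow> real) \<Rightarrow> (real \<Rightarrow> real) \<Rightarrow> real \<Rightarrow> real" where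
  "int_op c g t = (\<integral>s. c t s * g s \<partial>I01)"

text \<open>
  The eigenvalues in decreasing order, repeated according to multiplicity (numbered from \<open>0\<close>), with
  orthonormal eigenfunctions. The last clause says that the list is exhaustive: the \<open>v i\<close> together
  with the kernel of \<open>T\<close> span a dense subspace of \<open>H\<close>. Density of the span of the \<open>v i\<close> alone would
  be too much: an operator with infinitely many positive eigenvalues and a nontrivial kernel has no
  decreasing enumeration that includes the eigenvalue \<open>0\<close>.
\<close>

definition eigensystem ::
    "((real \<Rightarrow> real) \<Rightarrow> real \<Rightarrow> real) \<Rightarrow> (nat \<Rightarrow> real) \<Rightarrow> (nat \<Rightarrow> real \<Rightarrow> real) \<Rightarrow> bool" where
  "eigensystem T lam v \<longleftrightarrow>
     (\<forall>i. v i \<in> L2) \<and>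
     (\<forall>i j. ip (v i) (v j) = (if i = j then 1 else 0)) \<and>
     (\<forall>i. AE t in I01. T (v i) t = lam i * v i t) \<and>
     decseq lam \<and>
     (\<forall>g\<in>L2. (\<forall>i. ip g (v i) = 0) \<longrightarrow> (AE t in I01. T g t = 0))"

definition score_vec :: "nat \<Rightarrow> (nat \<Rightarrow> real \<Rightarrow> real) \<Rightarrow> (real \<Rightarrow> real) \<Rightarrow> real vec" where
  "score_vec d v g = Matrix.vec d (\<lambda>l. ip g (v l))"

text \<open>Entrywise form of \<open>N\<^sup>-\<^sup>1 \<Sum> \<xi>\<^sub>n \<xi>\<^sub>n\<^sub>+\<^sub>r\<^sup>T\<close>, respectively \<open>N\<^sup>-\<^sup>1 \<Sum> \<xi>\<^sub>n\<^sub>+\<^sub>|\<^sub>r\<^sub>| \<xi>\<^sub>n\<^sup>T\<close>.\<close>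

definition Gamma_hat :: "nat \<Rightarrow> nat \<Rightarrow> (nat \<Rightarrow> real vec) \<Rightarrow> int \<Rightarrow> real mat" where
  "Gamma_hat d N xi r = Matrix.mat d d (\<lambda>(i, j).
     if 0 \<le> r then (\<Sum>n=1..N - nat r. xi n $ i * xi (n + nat r) $ j) / real N
     else (\<Sum>n=1..N - nat \<bar>r\<bar>. xi (n + nat \<bar>r\<bar>) $ i * xi n $ j) / real N)"

definition Sigma_hat ::
    "nat \<Rightarrow> nat \<Rightarrow> nat \<Rightarrow> (nat \<Rightarrow> int \<Rightarrow> real) \<Rightarrow> (nat \<Rightarrow> real vec) \<Rightarrow> real mat" where
  "Sigma_hat d N q \<omega> xi = Matrix.mat d d (\<lambda>(i, j).
     \<Sum>r\<in>{- int q..int q}. \<omega> q r * Gamma_hat d N xi r $$ (i, j))"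

definition matrix_norm :: "nat \<Rightarrow> (real mat \<Rightarrow> real) \<Rightarrow> bool" where
  "matrix_norm d nm \<longleftrightarrow>
     (\<forall>A\<in>carrier_mat d d. 0 \<le> nm A \<and> (nm A = 0 \<longleftrightarrow> A = 0\<^sub>m d d)) \<and>
     (\<forall>A\<in>carrier_mat d d. \<forall>a. nm (a \<cdot>\<^sub>m A) = \<bar>a\<bar> * nm A) \<and>
     (\<forall>A\<in>carrier_mat d d. \<forall>B\<in>carrier_mat d d. nm (A + B) \<le> nm A + nm B)"

text \<open>
  \<open>Z N = o\<^sub>P(1)\<close>. For measurable \<open>Z N\<close> the outer measure is the probability of the event. It is used
  because sample eigenfunctions are only chosen pointwise in \<open>w\<close>, without a measurability
  requirement, and \<open>measure\<close> would assign \<open>0\<close> to a non-measurable set.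
\<close>

definition oP1 :: "'w measure \<Rightarrow> (nat \<Rightarrow> 'w \<Rightarrow> real) \<Rightarrow> bool" where
  "oP1 M Z \<longleftrightarrow>
     (\<forall>e>0. (\<lambda>N. outer_measure_of M {w \<in> space M. e < \<bar>Z N w\<bar>}) \<longlonglongrightarrow> 0)"

end

theory Submission
  imports Defs "Jordan_Normal_Form.Determinant"
begin

text \<open>
  Write \<open>Y\<^sub>n = X\<^sub>n - \<mu>\<close> and let \<open>\<delta>\<close> be a bound for the difference of the quadratic forms of the
  empirical and the true covariance operator. An entry of a lag-\<open>r\<close> autocovariance matrix of scores is
  an average of products \<open>\<langle>Y\<^sub>n, p\<rangle> \<langle>Y\<^sub>n\<^sub>+\<^sub>r, p'\<rangle>\<close> over \<open>n\<close>. Moving directions \<open>p, p'\<close> of norm at most one by at most \<open>\<tau>\<close>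
  changes it by at most \<open>2 \<tau>\<close> times the average of \<open>\<parallel>Y\<^sub>n\<parallel>\<^sup>2\<close> (\<open>lag_product_direction_diff\<close>), and
  centring the \<open>Y\<^sub>n\<close> at the sample mean changes it by at most a multiple of the norm of that mean
  (\<open>lag_product_centring_diff\<close>). The kernel estimator adds up \<open>2q + 1\<close> such matrices with bounded
  weights. Hence both differences in the theorem are at most a constant times
  \<open>(2q + 1) A\<^sub>N D\<^sub>N\<close>, where \<open>A\<^sub>N\<close> (\<open>amplitude\<close>) is one plus the average of \<open>\<parallel>Y\<^sub>n\<parallel>\<^sup>2\<close> and \<open>D\<^sub>N\<close> (\<open>deviation\<close>)
  collects \<open>\<delta>\<close> and the norm of the sample mean of the \<open>Y\<^sub>n\<close>. The amplitude has bounded expectation, the deviation has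
  expectation \<open>O(N\<^bsup>-1/2\<^esup>)\<close>, and \<open>q\<^sup>4/N \<rightarrow> 0\<close> makes \<open>(2q + 1) / \<surd>N\<close> vanish; an application of
  Markov's inequality to \<open>\<surd>(A\<^sub>N D\<^sub>N)\<close> then gives convergence in probability, since only first
  moments of the two factors are needed there (\<open>oP1_by_products\<close>).

  Two facts carry the bound on the deviation. The first is deterministic: the sign-corrected sample
  eigenfunction is within \<open>3 \<delta> / \<gamma>\<close> of the true one, where \<open>\<gamma>\<close> is the smallest of the first \<open>d\<close>
  spectral gaps (\<open>eigenvector_perturbation\<close>). Weyl's inequality gives the distance of the eigenvalues,
  and testing the two eigenvalue equations against a suitably reflected residual gives the distance of the
  eigenvectors.

  The second is a second-moment computation: the mean square of the sample mean of the \<open>Y\<^sub>n\<close> and the mean square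
  of the Hilbert--Schmidt distance between the kernels are averages, over all pairs of times in
  the sample, of \<open>E \<langle>Y\<^sub>n, Y\<^sub>m\<rangle>\<close> and of \<open>E \<langle>Y\<^sub>n, Y\<^sub>m\<rangle>\<^sup>2 - \<kappa>\<close>, where \<open>0\<close> and \<open>\<kappa>\<close> are the values for
  independent copies. Replacing \<open>X\<^sub>h\<close> by its coupled version, which is independent of \<open>X\<^sub>0\<close> and has the same law, shows that the value
  at lag \<open>h\<close> is at most a constant times \<open>\<nu>\<^sub>4(X\<^sub>h - X\<^sub>h\<^bsup>(h)\<^esup>)\<close>. This is summable over \<open>h\<close>, so both mean squares are
  \<open>O(1/N)\<close> (\<open>mean_square_average\<close>, \<open>mean_squared_covariances\<close>, \<open>moment_rates\<close>).

  Almost-everywhere classes of square-integrable functions form a quotient type \<open>L2_class\<close>. It is shown to be complete,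
  which the variational characterisation of the eigenvalues requires, and second countable, which
  makes the inner product of two measurable random elements measurable.
\<close>

section \<open>Square-integrable functions on the unit interval as a real inner product space\<close>

lemma space_I01 [simp]: "space I01 = {0..1}"
  by (simp add: space_restrict_space)

lemma prob_space_I01: "prob_space I01"
  by (rule prob_spaceI) (simp add: emeasure_restrict_space space_restrict_space)

interpretation I01: prob_space I01
  by (rule prob_space_I01)

lemma L2_measurable [measurable_dest]: "g \<in> L2 \<Longrightarrow> g \<in> borel_measurable I01"
  by (simp add: L2_def)

lemma L2_square_integrable: "g \<in> L2 \<Longrightarrow> integrable I01 (\<lambda>t. (g t)\<^sup>2)"
  by (simp add: L2_def)

lemma L2_mult_integrable:
  assumes "g \<in> L2" "h \<in> L2"
  shows "integrable I01 (\<lambda>t. g t * h t)"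
proof (rule Bochner_Integration.integrable_bound)
  show "integrable I01 (\<lambda>t. (g t)\<^sup>2 + (h t)\<^sup>2)"
    using assms by (intro Bochner_Integration.integrable_add L2_square_integrable)
  show "(\<lambda>t. g t * h t) \<in> borel_measurable I01"
    using assms by (intro borel_measurable_times L2_measurable)
  have "\<bar>a * b\<bar> \<le> a\<^sup>2 + b\<^sup>2" for a b :: real
  proof -
    have "0 \<le> (\<bar>a\<bar> - \<bar>b\<bar>)\<^sup>2" by simp
    then have "2 * (\<bar>a\<bar> * \<bar>b\<bar>) \<le> a\<^sup>2 + b\<^sup>2" by (simp add: power2_diff)
    moreover have "0 \<le> \<bar>a\<bar> * \<bar>b\<bar>" by simp
    ultimately show ?thesis unfolding abs_mult by linarith
  qed
  then show "AE t in I01. norm (g t * h t) \<le> norm ((g t)\<^sup>2 + (h t)\<^sup>2)"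
    by (auto intro: order_trans[OF _ abs_ge_self])
qed

lemma L2_add: "g \<in> L2 \<Longrightarrow> h \<in> L2 \<Longrightarrow> (\<lambda>t. g t + h t) \<in> L2"
  using L2_square_integrable[of g] L2_square_integrable[of h] L2_mult_integrable[of g h]
  by (auto simp: L2_def power2_sum mult.assoc)

lemma L2_scale: "g \<in> L2 \<Longrightarrow> (\<lambda>t. a * g t) \<in> L2"
  by (auto simp: L2_def power_mult_distrib)

lemma L2_uminus: "g \<in> L2 \<Longrightarrow> (\<lambda>t. - g t) \<in> L2"
  by (auto simp: L2_def)

lemma L2_diff: "g \<in> L2 \<Longrightarrow> h \<in> L2 \<Longrightarrow> (\<lambda>t. g t - h t) \<in> L2"
  using L2_add[OF _ L2_uminus, of g h] by simp

lemma L2_zero: "(\<lambda>t. 0) \<in> L2"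
  by (simp add: L2_def)

lemma L2_sum: "(\<And>i. i \<in> A \<Longrightarrow> g i \<in> L2) \<Longrightarrow> (\<lambda>t. \<Sum>i\<in>A. g i t) \<in> L2"
  by (induction A rule: infinite_finite_induct) (auto intro: L2_add L2_zero)

lemma L2_bounded:
  assumes [measurable]: "g \<in> borel_measurable I01" and "\<And>t. t \<in> {0..1} \<Longrightarrow> \<bar>g t\<bar> \<le> c"
  shows "g \<in> L2"
proof -
  have "\<bar>g t\<bar> \<le> \<bar>c\<bar>" if "t \<in> {0..1}" for t
    using assms(2)[OF that] by linarith
  then show ?thesis
    unfolding L2_def
    by (auto intro!: I01.integrable_const_bound[where B="c\<^sup>2"] AE_I2
        simp: abs_le_square_iff[symmetric])
qed

text \<open>The relation is partial: only square-integrable functions represent a class. The class of any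
  other function is unspecified, and so membership in \<open>L2\<close> appears as a hypothesis of the transfer
  lemmas below.\<close>

quotient_type L2_class = "real \<Rightarrow> real" / partial:
    "\<lambda>g h. g \<in> L2 \<and> h \<in> L2 \<and> (AE t in I01. g t = h t)"
  morphisms L2_class_rep L2_class_of
proof (rule part_equivpI)
  show "\<exists>g. g \<in> L2 \<and> g \<in> L2 \<and> (AE t in I01. g t = g t)"
    using L2_zero by auto
  show "symp (\<lambda>g h. g \<in> L2 \<and> h \<in> L2 \<and> (AE t in I01. g t = h t))"
    by (auto simp: symp_def elim: AE_mp)
  show "transp (\<lambda>g h. g \<in> L2 \<and> h \<in> L2 \<and> (AE t in I01. g t = h t))"
    by (auto simp: transp_def elim: AE_mp)
qed

instantiation L2_class :: real_inner
begin

lift_definition zero_L2_class :: L2_class is "\<lambda>t. 0"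
  by (simp add: L2_zero)

lift_definition plus_L2_class :: "L2_class \<Rightarrow> L2_class \<Rightarrow> L2_class"
  is "\<lambda>g h t. g t + h t"
  by (auto intro: L2_add)

lift_definition minus_L2_class :: "L2_class \<Rightarrow> L2_class \<Rightarrow> L2_class"
  is "\<lambda>g h t. g t - h t"
  by (auto intro: L2_diff)

lift_definition uminus_L2_class :: "L2_class \<Rightarrow> L2_class"
  is "\<lambda>g t. - g t"
  by (auto intro: L2_uminus)

lift_definition scaleR_L2_class :: "real \<Rightarrow> L2_class \<Rightarrow> L2_class"
  is "\<lambda>a g t. a * g t"
  by (auto intro: L2_scale)

lift_definition inner_L2_class :: "L2_class \<Rightarrow> L2_class \<Rightarrow> real"
  is ip
  unfolding ip_def by (auto intro!: integral_cong_AE)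

definition norm_L2_class :: "L2_class \<Rightarrow> real" where
  "norm_L2_class x = sqrt (inner x x)"
definition dist_L2_class :: "L2_class \<Rightarrow> L2_class \<Rightarrow> real" where
  "dist_L2_class x y = norm (x - y)"
definition sgn_L2_class :: "L2_class \<Rightarrow> L2_class" where
  "sgn_L2_class x = inverse (norm x) *\<^sub>R x"
definition uniformity_L2_class :: "(L2_class \<times> L2_class) filter" where
  "uniformity_L2_class = (INF e\<in>{0 <..}. principal {(x, y). dist x y < e})"
definition open_L2_class :: "L2_class set \<Rightarrow> bool" where
  "open_L2_class U \<longleftrightarrow> (\<forall>x\<in>U. eventually (\<lambda>(x', y). x' = x \<longrightarrow> y \<in> U) uniformity)"

instance
proof
  fix x y z :: L2_class and a b :: real
  show "x + y + z = x + (y + z)" by transfer (auto simp: add.assoc intro: L2_add)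
  show "x + y = y + x" by transfer (auto simp: add.commute intro: L2_add)
  show "0 + x = x" by transfer auto
  show "- x + x = 0" by transfer (auto simp: L2_zero)
  show "x - y = x + - y" by transfer (auto intro: L2_diff)
  show "a *\<^sub>R (x + y) = a *\<^sub>R x + a *\<^sub>R y"
    by transfer (auto simp: distrib_left intro!: L2_add L2_scale)
  show "(a + b) *\<^sub>R x = a *\<^sub>R x + b *\<^sub>R x"
    by transfer (auto simp: distrib_right intro!: L2_add L2_scale)
  show "a *\<^sub>R b *\<^sub>R x = (a * b) *\<^sub>R x"
    by transfer (auto simp: mult.assoc intro!: L2_scale)
  show "1 *\<^sub>R x = x" by transfer auto
  show "dist x y = norm (x - y)" by (rule dist_L2_class_def)
  show "sgn x = inverse (norm x) *\<^sub>R x" by (rule sgn_L2_class_def)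
  show "(uniformity :: (L2_class \<times> L2_class) filter) = (INF e\<in>{0 <..}. principal {(x, y). dist x y < e})"
    by (rule uniformity_L2_class_def)
  show "open U \<longleftrightarrow> (\<forall>x\<in>U. eventually (\<lambda>(x', y). x' = x \<longrightarrow> y \<in> U) uniformity)"
    for U :: "L2_class set" by (rule open_L2_class_def)
  show "inner x y = inner y x" by transfer (simp add: ip_def mult.commute)
  show "inner (x + y) z = inner x z + inner y z"
    by transfer (auto simp: ip_def distrib_right intro!: Bochner_Integration.integral_add L2_mult_integrable)
  show "inner (a *\<^sub>R x) y = a * inner x y"
    by transfer (simp add: ip_def mult.assoc)
  show "0 \<le> inner x x" by transfer (simp add: ip_def)
  show "inner x x = 0 \<longleftrightarrow> x = 0"
  proof transfer
    fix g assume "g \<in> L2 \<and> g \<in> L2 \<and> (AE t in I01. g t = g t)"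
    then have g: "g \<in> L2" by simp
    have "ip g g = 0 \<longleftrightarrow> (AE t in I01. g t * g t = 0)"
      unfolding ip_def using g by (intro integral_nonneg_eq_0_iff_AE L2_mult_integrable) auto
    then show "ip g g = 0 \<longleftrightarrow> g \<in> L2 \<and> (\<lambda>t. 0) \<in> L2 \<and> (AE t in I01. g t = 0)"
      using g L2_zero by simp
  qed
  show "norm x = sqrt (inner x x)" by (rule norm_L2_class_def)
qed

end

lemma L2_class_of_surj: "\<exists>g\<in>L2. x = L2_class_of g"
  using Quotient3_abs_rep[OF Quotient3_L2_class] Quotient3_rep_reflp[OF Quotient3_L2_class]
  by metis

lemma L2_class_of_eq_iff:
  "g \<in> L2 \<Longrightarrow> h \<in> L2 \<Longrightarrow> L2_class_of g = L2_class_of h \<longleftrightarrow> (AE t in I01. g t = h t)"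
  using Quotient3_rel[OF Quotient3_L2_class, of g h] by auto

lemma L2_class_of_zero: "L2_class_of (\<lambda>t. 0) = 0"
  by (simp add: zero_L2_class_def)

lemma L2_class_of_add: "g \<in> L2 \<Longrightarrow> h \<in> L2 \<Longrightarrow> L2_class_of (\<lambda>t. g t + h t) = L2_class_of g + L2_class_of h"
  by (simp add: plus_L2_class.abs_eq)

lemma L2_class_of_diff: "g \<in> L2 \<Longrightarrow> h \<in> L2 \<Longrightarrow> L2_class_of (\<lambda>t. g t - h t) = L2_class_of g - L2_class_of h"
  by (simp add: minus_L2_class.abs_eq)

lemma L2_class_of_scale: "g \<in> L2 \<Longrightarrow> L2_class_of (\<lambda>t. a * g t) = a *\<^sub>R L2_class_of g"
  by (simp add: scaleR_L2_class.abs_eq)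

lemma L2_class_of_sum:
  "(\<And>i. i \<in> A \<Longrightarrow> g i \<in> L2) \<Longrightarrow> L2_class_of (\<lambda>t. \<Sum>i\<in>A. g i t) = (\<Sum>i\<in>A. L2_class_of (g i))"
  by (induction A rule: infinite_finite_induct) (auto simp: L2_class_of_zero L2_class_of_add L2_sum)

lemma inner_L2_class_of: "g \<in> L2 \<Longrightarrow> h \<in> L2 \<Longrightarrow> inner (L2_class_of g) (L2_class_of h) = ip g h"
  by (simp add: inner_L2_class.abs_eq)

lemma norm_L2_class_of: "g \<in> L2 \<Longrightarrow> norm (L2_class_of g) = L2norm g"
  by (simp add: norm_eq_sqrt_inner inner_L2_class_of L2norm_def ip_def power2_eq_square)

section \<open>Completeness of the function space\<close>

lemma L2norm_nonneg [simp]: "0 \<le> L2norm g"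
  by (simp add: L2norm_def)

text \<open>The unit interval has measure one, so the Cauchy--Schwarz inequality against the constant
  function \<open>1\<close> makes \<open>L\<^sup>2\<close> convergence imply \<open>L\<^sup>1\<close> convergence.\<close>

lemma integral_abs_le_L2norm:
  assumes "g \<in> L2"
  shows "integrable I01 g" "(\<integral>t. \<bar>g t\<bar> \<partial>I01) \<le> L2norm g"
proof -
  have 1: "(\<lambda>t. 1) \<in> L2" by (rule L2_bounded[where c=1]) auto
  have a: "(\<lambda>t. \<bar>g t\<bar>) \<in> L2" using assms by (auto simp: L2_def)
  show "integrable I01 g"
    using L2_mult_integrable[OF assms 1] by simp
  have "inner (L2_class_of (\<lambda>t. \<bar>g t\<bar>)) (L2_class_of (\<lambda>t. 1)) \<le> L2norm (\<lambda>t. \<bar>g t\<bar>) * L2norm (\<lambda>t. 1)"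
    using norm_cauchy_schwarz[of "L2_class_of (\<lambda>t. \<bar>g t\<bar>)" "L2_class_of (\<lambda>t. 1)"]
    by (simp add: norm_L2_class_of 1 a)
  moreover have "L2norm (\<lambda>t. 1) = 1" "L2norm (\<lambda>t. \<bar>g t\<bar>) = L2norm g"
    using I01.prob_space by (simp_all add: L2norm_def)
  ultimately show "(\<integral>t. \<bar>g t\<bar> \<partial>I01) \<le> L2norm g"
    by (simp add: inner_L2_class_of 1 a ip_def)
qed

lemma dist_L2_class_of: "g \<in> L2 \<Longrightarrow> h \<in> L2 \<Longrightarrow> dist (L2_class_of g) (L2_class_of h) = L2norm (\<lambda>t. g t - h t)"
  by (simp add: dist_norm norm_L2_class_of L2_diff flip: L2_class_of_diff)

lemma nn_integral_square_L2: "g \<in> L2 \<Longrightarrow> (\<integral>\<^sup>+t. ennreal ((g t)\<^sup>2) \<partial>I01) = ennreal ((L2norm g)\<^sup>2)"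
  by (simp add: nn_integral_eq_integral L2_square_integrable L2norm_def)

text \<open>Riesz--Fischer: an \<open>L\<^sup>2\<close> Cauchy sequence is \<open>L\<^sup>1\<close> Cauchy, so a subsequence converges almost
  everywhere, and by Fatou's lemma the pointwise limit is also the \<open>L\<^sup>2\<close> limit.\<close>

instance L2_class :: complete_space
proof
  fix X :: "nat \<Rightarrow> L2_class" assume X: "Cauchy X"
  obtain g where g: "\<And>n. g n \<in> L2" "\<And>n. X n = L2_class_of (g n)"
    using L2_class_of_surj[of "X _"] by metis
  note [measurable] = L2_measurable[OF g(1)]
  have cauchy: "\<exists>K. \<forall>i\<ge>K. \<forall>j\<ge>K. L2norm (\<lambda>t. g i t - g j t) < e" if "e > 0" for e
    using X that unfolding Cauchy_def g(2) by (simp add: dist_L2_class_of g(1))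
  have "\<exists>K. \<forall>i\<ge>K. \<forall>j\<ge>K. (\<integral>t. norm (g i t - g j t) \<partial>I01) < e" if "e > 0" for e
    using cauchy[OF that]
    by (fastforce intro: le_less_trans[OF integral_abs_le_L2norm(2)[OF L2_diff[OF g(1) g(1)]]])
  then obtain r where r: "strict_mono r" "AE t in I01. Cauchy (\<lambda>k. g (r k) t)"
    using cauchy_L1_AE_cauchy_subseq[of I01 g] integral_abs_le_L2norm(1)[OF g(1)] by blast
  define h where "h t = lim (\<lambda>k. g (r k) t)" for t
  have [measurable]: "h \<in> borel_measurable I01"
    unfolding h_def by measurable
  have conv: "AE t in I01. (\<lambda>k. g (r k) t) \<longlonglongrightarrow> h t"
    using r(2) by eventually_elim (simp add: h_def Cauchy_convergent convergent_LIMSEQ_iff[symmetric])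
  have fatou: "(\<integral>\<^sup>+t. ennreal ((h t - g i t)\<^sup>2) \<partial>I01) \<le> ennreal (e\<^sup>2)"
    if e: "\<And>j. j \<ge> K \<Longrightarrow> L2norm (\<lambda>t. g j t - g i t) \<le> e" for i K e
  proof -
    have "(\<integral>\<^sup>+t. ennreal ((h t - g i t)\<^sup>2) \<partial>I01)
        = (\<integral>\<^sup>+t. liminf (\<lambda>k. ennreal ((g (r k) t - g i t)\<^sup>2)) \<partial>I01)"
      using conv by (intro nn_integral_cong_AE, eventually_elim)
        (intro lim_imp_Liminf[symmetric] tendsto_ennrealI tendsto_intros, auto)
    also have "\<dots> \<le> liminf (\<lambda>k. \<integral>\<^sup>+t. ennreal ((g (r k) t - g i t)\<^sup>2) \<partial>I01)"
      by (intro nn_integral_liminf) auto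
    also have "\<dots> \<le> ennreal (e\<^sup>2)"
    proof (intro Liminf_le eventually_sequentiallyI[of K])
      fix k assume "K \<le> k"
      then have "r k \<ge> K" using r(1) seq_suble[of r k] by simp
      then have "L2norm (\<lambda>t. g (r k) t - g i t) \<le> e" by (rule e)
      moreover have "0 \<le> L2norm (\<lambda>t. g (r k) t - g i t)" by (simp add: L2norm_def)
      ultimately show "(\<integral>\<^sup>+t. ennreal ((g (r k) t - g i t)\<^sup>2) \<partial>I01) \<le> ennreal (e\<^sup>2)"
        by (simp add: nn_integral_square_L2 L2_diff g(1) ennreal_leI power_mono)
    qed auto
    finally show ?thesis .
  qed
  have diff: "(\<lambda>t. h t - g i t) \<in> L2" if "\<And>j. j \<ge> K \<Longrightarrow> L2norm (\<lambda>t. g j t - g i t) \<le> e" for i K e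
    unfolding L2_def using fatou[OF that] by (auto intro!: integrableI_nonneg simp: less_top[symmetric] top_unique)
  obtain K1 where K1: "\<And>i j. i \<ge> K1 \<Longrightarrow> j \<ge> K1 \<Longrightarrow> L2norm (\<lambda>t. g i t - g j t) < 1"
    using cauchy[of 1] by auto
  have "(\<lambda>t. h t - g K1 t) \<in> L2"
    by (rule diff[of K1 _ 1]) (use K1 in \<open>auto intro: less_imp_le\<close>)
  from L2_add[OF this g(1)[of K1]] have h: "h \<in> L2" by simp
  have "X \<longlonglongrightarrow> L2_class_of h"
    unfolding lim_sequentially
  proof (intro allI impI)
    fix e :: real assume e: "e > 0"
    obtain K where K: "\<And>i j. i \<ge> K \<Longrightarrow> j \<ge> K \<Longrightarrow> L2norm (\<lambda>t. g i t - g j t) < e / 2"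
      using cauchy[of "e/2"] e by auto
    have "dist (X i) (L2_class_of h) < e" if "i \<ge> K" for i
    proof -
      have "ennreal ((L2norm (\<lambda>t. h t - g i t))\<^sup>2) \<le> ennreal ((e/2)\<^sup>2)"
        using fatou[of K i "e/2"] K[OF _ that] by (auto simp: nn_integral_square_L2 L2_diff g(1) h less_imp_le)
      then have "L2norm (\<lambda>t. h t - g i t) \<le> e/2"
        using e by (simp add: abs_le_square_iff[symmetric] L2norm_nonneg)
      then have "dist (L2_class_of h) (X i) < e"
        using e by (simp add: g(2) dist_L2_class_of g(1) h)
      then show ?thesis
        by (simp add: dist_commute)
    qed
    then show "\<exists>K. \<forall>i\<ge>K. dist (X i) (L2_class_of h) < e" by blast
  qed
  then show "convergent X" by (auto simp: convergent_def)
qed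

instance L2_class :: banach ..

section \<open>Separability and the Borel sets of the function space\<close>

lemma tendsto_L2norm_dominated:
  assumes g: "g \<in> L2" and u: "\<And>n. u n \<in> borel_measurable I01" and B: "B \<in> L2"
    and conv: "AE t in I01. (\<lambda>n. u n t) \<longlonglongrightarrow> g t"
    and bound: "\<And>n. AE t in I01. \<bar>u n t\<bar> \<le> B t"
  shows "(\<lambda>n. L2norm (\<lambda>t. g t - u n t)) \<longlonglongrightarrow> 0"
proof -
  note [measurable] = L2_measurable[OF g] L2_measurable[OF B] u
  have B': "(\<lambda>t. \<bar>g t\<bar> + B t) \<in> L2"
    by (intro L2_add B) (use g in \<open>auto simp: L2_def\<close>)
  have "(\<lambda>n. \<integral>t. (g t - u n t)\<^sup>2 \<partial>I01) \<longlonglongrightarrow> (\<integral>t. 0 \<partial>I01)"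
  proof (rule integral_dominated_convergence)
    show "integrable I01 (\<lambda>t. (\<bar>g t\<bar> + B t)\<^sup>2)" using B' by (rule L2_square_integrable)
    show "AE t in I01. (\<lambda>n. (g t - u n t)\<^sup>2) \<longlonglongrightarrow> 0"
      using conv
    proof eventually_elim
      case (elim t)
      have "(\<lambda>n. (g t - u n t)\<^sup>2) \<longlonglongrightarrow> (g t - g t)\<^sup>2"
        by (intro tendsto_intros elim)
      then show ?case by simp
    qed
    show "AE t in I01. norm ((g t - u n t)\<^sup>2) \<le> (\<bar>g t\<bar> + B t)\<^sup>2" for n
      using bound[of n]
    proof eventually_elim
      case (elim t)
      then have "\<bar>g t - u n t\<bar> \<le> \<bar>\<bar>g t\<bar> + B t\<bar>" by linarith
      then show ?case by (simp add: abs_le_square_iff)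
    qed
  qed auto
  then have "(\<lambda>n. sqrt (\<integral>t. (g t - u n t)\<^sup>2 \<partial>I01)) \<longlonglongrightarrow> sqrt 0"
    by (intro tendsto_real_sqrt) simp
  then show ?thesis by (simp add: L2norm_def)
qed

lemma L2_approx_bounded:
  assumes g: "g \<in> L2" and e: "e > 0"
  obtains k :: nat where "L2norm (\<lambda>t. g t - max (- real k) (min (real k) (g t))) < e"
proof -
  note [measurable] = L2_measurable[OF g]
  have "(\<lambda>k. L2norm (\<lambda>t. g t - max (- real k) (min (real k) (g t)))) \<longlonglongrightarrow> 0"
  proof (rule tendsto_L2norm_dominated[where B="\<lambda>t. \<bar>g t\<bar>"])
    show "(\<lambda>t. \<bar>g t\<bar>) \<in> L2" using g by (auto simp: L2_def)
    show "AE t in I01. (\<lambda>k. max (- real k) (min (real k) (g t))) \<longlonglongrightarrow> g t"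
    proof (intro AE_I2 tendsto_eventually)
      fix t
      obtain K :: nat where K: "\<bar>g t\<bar> \<le> real K" using real_arch_simple by blast
      show "eventually (\<lambda>k. max (- real k) (min (real k) (g t)) = g t) sequentially"
      proof (rule eventually_sequentiallyI[of K])
        fix k assume "K \<le> k"
        then have "\<bar>g t\<bar> \<le> real k" using K by linarith
        then show "max (- real k) (min (real k) (g t)) = g t" by auto
      qed
    qed
    show "AE t in I01. \<bar>max (- real k) (min (real k) (g t))\<bar> \<le> \<bar>g t\<bar>" for k :: nat
      by (auto simp: max_def min_def)
  qed (auto simp: g)
  then have "eventually (\<lambda>k. L2norm (\<lambda>t. g t - max (- real k) (min (real k) (g t))) < e) sequentially"
    using e by (rule order_tendstoD)
  then show ?thesis using that by (auto simp: eventually_sequentially)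
qed

text \<open>Lebesgue measurable functions are almost everywhere limits of continuous ones; clipping the
  continuous functions at the bound of \<open>g\<close> allows dominated convergence.\<close>

lemma L2_approx_continuous_of_bounded:
  assumes g: "g \<in> borel_measurable I01" and c: "\<And>t. \<bar>g t\<bar> \<le> c" and e: "e > 0"
  obtains u where "continuous_on UNIV u" "L2norm (\<lambda>t. g t - u t) < e"
proof -
  define G where "G t = (if t \<in> {0..1} then g t else 0)" for t :: real
  have c0: "0 \<le> c" using c[of 0] by linarith
  have "G \<in> borel_measurable lborel"
  proof -
    have "G = (\<lambda>t. indicator {0..1} t *\<^sub>R g t)" by (auto simp: G_def)
    then show ?thesis using g by (simp add: borel_measurable_restrict_space_iff)
  qed
  then have "G \<in> borel_measurable lebesgue"
    by (rule measurable_completion)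
  then have "G measurable_on UNIV"
    using lebesgue_measurable_imp_measurable_on[of G UNIV] by simp
  then obtain N u where N: "negligible N" and u: "\<And>n. continuous_on UNIV (u n)"
      "\<And>t. t \<notin> N \<Longrightarrow> (\<lambda>n. u n t) \<longlonglongrightarrow> G t"
    unfolding measurable_on_def by auto
  define w where "w n t = max (- c) (min c (u n t))" for n :: nat and t
  have w: "continuous_on UNIV (w n)" for n
    unfolding w_def by (intro continuous_intros u)
  have wm: "w n \<in> borel_measurable I01" for n
    using w[of n] by (intro measurable_restrict_space1) (simp add: borel_measurable_continuous_onI)
  have "AE t in lebesgue. t \<notin> N"
    using N by (simp add: AE_iff_null_sets negligible_iff_null_sets AE_not_in)
  then have "AE t in lborel. t \<notin> N" by (simp add: AE_completion_iff)
  then have N': "AE t in I01. t \<notin> N" by (subst AE_restrict_space_iff) auto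
  have gL2: "g \<in> L2" using g c by (intro L2_bounded)
  have "(\<lambda>n. L2norm (\<lambda>t. g t - w n t)) \<longlonglongrightarrow> 0"
  proof (rule tendsto_L2norm_dominated[where B="\<lambda>t. c"])
    show "(\<lambda>t. c) \<in> L2" by (rule L2_bounded) auto
    show "AE t in I01. (\<lambda>n. w n t) \<longlonglongrightarrow> g t"
      using N' AE_space
    proof eventually_elim
      case (elim t)
      then have "(\<lambda>n. w n t) \<longlonglongrightarrow> max (- c) (min c (g t))"
        unfolding w_def using u(2)[of t] by (intro tendsto_intros) (simp add: G_def)
      moreover have "max (- c) (min c (g t)) = g t" using c[of t] by auto
      ultimately show ?case by simp
    qed
    show "AE t in I01. \<bar>w n t\<bar> \<le> c" for n using c0 by (auto simp: w_def)
  qed (auto simp: gL2 wm)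
  then have "eventually (\<lambda>n. L2norm (\<lambda>t. g t - w n t) < e) sequentially"
    using e by (rule order_tendstoD)
  then show ?thesis using that w by (auto simp: eventually_sequentially)
qed

text \<open>Step functions with rational values on the grid of width \<open>1/m\<close>. They are parametrised by a
  countable set, and the values beyond the end of the list are \<open>0\<close> to keep the function bounded.\<close>

definition rational_step :: "nat \<Rightarrow> rat list \<Rightarrow> real \<Rightarrow> real" where
  "rational_step m Q t = (let k = nat \<lfloor>real m * t\<rfloor> in if k < length Q then of_rat (Q ! k) else 0)"

lemma rational_step_L2: "rational_step m Q \<in> L2"
proof (rule L2_bounded)
  have "(\<lambda>t. (\<lambda>k. if k < length Q then real_of_rat (Q ! k) else 0) (nat \<lfloor>real m * t\<rfloor>)) \<in> borel_measurable borel"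
    by measurable
  then show "rational_step m Q \<in> borel_measurable I01"
    unfolding rational_step_def Let_def by (intro measurable_restrict_space1) simp
  show "\<bar>rational_step m Q t\<bar> \<le> (\<Sum>k<length Q. \<bar>of_rat (Q ! k)\<bar>)" for t
    using member_le_sum[of "nat \<lfloor>real m * t\<rfloor>" "{..<length Q}" "\<lambda>k. \<bar>real_of_rat (Q ! k)\<bar>"]
    by (auto simp: rational_step_def Let_def sum_nonneg)
qed

lemma rational_step_approx:
  assumes u: "continuous_on {0..1} u" and e: "e > 0"
  obtains m Q where "\<And>t. t \<in> {0..1} \<Longrightarrow> \<bar>u t - rational_step m Q t\<bar> \<le> e"
proof -
  have "uniformly_continuous_on {0..1} u"
    using u by (intro compact_uniformly_continuous) auto
  from this[unfolded uniformly_continuous_on_def, rule_format, OF half_gt_zero[OF e]]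
  obtain s where s: "s > 0"
    "\<And>t t'. t \<in> {0..1} \<Longrightarrow> t' \<in> {0..1} \<Longrightarrow> dist t' t < s \<Longrightarrow> dist (u t') (u t) < e/2"
    by blast
  obtain m :: nat where m: "1 / s < real m" using reals_Archimedean2 by blast
  moreover have "0 < 1 / s" using s(1) by simp
  ultimately have m0: "0 < real m" by linarith
  have ms: "1 / real m < s" using m m0 s(1) by (simp add: field_simps)
  have "\<exists>x. \<bar>u (real k / real m) - of_rat x\<bar> < e/2" for k :: nat
  proof -
    have "u (real k / real m) - e/2 < u (real k / real m) + e/2" using e by linarith
    then obtain x where "u (real k / real m) - e/2 < of_rat x" "of_rat x < u (real k / real m) + e/2"
      using of_rat_dense by blast
    then have "\<bar>u (real k / real m) - of_rat x\<bar> < e/2" by linarith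
    then show ?thesis by blast
  qed
  then obtain x where x: "\<And>k::nat. \<bar>u (real k / real m) - of_rat (x k)\<bar> < e/2" by metis
  \<comment> \<open>The list has \<open>m + 1\<close> entries because \<open>t = 1\<close> falls into the cell with index \<open>m\<close>.\<close>
  have "\<bar>u t - rational_step m (map x [0..<Suc m]) t\<bar> \<le> e" if t: "t \<in> {0..1}" for t
  proof -
    define k where "k = nat \<lfloor>real m * t\<rfloor>"
    have fl: "real k \<le> real m * t" "real m * t < real k + 1"
    proof -
      have "0 \<le> real m * t" using t m0 by simp
      then have "real k = of_int \<lfloor>real m * t\<rfloor>" by (simp add: k_def)
      then show "real k \<le> real m * t" "real m * t < real k + 1" by linarith+
    qed
    have "real m * t \<le> real m * 1" using t by (intro mult_left_mono) auto
    then have km: "k \<le> m" using fl(1) by linarith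
    have step: "rational_step m (map x [0..<Suc m]) t = of_rat (x k)"
      using km by (simp add: rational_step_def Let_def flip: k_def del: upt_Suc)
    have "\<bar>real k / real m - t\<bar> < s"
    proof -
      have "real k / real m \<le> t" "t < real k / real m + 1 / real m"
        using fl m0 by (simp_all add: pos_divide_le_eq pos_less_divide_eq mult.commute flip: add_divide_distrib)
      then show ?thesis using ms by linarith
    qed
    then have "\<bar>u (real k / real m) - u t\<bar> < e/2"
      using s(2)[OF t, of "real k / real m"] km m0 by (simp add: dist_real_def)
    then show ?thesis using x[of k] unfolding step by linarith
  qed
  then show ?thesis by (rule that)
qed

lemma L2norm_le_bound:
  assumes "g \<in> L2" "\<And>t. t \<in> {0..1} \<Longrightarrow> \<bar>g t\<bar> \<le> c" "0 \<le> c"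
  shows "L2norm g \<le> c"
proof -
  have "(\<integral>t. (g t)\<^sup>2 \<partial>I01) \<le> (\<integral>t. c\<^sup>2 \<partial>I01)"
    using assms by (intro integral_mono L2_square_integrable L2_bounded[where g="\<lambda>t. c"])
      (auto simp: abs_le_square_iff[symmetric])
  then have "(\<integral>t. (g t)\<^sup>2 \<partial>I01) \<le> c\<^sup>2" using I01.prob_space by simp
  then show ?thesis using assms(3) by (simp add: L2norm_def real_le_lsqrt)
qed

text \<open>Three approximations, each within a third of the tolerance: by a bounded function, by a
  continuous one, and by a rational step function.\<close>

lemma rational_step_dense: "e > 0 \<Longrightarrow> \<exists>m Q. dist x (L2_class_of (rational_step m Q)) < e"
proof -
  assume e: "e > 0"
  obtain g where g: "g \<in> L2" and x: "x = L2_class_of g" using L2_class_of_surj by blast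
  obtain k :: nat where k: "L2norm (\<lambda>t. g t - max (- real k) (min (real k) (g t))) < e/3"
    using L2_approx_bounded[OF g, of "e/3"] e by auto
  define g' where "g' t = max (- real k) (min (real k) (g t))" for t
  note [measurable] = L2_measurable[OF g]
  have g'm: "g' \<in> borel_measurable I01" unfolding g'_def by measurable
  have g'b: "\<bar>g' t\<bar> \<le> real k" for t by (auto simp: g'_def)
  have g': "g' \<in> L2" by (rule L2_bounded[OF g'm g'b])
  obtain u where u: "continuous_on UNIV u" "L2norm (\<lambda>t. g' t - u t) < e/3"
    using L2_approx_continuous_of_bounded[OF g'm g'b, of "e/3"] e by auto
  have u01: "continuous_on {0..1} u" using u(1) continuous_on_subset by blast
  have "compact (u ` {0..1})" by (intro compact_continuous_image u01) simp
  then obtain B where B: "\<And>t. t \<in> {0..1} \<Longrightarrow> \<bar>u t\<bar> \<le> B"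
    using compact_imp_bounded bounded_real by (metis imageI)
  have um: "u \<in> borel_measurable I01"
    using u(1) by (intro measurable_restrict_space1) (simp add: borel_measurable_continuous_onI)
  have uL: "u \<in> L2" by (rule L2_bounded[OF um B])
  obtain m Q where Q: "\<And>t. t \<in> {0..1} \<Longrightarrow> \<bar>u t - rational_step m Q t\<bar> \<le> e/3"
    using rational_step_approx[OF u01, of "e/3"] e by auto
  have "L2norm (\<lambda>t. u t - rational_step m Q t) \<le> e/3"
    using Q e by (intro L2norm_le_bound L2_diff uL rational_step_L2) auto
  then have "dist (L2_class_of u) (L2_class_of (rational_step m Q)) \<le> e/3"
    by (simp add: dist_L2_class_of uL rational_step_L2)
  moreover have "dist (L2_class_of g) (L2_class_of g') < e/3"
    using k by (simp add: dist_L2_class_of g g' g'_def)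
  moreover have "dist (L2_class_of g') (L2_class_of u) < e/3"
    using u(2) by (simp add: dist_L2_class_of uL g')
  ultimately have "dist x (L2_class_of (rational_step m Q)) < e"
    unfolding x using dist_triangle[of "L2_class_of g" "L2_class_of (rational_step m Q)" "L2_class_of g'"]
      dist_triangle[of "L2_class_of g'" "L2_class_of (rational_step m Q)" "L2_class_of u"] by linarith
  then show ?thesis by blast
qed

instance L2_class :: second_countable_topology
proof
  define B where "B = (\<lambda>(m, Q, k). ball (L2_class_of (rational_step m Q)) (inverse (real (Suc k)))) ` (UNIV :: (nat \<times> rat list \<times> nat) set)"
  have "topological_basis B"
  proof (rule topological_basisI)
    show "open b" if "b \<in> B" for b using that by (auto simp: B_def)
    fix U :: "L2_class set" and x assume "open U" "x \<in> U"
    then obtain e where e: "e > 0" "ball x e \<subseteq> U" by (meson openE)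
    obtain k where k: "inverse (real (Suc k)) < e/2" using e(1) reals_Archimedean[of "e/2"] by auto
    obtain m Q where Q: "dist x (L2_class_of (rational_step m Q)) < inverse (real (Suc k))"
      using rational_step_dense[of "inverse (real (Suc k))" x] by auto
    have "ball (L2_class_of (rational_step m Q)) (inverse (real (Suc k))) \<subseteq> ball x e"
    proof
      fix y assume "y \<in> ball (L2_class_of (rational_step m Q)) (inverse (real (Suc k)))"
      then show "y \<in> ball x e"
        using Q k dist_triangle[of x y "L2_class_of (rational_step m Q)"] by simp
    qed
    moreover have "ball (L2_class_of (rational_step m Q)) (inverse (real (Suc k))) \<in> B"
      unfolding B_def by (rule image_eqI[of _ _ "(m, Q, k)"]) simp_all
    moreover have "x \<in> ball (L2_class_of (rational_step m Q)) (inverse (real (Suc k)))"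
      using Q by (simp add: dist_commute)
    ultimately show "\<exists>B'\<in>B. x \<in> B' \<and> B' \<subseteq> U"
      using e(2) by blast
  qed
  moreover have "countable B" unfolding B_def by (intro countable_image) simp
  ultimately show "\<exists>B::L2_class set set. countable B \<and> open = generate_topology B"
    using topological_basis_imp_subbasis by blast
qed

lemma space_borel_L2: "space borel_L2 = L2"
  unfolding borel_L2_def by (rule space_measure_of) blast

lemma sets_borel_L2I:
  assumes "U \<subseteq> L2" "\<And>g. g \<in> U \<Longrightarrow> \<exists>e>0. \<forall>h\<in>L2. L2norm (\<lambda>t. h t - g t) < e \<longrightarrow> h \<in> U"
  shows "U \<in> sets borel_L2"
proof -
  have *: "{U. U \<subseteq> L2 \<and> (\<forall>g\<in>U. \<exists>e>0. \<forall>h\<in>L2. L2norm (\<lambda>t. h t - g t) < e \<longrightarrow> h \<in> U)} \<subseteq> Pow L2"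
    by blast
  show ?thesis
    unfolding borel_L2_def sets_measure_of[OF *]
    by (rule sigma_sets.Basic) (use assms in blast)
qed

text \<open>The generators of \<open>borel_L2\<close> are the preimages of the norm-open sets of classes, so a measurable
  map into \<open>borel_L2\<close> becomes a Borel random element of a separable Hilbert space.\<close>

lemma measurable_L2_class_of [measurable]: "L2_class_of \<in> borel_measurable borel_L2"
proof (rule borel_measurableI)
  fix U :: "L2_class set" assume U: "open U"
  have "{g \<in> L2. L2_class_of g \<in> U} \<in> sets borel_L2"
  proof (rule sets_borel_L2I)
    fix g assume g: "g \<in> {g \<in> L2. L2_class_of g \<in> U}"
    then have "L2_class_of g \<in> U" by blast
    with U obtain e where e: "e > 0" "ball (L2_class_of g) e \<subseteq> U" by (rule openE)
    have "L2_class_of h \<in> U" if "h \<in> L2" "L2norm (\<lambda>t. h t - g t) < e" for h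
    proof -
      have "dist (L2_class_of h) (L2_class_of g) < e" using that g by (simp add: dist_L2_class_of)
      then have "L2_class_of h \<in> ball (L2_class_of g) e" by (simp add: dist_commute)
      then show ?thesis using e(2) by blast
    qed
    then show "\<exists>e>0. \<forall>h\<in>L2. L2norm (\<lambda>t. h t - g t) < e \<longrightarrow> h \<in> {g \<in> L2. L2_class_of g \<in> U}"
      using e(1) by blast
  qed blast
  moreover have "L2_class_of -` U \<inter> space borel_L2 = {g \<in> L2. L2_class_of g \<in> U}"
    unfolding space_borel_L2 by blast
  ultimately show "L2_class_of -` U \<inter> space borel_L2 \<in> sets borel_L2" by (simp only:)
qed

section \<open>Perturbation of the eigenvectors of a quadratic form\<close>

text \<open>A homogeneous system with \<open>k\<close> equations and \<open>k + 1\<close> unknowns has a nontrivial solution; a zero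
  row makes the coefficient matrix square and singular. In Weyl's inequality this gives a
  nonzero vector in the span of \<open>k + 1\<close> eigenvectors that is orthogonal to \<open>k\<close> prescribed vectors.\<close>

lemma underdetermined_system:
  fixes a :: "nat \<Rightarrow> nat \<Rightarrow> real"
  shows "\<exists>c. (\<exists>j<Suc k. c j \<noteq> 0) \<and> (\<forall>i<k. (\<Sum>j<Suc k. a i j * c j) = 0)"
proof -
  define A where "A = mat\<^sub>r (Suc k) (Suc k) (\<lambda>i. if i = k then 0\<^sub>v (Suc k) else vec (Suc k) (a i))"
  have A: "A \<in> carrier_mat (Suc k) (Suc k)" by (simp add: A_def)
  have "\<exists>x. x \<in> carrier_vec (Suc k) \<and> x \<noteq> 0\<^sub>v (Suc k) \<and> A *\<^sub>v x = 0\<^sub>v (Suc k)"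
  proof -
    have "det A = 0" unfolding A_def by (rule det_row_0) auto
    then show ?thesis using det_0_iff_vec_prod_zero[OF A] by blast
  qed
  then obtain x where x: "x \<in> carrier_vec (Suc k)" "x \<noteq> 0\<^sub>v (Suc k)" "A *\<^sub>v x = 0\<^sub>v (Suc k)"
    by blast
  have nz: "\<exists>j<Suc k. x $ j \<noteq> 0"
  proof (rule ccontr)
    assume "\<not> ?thesis"
    then have "x = 0\<^sub>v (Suc k)" using x(1) by (intro eq_vecI) auto
    then show False using x(2) by blast
  qed
  have "(\<Sum>j<Suc k. a i j * x $ j) = 0" if i: "i < k" for i
  proof -
    have "(A *\<^sub>v x) $ i = (\<Sum>j<Suc k. a i j * x $ j)"
      using i x(1) by (auto simp: A_def scalar_prod_def lessThan_atLeast0 intro!: sum.cong)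
    then show ?thesis using i by (simp add: x(3))
  qed
  with nz show ?thesis by (intro exI[of _ "\<lambda>j. x $ j"]) blast
qed

text \<open>A positive form with a decreasing system of eigenvectors, exhaustive in the sense that the form
  vanishes on the orthogonal complement of the eigenvectors. Working with the form \<open>\<langle>T x, y\<rangle>\<close> in place of
  the operator \<open>T\<close> makes it unnecessary to know that \<open>T\<close> maps the space into itself.\<close>

locale eigen_form =
  fixes B :: "'a :: {real_inner, banach} \<Rightarrow> 'a \<Rightarrow> real" and lam :: "nat \<Rightarrow> real" and v :: "nat \<Rightarrow> 'a"
  assumes bounded_bilinear: "bounded_bilinear B"
    and sym: "B x y = B y x"
    and nonneg: "0 \<le> B x x"
    and orthonormal: "inner (v i) (v j) = (if i = j then 1 else 0)"
    and eigen: "B (v i) y = lam i * inner (v i) y"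
    and decreasing: "decseq lam"
    and exhaustive: "(\<And>i. inner x (v i) = 0) \<Longrightarrow> B x y = 0"
begin

sublocale B: bounded_bilinear B by (rule bounded_bilinear)

definition proj :: "nat \<Rightarrow> 'a \<Rightarrow> 'a" where
  "proj k x = (\<Sum>j<k. inner x (v j) *\<^sub>R v j)"

lemma norm_v: "norm (v i) = 1"
  by (simp add: norm_eq_sqrt_inner orthonormal)

lemma lam_nonneg: "0 \<le> lam i"
  using nonneg[of "v i"] by (simp add: eigen orthonormal)

lemma inner_sum_v: "finite A \<Longrightarrow> inner (\<Sum>j\<in>A. c j *\<^sub>R v j) (v i) = (if i \<in> A then c i else 0)"
  by (simp add: inner_sum_left orthonormal if_distrib[of "\<lambda>x. _ * x"] sum.delta cong: if_cong)

lemma norm_sum_v: "finite A \<Longrightarrow> (norm (\<Sum>j\<in>A. c j *\<^sub>R v j))\<^sup>2 = (\<Sum>j\<in>A. (c j)\<^sup>2)"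
proof -
  assume A: "finite A"
  define S where "S = (\<Sum>j\<in>A. c j *\<^sub>R v j)"
  have "inner S S = (\<Sum>j\<in>A. c j * inner S (v j))"
    by (subst (2) S_def) (simp add: inner_sum_right)
  also have "\<dots> = (\<Sum>j\<in>A. (c j)\<^sup>2)"
    using A by (simp add: S_def inner_sum_v power2_eq_square)
  finally show ?thesis by (simp add: power2_norm_eq_inner S_def)
qed

lemma B_sum_v: "finite A \<Longrightarrow> B (\<Sum>j\<in>A. c j *\<^sub>R v j) y = (\<Sum>j\<in>A. lam j * (c j * inner (v j) y))"
  by (simp add: B.sum_left B.scaleR_left eigen mult.left_commute)

lemma inner_proj: "inner (proj k x) (v j) = (if j < k then inner x (v j) else 0)"
  by (simp add: proj_def inner_sum_v)

lemma bessel: "(\<Sum>j<k. (inner x (v j))\<^sup>2) \<le> (norm x)\<^sup>2"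
proof -
  have "inner (proj k x) x = (\<Sum>j<k. (inner x (v j))\<^sup>2)"
    by (simp add: inner_commute[of _ x] proj_def inner_sum_right power2_eq_square)
  moreover have "(norm (proj k x))\<^sup>2 = (\<Sum>j<k. (inner x (v j))\<^sup>2)"
    by (simp add: proj_def norm_sum_v)
  moreover have "0 \<le> (norm (x - proj k x))\<^sup>2" by simp
  ultimately show ?thesis
    by (simp add: power2_norm_eq_inner inner_diff_left inner_diff_right inner_commute)
qed

lemma proj_convergent: "convergent (\<lambda>k. proj k x)"
proof -
  have "summable (\<lambda>j. (inner x (v j))\<^sup>2)"
    by (rule summableI_nonneg_bounded[OF _ bessel]) simp
  then have cau: "Cauchy (\<lambda>k. \<Sum>j<k. (inner x (v j))\<^sup>2)"
    by (rule LIMSEQ_imp_Cauchy[OF summable_LIMSEQ])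
  have "Cauchy (\<lambda>k. proj k x)"
  proof (rule CauchyI')
    fix e :: real assume e: "e > 0"
    then have "0 < e\<^sup>2" by simp
    from metric_CauchyD[OF cau this]
    obtain K where K: "\<And>m n. m \<ge> K \<Longrightarrow> n \<ge> K \<Longrightarrow>
        dist (\<Sum>j<m. (inner x (v j))\<^sup>2) (\<Sum>j<n. (inner x (v j))\<^sup>2) < e\<^sup>2"
      by blast
    have "dist (proj m x) (proj n x) < e" if "m \<ge> K" "n > m" for m n
    proof -
      have split: "{..<n} = {..<m} \<union> {m..<n}" using that by auto
      have "proj n x - proj m x = (\<Sum>j\<in>{m..<n}. inner x (v j) *\<^sub>R v j)"
        unfolding proj_def split by (subst sum.union_disjoint) auto
      then have "(norm (proj n x - proj m x))\<^sup>2 = (\<Sum>j\<in>{m..<n}. (inner x (v j))\<^sup>2)"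
        by (simp add: norm_sum_v)
      also have "\<dots> = (\<Sum>j<n. (inner x (v j))\<^sup>2) - (\<Sum>j<m. (inner x (v j))\<^sup>2)"
        unfolding split by (subst sum.union_disjoint) auto
      also have "\<dots> < e\<^sup>2" using K[of m n] that unfolding dist_real_def by linarith
      finally have "(norm (proj m x - proj n x))\<^sup>2 < e\<^sup>2" by (simp add: norm_minus_commute)
      then show ?thesis unfolding dist_norm by (rule power2_less_imp_less[OF _ less_imp_le[OF e]])
    qed
    then show "\<exists>K. \<forall>m\<ge>K. \<forall>n>m. dist (proj m x) (proj n x) < e" by blast
  qed
  then show ?thesis by (rule Cauchy_convergent)
qed

lemma proj_limit:
  obtains s where "(\<lambda>k. proj k x) \<longlonglongrightarrow> s" "\<And>j. inner (x - s) (v j) = 0"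
proof -
  obtain s where s: "(\<lambda>k. proj k x) \<longlonglongrightarrow> s" using proj_convergent by (auto simp: convergent_def)
  have "inner s (v j) = inner x (v j)" for j
  proof (rule LIMSEQ_unique)
    show "(\<lambda>k. inner (proj k x) (v j)) \<longlonglongrightarrow> inner s (v j)" by (intro tendsto_intros s)
    have "eventually (\<lambda>k. inner (proj k x) (v j) = inner x (v j)) sequentially"
      by (rule eventually_sequentiallyI[of "Suc j"]) (simp add: inner_proj)
    then show "(\<lambda>k. inner (proj k x) (v j)) \<longlonglongrightarrow> inner x (v j)" by (rule tendsto_eventually)
  qed
  then show ?thesis using s that by (simp add: inner_diff_left)
qed

text \<open>The half of the variational principle that needs completeness. The Fourier series of \<open>x\<close>
  converges to some \<open>s\<close>, and \<open>x - s\<close> is orthogonal to every eigenvector, so the form does not see it. On the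
  partial sums the form is a sum of \<open>lam j\<close> times squared coefficients, in which only \<open>j \<ge> k\<close>
  occur, and Bessel's inequality bounds it.\<close>

lemma form_le:
  assumes x: "\<And>j. j < k \<Longrightarrow> inner x (v j) = 0"
  shows "B x x \<le> lam k * (norm x)\<^sup>2"
proof -
  obtain s where s: "(\<lambda>n. proj n x) \<longlonglongrightarrow> s" and orth: "\<And>j. inner (x - s) (v j) = 0"
    using proj_limit by blast
  have z: "B (x - s) y = 0" for y by (rule exhaustive) (rule orth)
  have "B x x = B s x" using z[of x] by (simp add: B.diff_left)
  also have "\<dots> = B s s" using z[of s] by (simp add: B.diff_left sym[of s x])
  finally have eq: "B x x = B s s" .
  have "(\<lambda>n. B (proj n x) (proj n x)) \<longlonglongrightarrow> B s s" by (intro B.tendsto s)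
  moreover have "B (proj n x) (proj n x) \<le> lam k * (norm x)\<^sup>2" for n
  proof -
    have "B (proj n x) (proj n x) = (\<Sum>j<n. lam j * (inner x (v j))\<^sup>2)"
      by (subst (1) proj_def) (simp add: B_sum_v inner_commute[of "v _" "proj _ _"] inner_proj power2_eq_square)
    also have "\<dots> \<le> (\<Sum>j<n. lam k * (inner x (v j))\<^sup>2)"
    proof (rule sum_mono)
      fix j
      show "lam j * (inner x (v j))\<^sup>2 \<le> lam k * (inner x (v j))\<^sup>2"
        using x[of j] decseqD[OF decreasing, of k j] by (cases "j < k") (auto intro: mult_right_mono)
    qed
    also have "\<dots> \<le> lam k * (norm x)\<^sup>2"
      using bessel lam_nonneg by (simp add: mult_left_mono flip: sum_distrib_left)
    finally show ?thesis .
  qed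
  ultimately show ?thesis unfolding eq by (intro LIMSEQ_le_const2) auto
qed

lemma form_ge:
  assumes x: "x = (\<Sum>j<k. c j *\<^sub>R v j)" and l: "\<And>j. j < k \<Longrightarrow> l \<le> lam j"
  shows "l * (norm x)\<^sup>2 \<le> B x x"
proof -
  have "B x x = (\<Sum>j<k. lam j * (c j)\<^sup>2)"
    by (subst (1) x) (simp add: x B_sum_v inner_commute[of "v _"] inner_sum_v power2_eq_square)
  moreover have "(norm x)\<^sup>2 = (\<Sum>j<k. (c j)\<^sup>2)" unfolding x by (simp add: norm_sum_v)
  ultimately show ?thesis by (auto simp: sum_distrib_left intro!: sum_mono mult_right_mono l)
qed

end

text \<open>A nonzero vector in the span of the first \<open>k + 1\<close> eigenvectors of \<open>B\<close> that is orthogonal to the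
  first \<open>k\<close> eigenvectors of \<open>B'\<close> has a Rayleigh quotient at least \<open>lam k\<close> for \<open>B\<close> and at most
  \<open>lam' k\<close> for \<open>B'\<close>.\<close>

lemma weyl_one_sided:
  assumes "eigen_form B lam v" "eigen_form B' lam' v'"
    and close: "\<And>x. B x x \<le> B' x x + \<delta> * (norm x)\<^sup>2"
  shows "lam k \<le> lam' k + \<delta>"
proof -
  interpret B: eigen_form B lam v by fact
  interpret B': eigen_form B' lam' v' by fact
  obtain c where c: "\<exists>j<Suc k. c j \<noteq> 0" "\<And>i. i < k \<Longrightarrow> (\<Sum>j<Suc k. inner (v j) (v' i) * c j) = 0"
    using underdetermined_system[of k "\<lambda>i j. inner (v j) (v' i)"] by blast
  define x where "x = (\<Sum>j<Suc k. c j *\<^sub>R v j)"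
  have "(norm x)\<^sup>2 = (\<Sum>j<Suc k. (c j)\<^sup>2)" unfolding x_def by (rule B.norm_sum_v) simp
  also have "\<dots> > 0"
  proof -
    obtain j where "j < Suc k" "c j \<noteq> 0" using c(1) by blast
    then show ?thesis by (intro sum_pos2[of _ j]) auto
  qed
  finally have pos: "(norm x)\<^sup>2 > 0" .
  have orth: "inner x (v' i) = 0" if "i < k" for i
    using c(2)[OF that] by (simp add: x_def inner_sum_left inner_add_left mult.commute)
  have "lam k * (norm x)\<^sup>2 \<le> B x x"
    using decseqD[OF B.decreasing] by (intro B.form_ge[OF x_def]) auto
  also have "\<dots> \<le> B' x x + \<delta> * (norm x)\<^sup>2" by (rule close)
  also have "\<dots> \<le> (lam' k + \<delta>) * (norm x)\<^sup>2"
    using B'.form_le[OF orth] by (simp add: distrib_right)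
  finally show ?thesis using pos by simp
qed

lemma weyl_inequality:
  assumes "eigen_form B lam v" "eigen_form B' lam' v'"
    and close: "\<And>x y. \<bar>B' x y - B x y\<bar> \<le> \<delta> * (norm x * norm y)"
  shows "\<bar>lam' k - lam k\<bar> \<le> \<delta>"
proof -
  have c: "\<bar>B' x x - B x x\<bar> \<le> \<delta> * (norm x)\<^sup>2" for x using close[of x x] by (simp add: power2_eq_square)
  have "lam k \<le> lam' k + \<delta>"
    by (rule weyl_one_sided[OF assms(1,2)]) (use c in \<open>simp add: abs_le_iff algebra_simps\<close>)
  moreover have "lam' k \<le> lam k + \<delta>"
    by (rule weyl_one_sided[OF assms(2,1)]) (use c in \<open>simp add: abs_le_iff algebra_simps\<close>)
  ultimately show ?thesis by linarith
qed

text \<open>Let \<open>w\<close> be the perturbed eigenvector and split it as \<open>a v\<^sub>i + r1 + r2\<close>, where \<open>r1\<close> lies in the span of the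
  earlier eigenvectors and \<open>r2\<close> is orthogonal to \<open>v\<^sub>0, \<dots>, v\<^sub>i\<close>. By Weyl's inequality the functional
  \<open>y \<mapsto> B w y - lam i \<langle>w, y\<rangle>\<close> is at most \<open>2 \<delta> \<parallel>y\<parallel>\<close>. On the other hand \<open>B - lam i\<close> is at least \<open>\<gamma>\<close>
  on \<open>r1\<close> and at most \<open>- \<gamma>\<close> on \<open>r2\<close>, so testing with the reflected residual \<open>r1 - r2\<close> lets both
  gaps contribute with the same sign and yields \<open>\<gamma> \<parallel>r1 + r2\<parallel>\<^sup>2\<close>. Hence the residual is at most
  \<open>2 \<delta> / \<gamma>\<close>; aligning the sign costs a further factor \<open>\<surd>2\<close>, which is estimated by \<open>3/2\<close>. If \<open>w\<close> is orthogonal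
  to \<open>v\<^sub>i\<close>, the sign is \<open>0\<close> and the residual has norm one.\<close>

lemma eigenvector_perturbation:
  assumes "eigen_form B lam v" "eigen_form B' lam' v'"
    and close: "\<And>x y. \<bar>B' x y - B x y\<bar> \<le> \<delta> * (norm x * norm y)"
    and gap: "\<gamma> > 0" "\<And>j. j \<le> i \<Longrightarrow> \<gamma> \<le> lam j - lam (Suc j)"
  shows "norm (v i - sgn (inner (v i) (v' i)) *\<^sub>R v' i) \<le> 3 / \<gamma> * \<delta>"
proof -
  interpret B: eigen_form B lam v by fact
  interpret B': eigen_form B' lam' v' by fact
  define w where "w = v' i"
  define a where "a = inner w (v i)"
  define r1 where "r1 = B.proj i w"
  define r2 where "r2 = w - a *\<^sub>R v i - r1"
  have w1: "norm w = 1" by (simp add: w_def B'.norm_v)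
  have w: "w = a *\<^sub>R v i + (r1 + r2)" by (simp add: r2_def)
  have r1v: "inner r1 (v j) = (if j < i then inner w (v j) else 0)" for j
    by (simp add: r1_def B.inner_proj)
  have r2v: "inner r2 (v j) = 0" if "j < Suc i" for j
    using that by (auto simp: r2_def inner_diff_left B.orthonormal r1v a_def less_Suc_eq)
  have r1_sum: "r1 = (\<Sum>j<i. inner w (v j) *\<^sub>R v j)" by (simp add: r1_def B.proj_def)
  have vr2: "inner (v j) r2 = 0" if "j < i" for j
    using r2v[of j] that by (simp add: inner_commute)
  have r12: "inner r1 r2 = 0"
    by (simp add: r1_sum inner_sum_left vr2)
  have Br12: "B r1 r2 = 0"
    by (simp add: r1_sum B.B_sum_v vr2)
  define r where "r = r1 + r2"
  define y where "y = r1 - r2"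
  have r21: "inner r2 r1 = 0" using r12 by (simp add: inner_commute)
  have ny: "norm y = norm r"
    by (simp add: norm_eq_sqrt_inner y_def r_def inner_add_left inner_add_right inner_diff_left
        inner_diff_right r12 r21)
  have nr: "(norm r)\<^sup>2 = (norm r1)\<^sup>2 + (norm r2)\<^sup>2"
    by (simp add: r_def power2_norm_eq_inner inner_add_left inner_add_right r12 r21)
  have vr: "inner (v i) r1 = 0" "inner (v i) r2 = 0" "inner r1 (v i) = 0" "inner r2 (v i) = 0"
    using r1v[of i] r2v[of i] by (simp_all add: inner_commute)
  have mono: "lam (Suc j) \<le> lam j" for j using B.decreasing by (simp add: decseq_Suc_iff)
  have low1: "(lam i + \<gamma>) * (norm r1)\<^sup>2 \<le> B r1 r1"
  proof (rule B.form_ge[OF r1_sum])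
    fix j assume "j < i"
    then have "lam i \<le> lam (Suc j)" by (intro decseqD[OF B.decreasing]) simp
    then show "lam i + \<gamma> \<le> lam j" using gap(2)[of j] \<open>j < i\<close> by simp
  qed
  have "B r2 r2 \<le> lam (Suc i) * (norm r2)\<^sup>2" by (rule B.form_le) (rule r2v)
  also have "\<dots> \<le> (lam i - \<gamma>) * (norm r2)\<^sup>2"
    using gap(2)[of i] by (intro mult_right_mono) auto
  finally have low2: "B r2 r2 \<le> (lam i - \<gamma>) * (norm r2)\<^sup>2" .
  have Bwy: "B w y = B r1 r1 - B r2 r2"
  proof -
    have "B r2 r1 = 0" using Br12 B.sym[of r2 r1] by simp
    then show ?thesis
      by (simp add: w y_def B.B.add_left B.B.diff_right B.B.scaleR_left B.eigen Br12
          inner_diff_right vr)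
  qed
  have iwy: "inner w y = (norm r1)\<^sup>2 - (norm r2)\<^sup>2"
    by (simp add: w y_def inner_add_left inner_diff_right vr r12 r21 power2_norm_eq_inner)
  have low: "\<gamma> * (norm r)\<^sup>2 \<le> B w y - lam i * inner w y"
    using low1 low2 by (simp add: Bwy iwy nr algebra_simps)
  have "B' w y = lam' i * inner w y" by (simp add: w_def B'.eigen)
  then have "B w y - lam i * inner w y = (lam' i - lam i) * inner w y - (B' w y - B w y)"
    by (simp add: algebra_simps)
  also have "\<dots> \<le> \<bar>lam' i - lam i\<bar> * \<bar>inner w y\<bar> + \<bar>B' w y - B w y\<bar>"
    using abs_ge_self[of "(lam' i - lam i) * inner w y"] unfolding abs_mult by linarith
  also have "\<dots> \<le> \<delta> * norm y + \<delta> * norm y"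
  proof (rule add_mono)
    have d: "\<bar>lam' i - lam i\<bar> \<le> \<delta>" by (rule weyl_inequality[OF assms(1-3)])
    have "\<bar>inner w y\<bar> \<le> norm y" using Cauchy_Schwarz_ineq2[of w y] by (simp add: w1)
    then show "\<bar>lam' i - lam i\<bar> * \<bar>inner w y\<bar> \<le> \<delta> * norm y"
      using d by (intro mult_mono) auto
    show "\<bar>B' w y - B w y\<bar> \<le> \<delta> * norm y" using close[of w y] by (simp add: w1)
  qed
  finally have "\<gamma> * (norm r)\<^sup>2 \<le> 2 * \<delta> * norm r" using low ny by simp
  then have "\<gamma> * norm r \<le> 2 * \<delta>"
    by (cases "norm r = 0") (use weyl_inequality[OF assms(1-3), of 0] in \<open>auto simp: power2_eq_square\<close>)
  then have nr_le: "norm r \<le> 2 * \<delta> / \<gamma>" using gap(1) by (simp add: field_simps)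
  have a2: "a\<^sup>2 + (norm r)\<^sup>2 = 1"
  proof -
    have "inner w w = a * a + inner r r"
      unfolding w by (simp add: inner_add_left inner_add_right r_def B.orthonormal vr r12 r21)
    then have "(norm w)\<^sup>2 = a\<^sup>2 + (norm r)\<^sup>2"
      unfolding power2_norm_eq_inner power2_eq_square[of a] .
    then show ?thesis by (simp add: w1)
  qed
  have "(norm (v i - sgn a *\<^sub>R w))\<^sup>2 \<le> 2 * (norm r)\<^sup>2"
  proof (cases "a = 0")
    case True
    then show ?thesis using a2 by (simp add: B.norm_v)
  next
    case False
    then have s: "sgn a * sgn a = 1" "sgn a * a = \<bar>a\<bar>" by (simp_all add: sgn_if)
    have "(norm (v i - sgn a *\<^sub>R w))\<^sup>2 = 1 - 2 * (sgn a * a) + (sgn a * sgn a) * (norm w)\<^sup>2"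
    proof -
      have "inner (v i) w = a" by (simp add: a_def inner_commute)
      then show ?thesis
        by (simp only: power2_norm_eq_inner inner_diff_left inner_diff_right inner_scaleR_left
            inner_scaleR_right B.orthonormal a_def[symmetric] simp_thms if_True)
          (simp add: algebra_simps del: sgn_mult_self_eq)
    qed
    also have "\<dots> = 2 - 2 * \<bar>a\<bar>" unfolding s w1 by simp
    also have "\<dots> \<le> 2 - 2 * a\<^sup>2"
    proof -
      have "a\<^sup>2 \<le> 1" using a2 zero_le_power2[of "norm r"] by linarith
      then have "\<bar>a\<bar> \<le> 1" by (simp add: abs_square_le_1)
      then have "\<bar>a\<bar> * \<bar>a\<bar> \<le> \<bar>a\<bar> * 1" by (intro mult_left_mono) auto
      then show ?thesis by (simp add: power2_eq_square)
    qed
    finally show ?thesis using a2 by simp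
  qed
  also have "\<dots> \<le> (3 / 2 * norm r)\<^sup>2" unfolding power_mult_distrib by (simp add: power2_eq_square)
  finally have "norm (v i - sgn a *\<^sub>R w) \<le> 3 / 2 * norm r" by (rule power2_le_imp_le) simp
  also have "\<dots> \<le> 3 / \<gamma> * \<delta>" using nr_le by simp
  finally have "norm (v i - sgn a *\<^sub>R w) \<le> 3 / \<gamma> * \<delta>" .
  moreover have "a = inner (v i) (v' i)" by (simp add: a_def w_def inner_commute)
  ultimately show ?thesis by (simp add: w_def)
qed

section \<open>Bernoulli shifts and their coupled copies\<close>

lemma distr_PiM_inj:
  assumes "prob_space P" "inj \<phi>"
  shows "distr (PiM UNIV (\<lambda>_. P)) (PiM UNIV (\<lambda>_. P)) (\<lambda>x j. x (\<phi> j)) = PiM UNIV (\<lambda>_. P)"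
  using distr_PiM_reindex[of UNIV "\<lambda>_. P" \<phi> UNIV] assms by (simp add: restrict_def)

lemma measurable_case_sum_PiM:
  "(\<lambda>(x, y). case_sum x y) \<in> PiM UNIV (\<lambda>_ :: 'i. P) \<Otimes>\<^sub>M PiM UNIV (\<lambda>_ :: 'k. P) \<rightarrow>\<^sub>M PiM UNIV (\<lambda>_. P)"
proof (rule measurable_PiM_single')
  fix i :: "'i + 'k"
  show "(\<lambda>z. (case z of (x, y) \<Rightarrow> case_sum x y) i) \<in> PiM UNIV (\<lambda>_. P) \<Otimes>\<^sub>M PiM UNIV (\<lambda>_. P) \<rightarrow>\<^sub>M P"
    by (cases i) (simp_all add: case_prod_beta)
qed (auto simp: space_pair_measure space_PiM PiE_def Pi_def split: sum.split)

text \<open>Two independent i.i.d. families form a single i.i.d. family over the sum of the index types. Selecting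
  coordinates injectively from both families thus reduces to selecting them from one.\<close>

lemma distr_pair_PiM:
  assumes P: "prob_space P"
  shows "distr (PiM UNIV (\<lambda>_. P) \<Otimes>\<^sub>M PiM UNIV (\<lambda>_. P)) (PiM UNIV (\<lambda>_. P)) (\<lambda>(x, y). case_sum x y)
    = PiM UNIV (\<lambda>_ :: 'i + 'k. P)"
proof (rule measure_eqI_PiM_infinite)
  let ?A = "PiM UNIV (\<lambda>_ :: 'i. P)" and ?B = "PiM UNIV (\<lambda>_ :: 'k. P)"
  interpret A: product_prob_space "\<lambda>_ :: 'i. P" UNIV
    by (simp add: product_prob_space_def product_sigma_finite_def product_prob_space_axioms_def P
        prob_space_imp_sigma_finite)
  interpret B: product_prob_space "\<lambda>_ :: 'k. P" UNIV
    by (simp add: product_prob_space_def product_sigma_finite_def product_prob_space_axioms_def P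
        prob_space_imp_sigma_finite)
  interpret AB: product_prob_space "\<lambda>_ :: 'i + 'k. P" UNIV
    by (simp add: product_prob_space_def product_sigma_finite_def product_prob_space_axioms_def P
        prob_space_imp_sigma_finite)
  interpret AxB: pair_prob_space ?A ?B ..
  let ?D = "distr (?A \<Otimes>\<^sub>M ?B) (PiM UNIV (\<lambda>_. P)) (\<lambda>(x, y). case_sum x y)"
  show "sets ?D = sets (PiM UNIV (\<lambda>_ :: 'i + 'k. P))" by simp
  show "sets (PiM UNIV (\<lambda>_ :: 'i + 'k. P)) = sets (PiM UNIV (\<lambda>_ :: 'i + 'k. P))" by simp
  show "finite_measure ?D"
    by (intro finite_measure.finite_measure_distr AxB.finite_measure_axioms measurable_case_sum_PiM)
  fix F :: "'i + 'k \<Rightarrow> 'a set" and J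
  assume J: "finite J" "J \<subseteq> UNIV" and F: "\<And>i. i \<in> J \<Longrightarrow> F i \<in> sets P"
  define J1 where "J1 = Inl -` J"
  define J2 where "J2 = Inr -` J"
  have J12: "J = Inl ` J1 \<union> Inr ` J2"
  proof (rule Set.set_eqI)
    fix z show "z \<in> J \<longleftrightarrow> z \<in> Inl ` J1 \<union> Inr ` J2" by (cases z) (auto simp: J1_def J2_def)
  qed
  have fin: "finite J1" "finite J2"
    unfolding J1_def J2_def using J(1) by (auto intro!: finite_vimageI)
  let ?E = "prod_emb UNIV (\<lambda>_. P) J (Pi\<^sub>E J F)"
  let ?E1 = "prod_emb UNIV (\<lambda>_. P) J1 (Pi\<^sub>E J1 (\<lambda>i. F (Inl i)))"
  let ?E2 = "prod_emb UNIV (\<lambda>_. P) J2 (Pi\<^sub>E J2 (\<lambda>i. F (Inr i)))"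
  have E: "?E \<in> sets (PiM UNIV (\<lambda>_. P))" using J F by (intro sets_PiM_I) auto
  have E1: "?E1 \<in> sets ?A" using fin F by (intro sets_PiM_I) (auto simp: J1_def)
  have E2: "?E2 \<in> sets ?B" using fin F by (intro sets_PiM_I) (auto simp: J2_def)
  have "emeasure ?D ?E = emeasure (?A \<Otimes>\<^sub>M ?B) (?E1 \<times> ?E2)"
  proof (subst emeasure_distr[OF measurable_case_sum_PiM E], rule arg_cong[where f="emeasure _"])
    show "(\<lambda>(x, y). case_sum x y) -` ?E \<inter> space (?A \<Otimes>\<^sub>M ?B) = ?E1 \<times> ?E2"
    proof (rule Set.set_eqI, clarify)
      fix x y
      show "(x, y) \<in> (\<lambda>(x, y). case_sum x y) -` ?E \<inter> space (?A \<Otimes>\<^sub>M ?B) \<longleftrightarrow> (x, y) \<in> ?E1 \<times> ?E2"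
        by (simp add: prod_emb_iff space_pair_measure space_PiM PiE_UNIV_domain J12 ball_Un Pi_iff)
          (auto split: sum.split)
    qed
  qed
  also have "\<dots> = emeasure ?A ?E1 * emeasure ?B ?E2"
    using E1 E2
    by (rule sigma_finite_measure.emeasure_pair_measure_Times
        [OF prob_space_imp_sigma_finite[OF prob_space_PiM[OF P]]])
  also have "emeasure ?A ?E1 = (\<Prod>i\<in>J1. emeasure P (F (Inl i)))"
    using fin F by (intro A.emeasure_PiM_emb) (auto simp: J1_def)
  also have "emeasure ?B ?E2 = (\<Prod>i\<in>J2. emeasure P (F (Inr i)))"
    using fin F by (intro B.emeasure_PiM_emb) (auto simp: J2_def)
  also have "(\<Prod>i\<in>J1. emeasure P (F (Inl i))) * (\<Prod>i\<in>J2. emeasure P (F (Inr i)))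
      = (\<Prod>i\<in>J. emeasure P (F i))"
    unfolding J12 using fin by (subst prod.union_disjoint) (auto simp: prod.reindex)
  also have "\<dots> = emeasure (PiM UNIV (\<lambda>_. P)) ?E"
    using J F by (intro AB.emeasure_PiM_emb[symmetric]) auto
  finally show "emeasure ?D ?E = emeasure (PiM UNIV (\<lambda>_. P)) ?E" .
qed

lemma distr_PiM_pair_inj:
  fixes \<phi> :: "'j + 'l \<Rightarrow> 'i + 'k"
  assumes P: "prob_space P" and \<phi>: "inj \<phi>"
  shows "distr (PiM UNIV (\<lambda>_. P) \<Otimes>\<^sub>M PiM UNIV (\<lambda>_. P)) (PiM UNIV (\<lambda>_. P) \<Otimes>\<^sub>M PiM UNIV (\<lambda>_. P))
      (\<lambda>(x, y). ((\<lambda>j. case_sum x y (\<phi> (Inl j))), (\<lambda>l. case_sum x y (\<phi> (Inr l)))))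
    = PiM UNIV (\<lambda>_. P) \<Otimes>\<^sub>M PiM UNIV (\<lambda>_. P)" (is "?L = ?R")
proof -
  let ?split = "\<lambda>z :: 'j + 'l \<Rightarrow> 'a. ((\<lambda>j. z (Inl j)), (\<lambda>l. z (Inr l)))"
  have m1: "(\<lambda>z j. z (\<phi> j)) \<in> PiM UNIV (\<lambda>_. P) \<rightarrow>\<^sub>M PiM UNIV (\<lambda>_. P)"
    by (intro measurable_PiM_single') (auto simp: space_PiM PiE_def Pi_def)
  have m2: "?split \<in> PiM UNIV (\<lambda>_. P) \<rightarrow>\<^sub>M PiM UNIV (\<lambda>_. P) \<Otimes>\<^sub>M PiM UNIV (\<lambda>_. P)"
    by (intro measurable_Pair measurable_PiM_single') (auto simp: space_PiM PiE_def Pi_def)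
  note m3 = measurable_case_sum_PiM
  have "?L = distr (PiM UNIV (\<lambda>_. P) \<Otimes>\<^sub>M PiM UNIV (\<lambda>_. P)) ?R
      (?split \<circ> ((\<lambda>z j. z (\<phi> j)) \<circ> (\<lambda>(x, y). case_sum x y)))"
    by (rule arg_cong[where f="distr _ _"]) (simp add: fun_eq_iff)
  also have "\<dots> = distr (distr (distr (PiM UNIV (\<lambda>_. P) \<Otimes>\<^sub>M PiM UNIV (\<lambda>_. P)) (PiM UNIV (\<lambda>_. P))
      (\<lambda>(x, y). case_sum x y)) (PiM UNIV (\<lambda>_. P)) (\<lambda>z j. z (\<phi> j))) ?R ?split"
    by (subst distr_distr[OF m1 m3], subst distr_distr[OF m2 measurable_comp[OF m3 m1]]) (rule refl)
  also have "\<dots> = distr (PiM UNIV (\<lambda>_. P)) ?R ?split"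
    by (simp only: distr_pair_PiM[OF P] distr_PiM_inj[OF P \<phi>])
  also have "\<dots> = distr (distr ?R (PiM UNIV (\<lambda>_. P)) (\<lambda>(x, y). case_sum x y)) ?R ?split"
    by (simp only: distr_pair_PiM[OF P])
  also have "\<dots> = distr ?R ?R (?split \<circ> (\<lambda>(x, y). case_sum x y))"
    by (rule distr_distr[OF m2 m3])
  also have "?split \<circ> (\<lambda>(x, y). case_sum x y) = (\<lambda>z. z)"
    by (simp add: fun_eq_iff)
  also have "distr ?R ?R (\<lambda>z. z) = ?R" by simp
  finally show ?thesis .
qed

text \<open>The assumptions on the innovations that approximability provides, without the
  series itself. The value \<open>eps' n\<close> is the copy that is used at time \<open>n\<close>.\<close>

locale coupled_innovations = prob_space M for M :: "'w measure" +
  fixes S :: "'s measure" and eps :: "int \<Rightarrow> 'w \<Rightarrow> 's" and eps' :: "int \<Rightarrow> int \<Rightarrow> 'w \<Rightarrow> 's"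
  assumes indep_eps: "indep_vars (\<lambda>_. S) eps UNIV"
    and identical: "\<And>i. distr M S (eps i) = distr M S (eps 0)"
    and copy: "\<And>n. distr M (PiM UNIV (\<lambda>_. S)) (\<lambda>w k. eps' n k w)
           = distr M (PiM UNIV (\<lambda>_. S)) (\<lambda>w k. eps k w)"
    and indep_copies: "indep_vars (\<lambda>_. PiM UNIV (\<lambda>_. S))
          (\<lambda>j w k. case j of None \<Rightarrow> eps k w | Some n \<Rightarrow> eps' n k w) (UNIV :: int option set)"
begin

definition P :: "'s measure" where "P = distr M S (eps 0)"

abbreviation seqs :: "(nat \<Rightarrow> 's) measure" where "seqs \<equiv> PiM UNIV (\<lambda>_. P)"
abbreviation bi_seqs :: "(int \<Rightarrow> 's) measure" where "bi_seqs \<equiv> PiM UNIV (\<lambda>_. P)"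

text \<open>The argument of the shift at time \<open>n\<close>, most recent innovation first, and at time \<open>m\<close> its coupled
  version, in which the innovations at times \<open>\<le> 0\<close> are replaced by their copies.\<close>

definition past :: "int \<Rightarrow> 'w \<Rightarrow> nat \<Rightarrow> 's" where
  "past n w j = eps (n - int j) w"

definition coupled :: "nat \<Rightarrow> 'w \<Rightarrow> nat \<Rightarrow> 's" where
  "coupled m w j = (if j < m then eps (int m - int j) w else eps' (int m) (int m - int j) w)"

lemma sets_P: "sets P = sets S" by (simp add: P_def)

lemma measurable_eps: "eps i \<in> M \<rightarrow>\<^sub>M P"
  using indep_eps measurable_cong_sets[OF refl sets_P, of M] by (simp add: indep_vars_def)

lemma prob_space_P: "prob_space P"
  unfolding P_def using indep_eps by (intro prob_space_distr) (simp add: indep_vars_def)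

lemma sets_PiM_P: "sets (PiM UNIV (\<lambda>_. P)) = sets (PiM UNIV (\<lambda>_. S))"
  by (intro sets_PiM_cong) (simp_all add: sets_P)

lemma distr_eps: "distr M bi_seqs (\<lambda>w k. eps k w) = bi_seqs"
proof -
  have eq: "(\<lambda>k. distr M S (eps k)) = (\<lambda>_. P)"
    unfolding P_def by (rule ext) (rule identical)
  have "distr M (PiM UNIV (\<lambda>_. S)) (\<lambda>w. \<lambda>k\<in>UNIV. eps k w) = PiM UNIV (\<lambda>k. distr M S (eps k))"
    using indep_eps by (subst indep_vars_iff_distr_eq_PiM'[symmetric]) (auto simp: indep_vars_def)
  then have "distr M (PiM UNIV (\<lambda>_. S)) (\<lambda>w k. eps k w) = bi_seqs"
    using eq by (simp add: restrict_def)
  moreover have "distr M (PiM UNIV (\<lambda>_. S)) (\<lambda>w k. eps k w) = distr M bi_seqs (\<lambda>w k. eps k w)"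
    by (intro distr_cong sets_PiM_P[symmetric] refl)
  ultimately show ?thesis by simp
qed

lemma measurable_bi_eps: "(\<lambda>w k. eps k w) \<in> M \<rightarrow>\<^sub>M bi_seqs"
  by (intro measurable_PiM_single') (auto simp: measurable_eps intro: measurable_space[OF measurable_eps])

lemma distr_eps_copy:
  "(\<lambda>w k. eps' n k w) \<in> M \<rightarrow>\<^sub>M bi_seqs"
  "distr M (bi_seqs \<Otimes>\<^sub>M bi_seqs) (\<lambda>w. ((\<lambda>k. eps k w), (\<lambda>k. eps' n k w))) = bi_seqs \<Otimes>\<^sub>M bi_seqs"
proof -
  let ?Z = "\<lambda>j w k. case j of None \<Rightarrow> eps k w | Some n \<Rightarrow> eps' n k w"
  have m: "?Z j \<in> M \<rightarrow>\<^sub>M PiM UNIV (\<lambda>_. S)" for j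
    using indep_copies by (simp add: indep_vars_def)
  show m': "(\<lambda>w k. eps' n k w) \<in> M \<rightarrow>\<^sub>M bi_seqs"
    using m[of "Some n"] by (subst measurable_cong_sets[OF refl sets_PiM_P]) simp
  let ?S = "PiM UNIV (\<lambda>_ :: int. S)"
  have "indep_var (PiM {None} (\<lambda>_. ?S)) (\<lambda>w. restrict (\<lambda>j. ?Z j w) {None})
      (PiM {Some n} (\<lambda>_. ?S)) (\<lambda>w. restrict (\<lambda>j. ?Z j w) {Some n})"
    by (rule indep_var_restrict[OF indep_copies]) auto
  then have "indep_var ?S ((\<lambda>z. z None) \<circ> (\<lambda>w. restrict (\<lambda>j. ?Z j w) {None}))
      ?S ((\<lambda>z. z (Some n)) \<circ> (\<lambda>w. restrict (\<lambda>j. ?Z j w) {Some n}))"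
    by (rule indep_var_compose) simp_all
  then have "indep_var ?S (\<lambda>w k. eps k w) ?S (\<lambda>w k. eps' n k w)"
    by (simp add: comp_def)
  then have "distr M ?S (\<lambda>w k. eps k w) \<Otimes>\<^sub>M distr M ?S (\<lambda>w k. eps' n k w)
      = distr M (?S \<Otimes>\<^sub>M ?S) (\<lambda>w. ((\<lambda>k. eps k w), (\<lambda>k. eps' n k w)))"
    by (simp add: indep_var_distribution_eq)
  moreover have "distr M ?S (\<lambda>w k. eps k w) = bi_seqs"
    using distr_cong[OF refl sets_PiM_P refl, of M "\<lambda>w k. eps k w"] by (simp add: distr_eps)
  moreover have "distr M (?S \<Otimes>\<^sub>M ?S) (\<lambda>w. ((\<lambda>k. eps k w), (\<lambda>k. eps' n k w)))
      = distr M (bi_seqs \<Otimes>\<^sub>M bi_seqs) (\<lambda>w. ((\<lambda>k. eps k w), (\<lambda>k. eps' n k w)))"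
    by (intro distr_cong refl sets_pair_measure_cong sets_PiM_P[symmetric])
  ultimately show "distr M (bi_seqs \<Otimes>\<^sub>M bi_seqs) (\<lambda>w. ((\<lambda>k. eps k w), (\<lambda>k. eps' n k w))) = bi_seqs \<Otimes>\<^sub>M bi_seqs"
    by (simp add: copy)
qed

lemma measurable_past: "past n \<in> M \<rightarrow>\<^sub>M seqs"
  by (intro measurable_PiM_single')
    (auto simp: measurable_eps past_def intro: measurable_space[OF measurable_eps])

lemma measurable_coupled: "coupled m \<in> M \<rightarrow>\<^sub>M seqs"
proof (intro measurable_PiM_single')
  have "(\<lambda>w. (\<lambda>k. eps' (int m) k w) i) \<in> M \<rightarrow>\<^sub>M P" for i
    by (rule measurable_compose[OF distr_eps_copy(1)]) simp
  then have c: "(\<lambda>w. coupled m w j) \<in> M \<rightarrow>\<^sub>M P" for j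
    unfolding coupled_def by (cases "j < m") (simp_all add: measurable_eps)
  then show "(\<lambda>w. coupled m w j) \<in> M \<rightarrow>\<^sub>M P" for j .
  show "coupled m \<in> space M \<rightarrow> (\<Pi>\<^sub>E i\<in>UNIV. space P)"
    using measurable_space[OF c] by auto
qed

lemma distr_past: "distr M seqs (past n) = seqs"
proof -
  have "seqs = distr bi_seqs seqs (\<lambda>x j. x (n - int j))"
    using distr_PiM_inj[OF prob_space_P, of "\<lambda>j::nat. n - int j"] by (simp add: inj_def)
  also have "\<dots> = distr M seqs (\<lambda>w j. eps (n - int j) w)"
    by (subst distr_eps[symmetric], subst distr_distr)
      (auto simp: comp_def measurable_bi_eps space_PiM PiE_def Pi_def intro!: measurable_PiM_single')
  finally show ?thesis by (simp add: past_def[abs_def])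
qed

lemma distr_past_past:
  "distr M (seqs \<Otimes>\<^sub>M seqs) (\<lambda>w. (past n w, past (n + h) w))
    = distr M (seqs \<Otimes>\<^sub>M seqs) (\<lambda>w. (past 0 w, past h w))"
proof -
  let ?f = "\<lambda>x :: int \<Rightarrow> 's. ((\<lambda>j::nat. x (- int j)), (\<lambda>j::nat. x (h - int j)))"
  have comp: "(\<lambda>x. x i) \<in> bi_seqs \<rightarrow>\<^sub>M P" for i :: int by simp
  have f: "?f \<in> bi_seqs \<rightarrow>\<^sub>M seqs \<Otimes>\<^sub>M seqs"
    by (intro measurable_Pair measurable_PiM_single') (auto simp: space_PiM PiE_def Pi_def)
  have sh: "(\<lambda>w k. eps (n + k) w) \<in> M \<rightarrow>\<^sub>M bi_seqs"
    by (intro measurable_PiM_single') (auto simp: measurable_eps intro: measurable_space[OF measurable_eps])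
  have "bi_seqs = distr bi_seqs bi_seqs (\<lambda>x k. x (n + k))"
    using distr_PiM_inj[OF prob_space_P, of "\<lambda>k::int. n + k"] by (simp add: inj_def)
  also have "\<dots> = distr M bi_seqs (\<lambda>w k. eps (n + k) w)"
    by (subst distr_eps[symmetric], subst distr_distr)
      (auto simp: comp_def measurable_bi_eps space_PiM PiE_def Pi_def intro!: measurable_PiM_single')
  finally have shift: "distr M bi_seqs (\<lambda>w k. eps (n + k) w) = distr M bi_seqs (\<lambda>w k. eps k w)"
    by (simp add: distr_eps)
  have "distr M (seqs \<Otimes>\<^sub>M seqs) (\<lambda>w. (past n w, past (n + h) w))
      = distr (distr M bi_seqs (\<lambda>w k. eps (n + k) w)) (seqs \<Otimes>\<^sub>M seqs) ?f"
    by (subst distr_distr[OF f sh]) (simp add: comp_def past_def[abs_def] add_diff_eq)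
  also have "\<dots> = distr M (seqs \<Otimes>\<^sub>M seqs) (\<lambda>w. (past 0 w, past h w))"
    unfolding shift by (subst distr_distr[OF f measurable_bi_eps]) (simp add: comp_def past_def[abs_def])
  finally show ?thesis .
qed

text \<open>The coupled argument at time \<open>m\<close> uses the original innovations at the times \<open>1, \<dots>, m\<close> and the
  copies elsewhere, while \<open>past 0\<close> uses the original innovations at times \<open>\<le> 0\<close>. No innovation is used twice, so the
  selection of coordinates is injective and the pair consists of two independent i.i.d. sequences.\<close>

lemma distr_past_coupled:
  "distr M (seqs \<Otimes>\<^sub>M seqs) (\<lambda>w. (past 0 w, coupled m w)) = seqs \<Otimes>\<^sub>M seqs"
proof -
  define \<phi> :: "nat + nat \<Rightarrow> int + int" where
    "\<phi> = case_sum (\<lambda>j. Inl (- int j)) (\<lambda>j. if j < m then Inl (int m - int j) else Inr (int m - int j))"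
  have inj: "inj \<phi>"
    by (rule injI) (auto simp: \<phi>_def split: sum.splits if_splits)
  let ?f = "\<lambda>(x, y). ((\<lambda>j. case_sum x y (\<phi> (Inl j))), (\<lambda>j. case_sum x y (\<phi> (Inr j))))"
  have cs: "(\<lambda>z. case_sum (fst z) (snd z) i) \<in> bi_seqs \<Otimes>\<^sub>M bi_seqs \<rightarrow>\<^sub>M P" for i
    by (cases i) simp_all
  have cs': "case_sum (fst z) (snd z) i \<in> space P" if "z \<in> space (bi_seqs \<Otimes>\<^sub>M bi_seqs)" for i z
    using measurable_space[OF cs that] .
  have f: "?f \<in> bi_seqs \<Otimes>\<^sub>M bi_seqs \<rightarrow>\<^sub>M seqs \<Otimes>\<^sub>M seqs"
    unfolding case_prod_beta
    by (intro measurable_Pair measurable_PiM_single' cs) (use cs' in auto)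
  have pr: "(\<lambda>w. ((\<lambda>k. eps k w), (\<lambda>k. eps' (int m) k w))) \<in> M \<rightarrow>\<^sub>M bi_seqs \<Otimes>\<^sub>M bi_seqs"
    by (intro measurable_Pair measurable_bi_eps distr_eps_copy)
  have "seqs \<Otimes>\<^sub>M seqs = distr (bi_seqs \<Otimes>\<^sub>M bi_seqs) (seqs \<Otimes>\<^sub>M seqs) ?f"
    by (rule distr_PiM_pair_inj[OF prob_space_P inj, symmetric])
  also have "\<dots> = distr M (seqs \<Otimes>\<^sub>M seqs) (?f \<circ> (\<lambda>w. ((\<lambda>k. eps k w), (\<lambda>k. eps' (int m) k w))))"
    by (subst distr_eps_copy(2)[of "int m", symmetric]) (rule distr_distr[OF f pr])
  also have "?f \<circ> (\<lambda>w. ((\<lambda>k. eps k w), (\<lambda>k. eps' (int m) k w))) = (\<lambda>w. (past 0 w, coupled m w))"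
    by (auto simp: fun_eq_iff \<phi>_def past_def coupled_def)
  finally show ?thesis by simp
qed

end

section \<open>Decay of lagged covariances\<close>

lemma integral_Cauchy_Schwarz:
  fixes f g :: "'a \<Rightarrow> real"
  assumes [measurable]: "f \<in> borel_measurable M" "g \<in> borel_measurable M"
    and f: "integrable M (\<lambda>x. (f x)\<^sup>2)" and g: "integrable M (\<lambda>x. (g x)\<^sup>2)"
  shows "integrable M (\<lambda>x. f x * g x)"
    and "(\<integral>x. \<bar>f x * g x\<bar> \<partial>M) \<le> sqrt (\<integral>x. (f x)\<^sup>2 \<partial>M) * sqrt (\<integral>x. (g x)\<^sup>2 \<partial>M)"
proof -
  let ?F = "\<integral>x. (f x)\<^sup>2 \<partial>M" and ?G = "\<integral>x. (g x)\<^sup>2 \<partial>M"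
  have F0: "0 \<le> ?F" and G0: "0 \<le> ?G" by simp_all
  have "(\<integral>\<^sup>+x. ennreal \<bar>f x\<bar> * ennreal \<bar>g x\<bar> \<partial>M)\<^sup>2
      \<le> (\<integral>\<^sup>+x. (ennreal \<bar>f x\<bar>)\<^sup>2 \<partial>M) * (\<integral>\<^sup>+x. (ennreal \<bar>g x\<bar>)\<^sup>2 \<partial>M)"
    by (rule Cauchy_Schwarz_nn_integral) simp_all
  also have "(\<integral>\<^sup>+x. (ennreal \<bar>f x\<bar>)\<^sup>2 \<partial>M) = ennreal ?F"
    using nn_integral_eq_integral[OF f] by (simp add: ennreal_power)
  also have "(\<integral>\<^sup>+x. (ennreal \<bar>g x\<bar>)\<^sup>2 \<partial>M) = ennreal ?G"
    using nn_integral_eq_integral[OF g] by (simp add: ennreal_power)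
  also have "(\<integral>\<^sup>+x. ennreal \<bar>f x\<bar> * ennreal \<bar>g x\<bar> \<partial>M) = (\<integral>\<^sup>+x. ennreal \<bar>f x * g x\<bar> \<partial>M)"
    by (simp add: abs_mult ennreal_mult)
  finally have le: "(\<integral>\<^sup>+x. ennreal \<bar>f x * g x\<bar> \<partial>M)\<^sup>2 \<le> ennreal (?F * ?G)"
    by (simp add: ennreal_mult F0 G0)
  have "(\<integral>\<^sup>+x. ennreal \<bar>f x * g x\<bar> \<partial>M) < \<infinity>"
  proof (rule ccontr)
    assume "\<not> ?thesis"
    then have "(\<integral>\<^sup>+x. ennreal \<bar>f x * g x\<bar> \<partial>M) = \<infinity>" by (simp add: less_top[symmetric])
    then have "\<infinity> \<le> ennreal (?F * ?G)" using le by (simp add: power2_eq_square ennreal_mult_top)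
    then show False by (simp add: top_unique)
  qed
  then show int: "integrable M (\<lambda>x. f x * g x)" by (intro integrableI_bounded) simp_all
  then have "(\<integral>\<^sup>+x. ennreal \<bar>f x * g x\<bar> \<partial>M) = ennreal (\<integral>x. \<bar>f x * g x\<bar> \<partial>M)"
    by (intro nn_integral_eq_integral integrable_abs) simp_all
  with le have "ennreal ((\<integral>x. \<bar>f x * g x\<bar> \<partial>M)\<^sup>2) \<le> ennreal (?F * ?G)"
    by (simp add: ennreal_power)
  then have "(\<integral>x. \<bar>f x * g x\<bar> \<partial>M)\<^sup>2 \<le> ?F * ?G"
    using F0 G0 by simp
  then have "(\<integral>x. \<bar>f x * g x\<bar> \<partial>M) \<le> sqrt (?F * ?G)" by (rule real_le_rsqrt)
  then show "(\<integral>x. \<bar>f x * g x\<bar> \<partial>M) \<le> sqrt ?F * sqrt ?G" by (simp add: real_sqrt_mult)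
qed

lemma (in prob_space) second_le_fourth_moment:
  fixes f :: "'a \<Rightarrow> real"
  assumes [measurable]: "f \<in> borel_measurable M" and f: "integrable M (\<lambda>x. f x ^ 4)"
  shows "integrable M (\<lambda>x. (f x)\<^sup>2)" "expectation (\<lambda>x. (f x)\<^sup>2) \<le> sqrt (expectation (\<lambda>x. f x ^ 4))"
  using integral_Cauchy_Schwarz[of "\<lambda>x. (f x)\<^sup>2" M "\<lambda>x. 1"] f prob_space
  by simp_all

lemma fourth_power_add_le: "(a + b) ^ 4 \<le> 8 * (a ^ 4 + b ^ 4)" for a b :: real
proof -
  have "(a + b)\<^sup>2 \<le> 2 * (a\<^sup>2 + b\<^sup>2)" using zero_le_power2[of "a - b"] by (simp add: power2_sum power2_diff)
  then have "((a + b)\<^sup>2)\<^sup>2 \<le> (2 * (a\<^sup>2 + b\<^sup>2))\<^sup>2" by (intro power_mono) simp_all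
  also have "\<dots> = 4 * (a\<^sup>2 + b\<^sup>2)\<^sup>2" unfolding power_mult_distrib by simp
  also have "(a\<^sup>2 + b\<^sup>2)\<^sup>2 \<le> 2 * ((a\<^sup>2)\<^sup>2 + (b\<^sup>2)\<^sup>2)"
    using zero_le_power2[of "a\<^sup>2 - b\<^sup>2"] by (simp add: power2_sum power2_diff)
  finally show ?thesis by simp
qed

lemma inner_mult_inner_le: "\<bar>inner u a * inner u b\<bar> \<le> (norm u)\<^sup>2 * (norm a * norm b)"
  for u a b :: "'h :: real_inner"
proof -
  have "\<bar>inner u a * inner u b\<bar> \<le> (norm u * norm a) * (norm u * norm b)"
    unfolding abs_mult by (intro mult_mono Cauchy_Schwarz_ineq2) simp_all
  then show ?thesis by (simp add: power2_eq_square mult_ac)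
qed

lemma norm_average_square:
  fixes P :: "nat \<Rightarrow> 'h :: real_inner"
  shows "(norm ((1 / real N) *\<^sub>R (\<Sum>n=1..N. P n)))\<^sup>2 = (\<Sum>n=1..N. \<Sum>m=1..N. inner (P n) (P m)) / (real N)\<^sup>2"
proof -
  have "inner (\<Sum>n=1..N. P n) (\<Sum>n=1..N. P n) = (\<Sum>n=1..N. \<Sum>m=1..N. inner (P n) (P m))"
    by (subst inner_sum_left, subst inner_sum_right) (rule refl)
  then show ?thesis
    unfolding power2_norm_eq_inner inner_scaleR_left inner_scaleR_right by (simp add: power2_eq_square)
qed

text \<open>Each row of the array meets every lag at most twice, once on either side of the diagonal.\<close>

lemma double_sum_band_le:
  fixes a :: "nat \<Rightarrow> nat \<Rightarrow> real"
  assumes g: "summable g" "\<And>h. 0 \<le> g h"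
    and a: "\<And>n h. a n (n + h) \<le> g h" "\<And>n m. a n m = a m n"
  shows "(\<Sum>n=1..N. \<Sum>m=1..N. a n m) \<le> real N * (2 * suminf g)"
proof -
  have row: "(\<Sum>m=1..N. a n m) \<le> 2 * suminf g" if "n \<in> {1..N}" for n
  proof -
    have split: "{1..N} = {1..<n} \<union> {n..N}" using that by auto
    have "(\<Sum>m=1..N. a n m) = (\<Sum>m\<in>{1..<n}. a n m) + (\<Sum>m\<in>{n..N}. a n m)"
      unfolding split by (rule sum.union_disjoint) auto
    also have "(\<Sum>m\<in>{1..<n}. a n m) \<le> (\<Sum>m\<in>{1..<n}. g (n - m))"
    proof (rule sum_mono)
      fix m assume "m \<in> {1..<n}"
      then show "a n m \<le> g (n - m)" using a(1)[of m "n - m"] by (simp add: a(2)[of n m])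
    qed
    also have "\<dots> = sum g ((\<lambda>m. n - m) ` {1..<n})"
      by (subst sum.reindex) (auto intro!: inj_onI)
    also have "\<dots> \<le> suminf g" using g by (intro sum_le_suminf) auto
    also have "(\<Sum>m\<in>{n..N}. a n m) \<le> (\<Sum>m\<in>{n..N}. g (m - n))"
    proof (rule sum_mono)
      fix m assume "m \<in> {n..N}"
      then show "a n m \<le> g (m - n)" using a(1)[of n "m - n"] by simp
    qed
    also have "\<dots> = sum g ((\<lambda>m. m - n) ` {n..N})"
      by (subst sum.reindex) (auto intro!: inj_onI)
    also have "\<dots> \<le> suminf g" using g by (intro sum_le_suminf) auto
    finally show ?thesis by simp
  qed
  have "(\<Sum>n=1..N. \<Sum>m=1..N. a n m) \<le> (\<Sum>n=1..N. 2 * suminf g)" by (intro sum_mono row)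
  then show ?thesis by simp
qed

text \<open>A stationary series \<open>F (past n)\<close> in a separable inner product space, with summable coupling
  errors. The last assumption expresses that two independent copies are uncorrelated, as they are when the mean
  vanishes; in this form no vector-valued integral is needed.\<close>

locale short_memory = coupled_innovations M S eps eps'
  for M :: "'w measure" and S :: "'s measure" and eps eps' +
  fixes F :: "(nat \<Rightarrow> 's) \<Rightarrow> 'h :: {real_inner, second_countable_topology}"
  assumes measurable_F [measurable]: "F \<in> borel_measurable seqs"
    and fourth_moment: "integrable M (\<lambda>w. norm (F (past 0 w)) ^ 4)"
    and summable_gaps: "summable (\<lambda>m. sqrt (sqrt (expectation
          (\<lambda>w. norm (F (past (int (Suc m)) w) - F (coupled (Suc m) w)) ^ 4))))"
    and uncorrelated_copies: "(\<integral>z. inner (F (fst z)) (F (snd z)) \<partial>(seqs \<Otimes>\<^sub>M seqs)) = 0"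
begin

text \<open>The series, its coupled version, their common fourth moment, and the coupling
  error. The number \<open>\<kappa>\<close> is the squared Hilbert--Schmidt norm of the covariance operator, expressed through
  two independent copies.\<close>

definition U :: "int \<Rightarrow> 'w \<Rightarrow> 'h" where "U n w = F (past n w)"
definition V :: "nat \<Rightarrow> 'w \<Rightarrow> 'h" where "V m w = F (coupled m w)"
definition m4 :: real where "m4 = expectation (\<lambda>w. norm (U 0 w) ^ 4)"
definition \<rho> :: "nat \<Rightarrow> real" where
  "\<rho> m = sqrt (sqrt (expectation (\<lambda>w. norm (U (int m) w - V m w) ^ 4)))"
definition \<kappa> :: real where
  "\<kappa> = (\<integral>z. (inner (F (fst z)) (F (snd z)))\<^sup>2 \<partial>(seqs \<Otimes>\<^sub>M seqs))"

lemma measurable_U [measurable]: "U n \<in> borel_measurable M"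
  unfolding U_def[abs_def] by (rule measurable_compose[OF measurable_past measurable_F])

lemma measurable_V [measurable]: "V n \<in> borel_measurable M"
  unfolding V_def[abs_def] by (rule measurable_compose[OF measurable_coupled measurable_F])

lemma measurable_pairF:
  assumes \<phi>: "case_prod \<phi> \<in> borel_measurable (borel \<Otimes>\<^sub>M borel)"
  shows "(\<lambda>z. \<phi> (F (fst z)) (F (snd z))) \<in> borel_measurable (seqs \<Otimes>\<^sub>M seqs)"
proof -
  have "(\<lambda>z. (F (fst z), F (snd z))) \<in> seqs \<Otimes>\<^sub>M seqs \<rightarrow>\<^sub>M borel \<Otimes>\<^sub>M borel" by measurable
  from measurable_compose[OF this \<phi>] show ?thesis by simp
qed

lemma expectation_stationary:
  fixes \<phi> :: "'h \<Rightarrow> 'h \<Rightarrow> real"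
  assumes \<phi>: "case_prod \<phi> \<in> borel_measurable (borel \<Otimes>\<^sub>M borel)"
  shows "expectation (\<lambda>w. \<phi> (U n w) (U (n + h) w)) = expectation (\<lambda>w. \<phi> (U 0 w) (U h w))"
proof -
  note m = measurable_Pair[OF measurable_past measurable_past]
  note * = integral_distr[OF m measurable_pairF[OF \<phi>]]
  show ?thesis
    using *[of n "n + h"] *[of 0 h] unfolding U_def distr_past_past[of n h] fst_conv snd_conv
    by (simp only:)
qed

lemma expectation_coupled:
  fixes \<phi> :: "'h \<Rightarrow> 'h \<Rightarrow> real"
  assumes \<phi>: "case_prod \<phi> \<in> borel_measurable (borel \<Otimes>\<^sub>M borel)"
  shows "expectation (\<lambda>w. \<phi> (U 0 w) (V m w)) = (\<integral>z. \<phi> (F (fst z)) (F (snd z)) \<partial>(seqs \<Otimes>\<^sub>M seqs))"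
  using integral_distr[OF measurable_Pair[OF measurable_past measurable_coupled] measurable_pairF[OF \<phi>],
      of 0 m]
  unfolding U_def V_def distr_past_coupled[of m] fst_conv snd_conv by (simp only:)

lemma fourth_moment_U:
  "integrable M (\<lambda>w. norm (U n w) ^ 4)" "expectation (\<lambda>w. norm (U n w) ^ 4) = m4"
proof -
  have *: "(\<lambda>x. norm (F x) ^ 4) \<in> borel_measurable seqs" by measurable
  have "integrable M (\<lambda>w. norm (F (past n w)) ^ 4) \<longleftrightarrow> integrable seqs (\<lambda>x. norm (F x) ^ 4)" for n
    using integrable_distr_eq[OF measurable_past *, of n] by (simp add: distr_past)
  then show "integrable M (\<lambda>w. norm (U n w) ^ 4)" using fourth_moment by (simp add: U_def)
  have "expectation (\<lambda>w. norm (F (past n w)) ^ 4) = (\<integral>x. norm (F x) ^ 4 \<partial>seqs)" for n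
    using integral_distr[OF measurable_past *, of n] by (simp add: distr_past)
  then show "expectation (\<lambda>w. norm (U n w) ^ 4) = m4" by (simp add: U_def m4_def)
qed

lemma prob_space_seqs: "prob_space seqs"
  by (intro prob_space_PiM prob_space_P)

lemma distr_coupled: "distr M seqs (coupled m) = seqs"
proof -
  have "distr M seqs (coupled m) = distr (distr M (seqs \<Otimes>\<^sub>M seqs) (\<lambda>w. (past 0 w, coupled m w))) seqs snd"
    by (subst distr_distr[OF measurable_snd measurable_Pair[OF measurable_past measurable_coupled]])
      (simp add: comp_def)
  also have "\<dots> = distr (seqs \<Otimes>\<^sub>M seqs) seqs snd"
    unfolding distr_past_coupled ..
  also have "\<dots> = seqs"
  proof (rule measure_eqI)
    interpret Q: prob_space seqs by (rule prob_space_seqs)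
    fix A assume "A \<in> sets (distr (seqs \<Otimes>\<^sub>M seqs) seqs snd)"
    then have A: "A \<in> sets seqs" by simp
    have "snd -` A \<inter> space (seqs \<Otimes>\<^sub>M seqs) = space seqs \<times> A"
      using sets.sets_into_space[OF A] unfolding space_pair_measure by (auto simp del: space_PiM)
    then show "emeasure (distr (seqs \<Otimes>\<^sub>M seqs) seqs snd) A = emeasure seqs A"
      using A by (simp add: emeasure_distr Q.emeasure_pair_measure_Times Q.emeasure_space_1)
  qed simp
  finally show ?thesis .
qed

lemma fourth_moment_V:
  "integrable M (\<lambda>w. norm (V m w) ^ 4)" "expectation (\<lambda>w. norm (V m w) ^ 4) = m4"
proof -
  have *: "(\<lambda>x. norm (F x) ^ 4) \<in> borel_measurable seqs" by measurable
  have "integrable M (\<lambda>w. norm (F (past 0 w)) ^ 4) \<longleftrightarrow> integrable seqs (\<lambda>x. norm (F x) ^ 4)"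
    using integrable_distr_eq[OF measurable_past *, of 0] by (simp add: distr_past)
  then have i: "integrable seqs (\<lambda>x. norm (F x) ^ 4)" using fourth_moment by simp
  have "integrable M (\<lambda>w. norm (F (coupled m w)) ^ 4) \<longleftrightarrow> integrable seqs (\<lambda>x. norm (F x) ^ 4)"
    using integrable_distr_eq[OF measurable_coupled *, of m] by (simp add: distr_coupled)
  then show "integrable M (\<lambda>w. norm (V m w) ^ 4)" using i by (simp add: V_def)
  have "expectation (\<lambda>w. norm (F (coupled m w)) ^ 4) = (\<integral>x. norm (F x) ^ 4 \<partial>seqs)"
    using integral_distr[OF measurable_coupled *, of m] by (simp add: distr_coupled)
  also have "\<dots> = expectation (\<lambda>w. norm (F (past 0 w)) ^ 4)"
    using integral_distr[OF measurable_past *, of 0] by (simp add: distr_past)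
  finally show "expectation (\<lambda>w. norm (V m w) ^ 4) = m4" by (simp add: U_def V_def m4_def)
qed

lemma m4_nonneg: "0 \<le> m4" unfolding m4_def by simp
lemma \<rho>_nonneg: "0 \<le> \<rho> m" unfolding \<rho>_def by simp

lemma fourth_moment_add:
  fixes A B :: "'w \<Rightarrow> real"
  assumes [measurable]: "A \<in> borel_measurable M" "B \<in> borel_measurable M"
    and A: "integrable M (\<lambda>w. A w ^ 4)" and B: "integrable M (\<lambda>w. B w ^ 4)"
  shows "integrable M (\<lambda>w. (A w + B w) ^ 4)"
    "expectation (\<lambda>w. (A w + B w) ^ 4) \<le> 8 * (expectation (\<lambda>w. A w ^ 4) + expectation (\<lambda>w. B w ^ 4))"
proof -
  have i: "integrable M (\<lambda>w. 8 * (A w ^ 4 + B w ^ 4))" using A B by simp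
  show j: "integrable M (\<lambda>w. (A w + B w) ^ 4)"
    by (rule Bochner_Integration.integrable_bound[OF i]) (use fourth_power_add_le in \<open>auto intro!: AE_I2\<close>)
  have "expectation (\<lambda>w. (A w + B w) ^ 4) \<le> expectation (\<lambda>w. 8 * (A w ^ 4 + B w ^ 4))"
    by (rule integral_mono[OF j i fourth_power_add_le])
  then show "expectation (\<lambda>w. (A w + B w) ^ 4) \<le> 8 * (expectation (\<lambda>w. A w ^ 4) + expectation (\<lambda>w. B w ^ 4))"
    using A B by simp
qed

lemma fourth_moment_diff: "integrable M (\<lambda>w. norm (U (int m) w - V m w) ^ 4)"
proof (rule Bochner_Integration.integrable_bound)
  show "integrable M (\<lambda>w. (norm (U (int m) w) + norm (V m w)) ^ 4)"
    by (rule fourth_moment_add(1)) (simp_all add: fourth_moment_U fourth_moment_V)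
  show "AE w in M. norm (norm (U (int m) w - V m w) ^ 4) \<le> norm ((norm (U (int m) w) + norm (V m w)) ^ 4)"
    by (auto intro!: AE_I2 power_mono norm_triangle_ineq4 simp: norm_power)
qed measurable

lemma second_moment_U: "integrable M (\<lambda>w. (norm (U n w))\<^sup>2)" "expectation (\<lambda>w. (norm (U n w))\<^sup>2) \<le> sqrt m4"
  using second_le_fourth_moment[of "\<lambda>w. norm (U n w)"] fourth_moment_U[of n] by simp_all

lemma product_integrable:
  assumes [measurable]: "A \<in> borel_measurable M" "B \<in> borel_measurable M"
    and A: "integrable M (\<lambda>w. norm (A w :: 'h) ^ 4)" and B: "integrable M (\<lambda>w. norm (B w :: 'h) ^ 4)"
  shows "integrable M (\<lambda>w. norm (A w) * norm (B w))" "integrable M (\<lambda>w. (norm (A w))\<^sup>2 * (norm (B w))\<^sup>2)"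
    "integrable M (\<lambda>w. inner (A w) (B w))" "integrable M (\<lambda>w. (inner (A w) (B w))\<^sup>2)"
proof -
  show 1: "integrable M (\<lambda>w. norm (A w) * norm (B w))"
    using A B by (intro integral_Cauchy_Schwarz(1) second_le_fourth_moment) simp_all
  show 2: "integrable M (\<lambda>w. (norm (A w))\<^sup>2 * (norm (B w))\<^sup>2)"
    using A B by (intro integral_Cauchy_Schwarz(1)) simp_all
  show "integrable M (\<lambda>w. inner (A w) (B w))"
    by (rule Bochner_Integration.integrable_bound[OF 1]) (auto simp: Cauchy_Schwarz_ineq2)
  show "integrable M (\<lambda>w. (inner (A w) (B w))\<^sup>2)"
    by (rule Bochner_Integration.integrable_bound[OF 2])
      (auto simp: power2_norm_eq_inner Cauchy_Schwarz_ineq)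
qed

text \<open>The coupled variable \<open>V m\<close> is independent of \<open>U 0\<close> and hence uncorrelated with it, so only the
  inner product of \<open>U 0\<close> with the coupling error remains.\<close>

lemma lag_covariance_le: "\<bar>expectation (\<lambda>w. inner (U 0 w) (U (int m) w))\<bar> \<le> sqrt (sqrt m4) * \<rho> m"
proof -
  let ?D = "\<lambda>w. U (int m) w - V m w"
  have c: "expectation (\<lambda>w. inner (U 0 w) (V m w)) = 0"
    using expectation_coupled[of inner m] uncorrelated_copies by simp
  note I = product_integrable[OF measurable_U _ fourth_moment_U(1)]
  have "expectation (\<lambda>w. inner (U 0 w) (U (int m) w)) = expectation (\<lambda>w. inner (U 0 w) (?D w))"
    using I(3)[OF measurable_U fourth_moment_U(1)] I(3)[OF measurable_V fourth_moment_V(1)]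
    by (simp add: inner_diff_right c)
  also have "\<bar>\<dots>\<bar> \<le> expectation (\<lambda>w. \<bar>norm (U 0 w) * norm (?D w)\<bar>)"
    by (intro integral_abs_bound[THEN order_trans] integral_mono integrable_abs I fourth_moment_diff)
      (auto simp: Cauchy_Schwarz_ineq2)
  also have "\<dots> \<le> sqrt (expectation (\<lambda>w. (norm (U 0 w))\<^sup>2)) * sqrt (expectation (\<lambda>w. (norm (?D w))\<^sup>2))"
    by (intro integral_Cauchy_Schwarz(2) second_le_fourth_moment fourth_moment_U fourth_moment_diff) simp_all
  also have "\<dots> \<le> sqrt (sqrt m4) * \<rho> m"
    unfolding \<rho>_def by (intro mult_mono real_sqrt_le_mono second_moment_U second_le_fourth_moment
        fourth_moment_diff) (simp_all add: m4_nonneg)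
  finally show ?thesis .
qed

text \<open>Against the coupled variable the expectation is exactly \<open>\<kappa>\<close>. The difference of two squares
  brings out the coupling error times fourth-moment terms, and the Cauchy--Schwarz
  inequality is applied first to separate \<open>U 0\<close> and then to separate the coupling error.\<close>

lemma lag_squared_covariance_le:
  "\<bar>expectation (\<lambda>w. (inner (U 0 w) (U (int m) w))\<^sup>2) - \<kappa>\<bar> \<le> sqrt m4 * sqrt (sqrt (16 * m4)) * \<rho> m"
proof -
  let ?D = "\<lambda>w. U (int m) w - V m w"
  let ?T = "\<lambda>w. norm (U (int m) w) + norm (V m w)"
  have c: "expectation (\<lambda>w. (inner (U 0 w) (V m w))\<^sup>2) = \<kappa>"
    using expectation_coupled[of "\<lambda>x y. (inner x y)\<^sup>2" m] by (simp add: \<kappa>_def)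
  note I = product_integrable[OF measurable_U _ fourth_moment_U(1)]
  note I1 = I(4)[OF measurable_U fourth_moment_U(1)] and I2 = I(4)[OF measurable_V fourth_moment_V(1)]
  have T4: "integrable M (\<lambda>w. ?T w ^ 4)" "expectation (\<lambda>w. ?T w ^ 4) \<le> 16 * m4"
    using fourth_moment_add[of "\<lambda>w. norm (U (int m) w)" "\<lambda>w. norm (V m w)"]
    by (simp_all add: fourth_moment_U fourth_moment_V)
  have DT: "integrable M (\<lambda>w. (norm (?D w))\<^sup>2 * (?T w)\<^sup>2)"
    "expectation (\<lambda>w. \<bar>(norm (?D w))\<^sup>2 * (?T w)\<^sup>2\<bar>)
      \<le> sqrt (expectation (\<lambda>w. ((norm (?D w))\<^sup>2)\<^sup>2)) * sqrt (expectation (\<lambda>w. ((?T w)\<^sup>2)\<^sup>2))"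
    by (intro integral_Cauchy_Schwarz; use fourth_moment_diff[of m] T4(1) in simp)+
  have UDT: "integrable M (\<lambda>w. (norm (U 0 w))\<^sup>2 * (norm (?D w) * ?T w))"
    "expectation (\<lambda>w. \<bar>(norm (U 0 w))\<^sup>2 * (norm (?D w) * ?T w)\<bar>)
      \<le> sqrt (expectation (\<lambda>w. ((norm (U 0 w))\<^sup>2)\<^sup>2)) * sqrt (expectation (\<lambda>w. (norm (?D w) * ?T w)\<^sup>2))"
    by (intro integral_Cauchy_Schwarz; use fourth_moment_U[of 0] DT(1) in \<open>simp add: power_mult_distrib\<close>)+
  have pt: "\<bar>(inner x y)\<^sup>2 - (inner x z)\<^sup>2\<bar> \<le> (norm x)\<^sup>2 * (norm (y - z) * (norm y + norm z))" for x y z :: 'h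
  proof -
    have "(inner x y)\<^sup>2 - (inner x z)\<^sup>2 = inner x (y - z) * inner x (y + z)"
      by (simp add: inner_diff_right inner_add_right power2_eq_square algebra_simps)
    also have "\<bar>\<dots>\<bar> \<le> (norm x * norm (y - z)) * (norm x * norm (y + z))"
      unfolding abs_mult by (intro mult_mono Cauchy_Schwarz_ineq2) simp_all
    also have "\<dots> \<le> (norm x * norm (y - z)) * (norm x * (norm y + norm z))"
      by (intro mult_left_mono norm_triangle_ineq) simp_all
    finally show ?thesis by (simp add: power2_eq_square mult_ac)
  qed
  have eq: "expectation (\<lambda>w. (inner (U 0 w) (U (int m) w))\<^sup>2) - \<kappa>
      = expectation (\<lambda>w. (inner (U 0 w) (U (int m) w))\<^sup>2 - (inner (U 0 w) (V m w))\<^sup>2)"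
    using I1 I2 by (simp add: c)
  have "\<bar>expectation (\<lambda>w. (inner (U 0 w) (U (int m) w))\<^sup>2 - (inner (U 0 w) (V m w))\<^sup>2)\<bar>
      \<le> expectation (\<lambda>w. \<bar>(norm (U 0 w))\<^sup>2 * (norm (?D w) * ?T w)\<bar>)"
  proof (rule order_trans[OF integral_abs_bound integral_mono])
    show "integrable M (\<lambda>w. \<bar>(inner (U 0 w) (U (int m) w))\<^sup>2 - (inner (U 0 w) (V m w))\<^sup>2\<bar>)"
      by (intro integrable_abs Bochner_Integration.integrable_diff I1 I2)
    show "integrable M (\<lambda>w. \<bar>(norm (U 0 w))\<^sup>2 * (norm (?D w) * ?T w)\<bar>)"
      by (intro integrable_abs UDT)
  qed (rule order_trans[OF pt abs_ge_self])
  also have "\<dots> \<le> sqrt m4 * sqrt (expectation (\<lambda>w. (norm (?D w))\<^sup>2 * (?T w)\<^sup>2))"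
  proof -
    have "(\<lambda>w. ((norm (U 0 w))\<^sup>2)\<^sup>2) = (\<lambda>w. norm (U 0 w) ^ 4)" by simp
    then show ?thesis
      using UDT(2) unfolding power_mult_distrib[of "norm (?D _)"] by (simp only: fourth_moment_U(2))
  qed
  also have "\<dots> \<le> sqrt m4 * sqrt (sqrt (expectation (\<lambda>w. norm (?D w) ^ 4)) * sqrt (16 * m4))"
  proof -
    have "expectation (\<lambda>w. (norm (?D w))\<^sup>2 * (?T w)\<^sup>2)
        \<le> sqrt (expectation (\<lambda>w. norm (?D w) ^ 4)) * sqrt (expectation (\<lambda>w. ?T w ^ 4))"
      using DT(2) by simp
    also have "\<dots> \<le> sqrt (expectation (\<lambda>w. norm (?D w) ^ 4)) * sqrt (16 * m4)"
      using T4(2) by (intro mult_left_mono real_sqrt_le_mono) simp_all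
    finally show ?thesis by (intro mult_left_mono real_sqrt_le_mono) (simp_all add: m4_nonneg)
  qed
  also have "\<dots> = sqrt m4 * sqrt (sqrt (16 * m4)) * \<rho> m"
    unfolding \<rho>_def real_sqrt_mult by (simp only: mult_ac)
  finally show ?thesis unfolding eq .
qed

lemma summable_\<rho>: "summable \<rho>"
  using summable_gaps by (subst summable_Suc_iff[symmetric]) (simp add: \<rho>_def[abs_def] U_def V_def)

lemma mean_square_average:
  "\<exists>K\<ge>0. \<forall>N\<ge>1. expectation (\<lambda>w. (norm ((1 / real N) *\<^sub>R (\<Sum>n=1..N. U (int n) w)))\<^sup>2) \<le> K / real N"
proof (intro exI conjI allI impI)
  let ?g = "\<lambda>m. sqrt (sqrt m4) * \<rho> m"
  have g: "summable ?g" "\<And>m. 0 \<le> ?g m" using summable_\<rho> m4_nonneg \<rho>_nonneg by (simp_all add: summable_mult)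
  show "0 \<le> 2 * suminf ?g" using suminf_nonneg[OF g] by simp
  fix N :: nat assume N: "1 \<le> N"
  let ?a = "\<lambda>n m. expectation (\<lambda>w. inner (U (int n) w) (U (int m) w))"
  have I: "integrable M (\<lambda>w. inner (U n w) (U m w))" for n m
    by (intro product_integrable measurable_U fourth_moment_U)
  have "expectation (\<lambda>w. (norm ((1 / real N) *\<^sub>R (\<Sum>n=1..N. U (int n) w)))\<^sup>2)
      = (\<Sum>n=1..N. \<Sum>m=1..N. ?a n m) / (real N)\<^sup>2"
    unfolding norm_average_square by (simp add: I Bochner_Integration.integrable_sum)
  also have "\<dots> \<le> (real N * (2 * suminf ?g)) / (real N)\<^sup>2"
  proof (intro divide_right_mono double_sum_band_le g)
    show "?a n (n + h) \<le> ?g h" for n h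
      using lag_covariance_le[of h] expectation_stationary[of inner "int n" "int h"] by (simp add: abs_le_iff)
    show "?a n m = ?a m n" for n m by (simp add: inner_commute)
  qed simp
  also have "\<dots> = 2 * suminf ?g / real N" using N by (simp add: power2_eq_square)
  finally show "expectation (\<lambda>w. (norm ((1 / real N) *\<^sub>R (\<Sum>n=1..N. U (int n) w)))\<^sup>2) \<le> 2 * suminf ?g / real N" .
qed

lemma mean_squared_covariances:
  "\<exists>K\<ge>0. \<forall>N\<ge>1. (\<Sum>n=1..N. \<Sum>m=1..N. expectation (\<lambda>w. (inner (U (int n) w) (U (int m) w))\<^sup>2) - \<kappa>) / (real N)\<^sup>2
      \<le> K / real N"
proof (intro exI conjI allI impI)
  let ?g = "\<lambda>m. sqrt m4 * sqrt (sqrt (16 * m4)) * \<rho> m"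
  have g: "summable ?g" "\<And>m. 0 \<le> ?g m" using summable_\<rho> m4_nonneg \<rho>_nonneg by (simp_all add: summable_mult)
  show "0 \<le> 2 * suminf ?g" using suminf_nonneg[OF g] by simp
  fix N :: nat assume N: "1 \<le> N"
  let ?a = "\<lambda>n m. expectation (\<lambda>w. (inner (U (int n) w) (U (int m) w))\<^sup>2) - \<kappa>"
  have "(\<Sum>n=1..N. \<Sum>m=1..N. ?a n m) / (real N)\<^sup>2 \<le> (real N * (2 * suminf ?g)) / (real N)\<^sup>2"
  proof (intro divide_right_mono double_sum_band_le g)
    show "?a n (n + h) \<le> ?g h" for n h
      using lag_squared_covariance_le[of h] expectation_stationary[of "\<lambda>x y. (inner x y)\<^sup>2" "int n" "int h"]
      by (simp add: abs_le_iff)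
    show "?a n m = ?a m n" for n m by (simp add: inner_commute)
  qed simp
  also have "\<dots> = 2 * suminf ?g / real N" using N by (simp add: power2_eq_square)
  finally show "(\<Sum>n=1..N. \<Sum>m=1..N. ?a n m) / (real N)\<^sup>2 \<le> 2 * suminf ?g / real N" .
qed

end

section \<open>Covariance kernels of random functions\<close>

lemma (in pair_sigma_finite) integrable_tensor:
  fixes g :: "'a \<Rightarrow> real" and h :: "'b \<Rightarrow> real"
  assumes g: "integrable M1 g" and h: "integrable M2 h"
  shows "integrable (M1 \<Otimes>\<^sub>M M2) (\<lambda>z. g (fst z) * h (snd z))"
    and "(\<integral>z. g (fst z) * h (snd z) \<partial>(M1 \<Otimes>\<^sub>M M2)) = (\<integral>x. g x \<partial>M1) * (\<integral>y. h y \<partial>M2)"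
proof -
  have [measurable]: "g \<in> borel_measurable M1" "h \<in> borel_measurable M2" using g h by auto
  show i: "integrable (M1 \<Otimes>\<^sub>M M2) (\<lambda>z. g (fst z) * h (snd z))"
    by (rule Fubini_integrable) (use g h in \<open>auto simp: abs_mult\<close>)
  show "(\<integral>z. g (fst z) * h (snd z) \<partial>(M1 \<Otimes>\<^sub>M M2)) = (\<integral>x. g x \<partial>M1) * (\<integral>y. h y \<partial>M2)"
    using integral_fst'[OF i] by simp
qed

abbreviation Sq :: "(real \<times> real) measure" where "Sq \<equiv> I01 \<Otimes>\<^sub>M I01"

text \<open>The rank-one kernel \<open>(t, s) \<mapsto> g t h s\<close>. Pairings of such kernels in \<open>L\<^sup>2\<close> of the unit square are products of
  inner products, which turns Hilbert--Schmidt geometry into inner products of functions.\<close>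

definition tensor :: "(real \<Rightarrow> real) \<Rightarrow> (real \<Rightarrow> real) \<Rightarrow> real \<times> real \<Rightarrow> real" where
  "tensor g h z = g (fst z) * h (snd z)"

interpretation Sq: pair_prob_space I01 I01 ..

lemma tensor_mult: "tensor g h z * tensor g' h' z = tensor (\<lambda>t. g t * g' t) (\<lambda>t. h t * h' t) z"
  by (simp add: tensor_def)

lemma measurable_tensor [measurable]:
  "g \<in> borel_measurable I01 \<Longrightarrow> h \<in> borel_measurable I01 \<Longrightarrow> tensor g h \<in> borel_measurable Sq"
  unfolding tensor_def[abs_def]
  by (intro borel_measurable_times measurable_compose[OF measurable_fst] measurable_compose[OF measurable_snd])

lemma tensor_pairing:
  assumes "g \<in> L2" "h \<in> L2" "g' \<in> L2" "h' \<in> L2"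
  shows "integrable Sq (\<lambda>z. tensor g h z * tensor g' h' z)"
    and "(\<integral>z. tensor g h z * tensor g' h' z \<partial>Sq) = ip g g' * ip h h'"
  unfolding tensor_mult ip_def
  using Sq.integrable_tensor[OF L2_mult_integrable[OF assms(1,3)] L2_mult_integrable[OF assms(2,4)]]
  by (simp_all add: tensor_def[abs_def])

lemma ip_self: "ip g g = (L2norm g)\<^sup>2"
  by (simp add: ip_def L2norm_def power2_eq_square)

lemma tensor_square:
  assumes "g \<in> L2" "h \<in> L2"
  shows "integrable Sq (\<lambda>z. (tensor g h z)\<^sup>2)" "(\<integral>z. (tensor g h z)\<^sup>2 \<partial>Sq) = (L2norm g * L2norm h)\<^sup>2"
  using tensor_pairing[OF assms assms] by (simp_all add: power2_eq_square[of "tensor g h _"] ip_self power_mult_distrib)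

locale random_L2_function = prob_space M for M :: "'w measure" +
  fixes y :: "'w \<Rightarrow> real \<Rightarrow> real"
  assumes joint: "(\<lambda>(t, w). y w t) \<in> borel_measurable (I01 \<Otimes>\<^sub>M M)"
    and L2: "w \<in> space M \<Longrightarrow> y w \<in> L2"
    and fourth: "integrable M (\<lambda>w. L2norm (y w) ^ 4)"
begin

definition kernel :: "real \<times> real \<Rightarrow> real" where
  "kernel z = (\<integral>w. tensor (y w) (y w) z \<partial>M)"

sublocale SqM: pair_sigma_finite Sq M ..

lemma joint_tensor: "(\<lambda>p. tensor (y (snd p)) (y (snd p)) (fst p)) \<in> borel_measurable (Sq \<Otimes>\<^sub>M M)"
proof -
  have "(\<lambda>p. (case (fst (fst p), snd p) of (t, w) \<Rightarrow> y w t)) \<in> borel_measurable (Sq \<Otimes>\<^sub>M M)"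
    by (rule measurable_compose[OF _ joint]) measurable
  moreover have "(\<lambda>p. (case (snd (fst p), snd p) of (t, w) \<Rightarrow> y w t)) \<in> borel_measurable (Sq \<Otimes>\<^sub>M M)"
    by (rule measurable_compose[OF _ joint]) measurable
  ultimately show ?thesis by (simp add: tensor_def borel_measurable_times)
qed

lemma joint_tensor_square: "integrable (Sq \<Otimes>\<^sub>M M) (\<lambda>p. (tensor (y (snd p)) (y (snd p)) (fst p))\<^sup>2)"
proof (rule integrableI_bounded)
  show m: "(\<lambda>p. (tensor (y (snd p)) (y (snd p)) (fst p))\<^sup>2) \<in> borel_measurable (Sq \<Otimes>\<^sub>M M)"
    using joint_tensor by simp
  have "(\<integral>\<^sup>+p. ennreal (norm ((tensor (y (snd p)) (y (snd p)) (fst p))\<^sup>2)) \<partial>(Sq \<Otimes>\<^sub>M M))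
      = (\<integral>\<^sup>+w. (\<integral>\<^sup>+z. ennreal ((tensor (y w) (y w) z)\<^sup>2) \<partial>Sq) \<partial>M)"
    using m by (subst SqM.nn_integral_snd[symmetric]) (simp_all add: case_prod_beta)
  also have "\<dots> = (\<integral>\<^sup>+w. ennreal (L2norm (y w) ^ 4) \<partial>M)"
    by (intro nn_integral_cong)
      (simp add: nn_integral_eq_integral tensor_square L2 power_mult_distrib flip: power_add)
  also have "\<dots> < \<infinity>"
    using fourth by (subst nn_integral_eq_integral) auto
  finally show "(\<integral>\<^sup>+p. ennreal (norm ((tensor (y (snd p)) (y (snd p)) (fst p))\<^sup>2)) \<partial>(Sq \<Otimes>\<^sub>M M)) < \<infinity>" .
qed

lemma kernel_measurable: "kernel \<in> borel_measurable Sq"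
  unfolding kernel_def[abs_def]
  by (rule borel_measurable_lebesgue_integral) (use joint_tensor in \<open>simp add: case_prod_beta'\<close>)

text \<open>Fubini's theorem on the square times the probability space. The fourth moment makes
  \<open>(t, s, w) \<mapsto> y w t y w s\<close> square integrable there, so its product with any square-integrable kernel is integrable.\<close>

lemma kernel_pairing:
  assumes G [measurable]: "G \<in> borel_measurable Sq" and G2: "integrable Sq (\<lambda>z. (G z)\<^sup>2)"
  shows "integrable Sq (\<lambda>z. G z * kernel z)"
    and "integrable M (\<lambda>w. \<integral>z. G z * tensor (y w) (y w) z \<partial>Sq)"
    and "(\<integral>z. G z * kernel z \<partial>Sq) = (\<integral>w. (\<integral>z. G z * tensor (y w) (y w) z \<partial>Sq) \<partial>M)"
proof -
  have "integrable (Sq \<Otimes>\<^sub>M M) (\<lambda>p. (G (fst p))\<^sup>2)"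
    using SqM.integrable_tensor(1)[OF G2, of "\<lambda>_. 1"] by simp
  then have i: "integrable (Sq \<Otimes>\<^sub>M M) (\<lambda>p. G (fst p) * tensor (y (snd p)) (y (snd p)) (fst p))"
    by (intro integral_Cauchy_Schwarz(1) joint_tensor joint_tensor_square) simp_all
  then have i': "integrable (Sq \<Otimes>\<^sub>M M) (case_prod (\<lambda>z w. G z * tensor (y w) (y w) z))"
    by (simp add: case_prod_beta')
  show "integrable Sq (\<lambda>z. G z * kernel z)"
    using SqM.integrable_fst[OF i'] by (simp add: kernel_def)
  show "integrable M (\<lambda>w. \<integral>z. G z * tensor (y w) (y w) z \<partial>Sq)"
    by (rule SqM.integrable_snd[OF i'])
  show "(\<integral>z. G z * kernel z \<partial>Sq) = (\<integral>w. (\<integral>z. G z * tensor (y w) (y w) z \<partial>Sq) \<partial>M)"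
    using SqM.Fubini_integral[OF i'] by (simp add: kernel_def)
qed

lemma kernel_square_integrable: "integrable Sq (\<lambda>z. (kernel z)\<^sup>2)"
proof (rule Bochner_Integration.integrable_bound)
  have i: "integrable (Sq \<Otimes>\<^sub>M M) (case_prod (\<lambda>z w. (tensor (y w) (y w) z)\<^sup>2))"
    using joint_tensor_square by (simp add: case_prod_beta')
  show "integrable Sq (\<lambda>z. \<integral>w. (tensor (y w) (y w) z)\<^sup>2 \<partial>M)" by (rule SqM.integrable_fst[OF i])
  show "AE z in Sq. norm ((kernel z)\<^sup>2) \<le> norm (\<integral>w. (tensor (y w) (y w) z)\<^sup>2 \<partial>M)"
    using SqM.AE_integrable_fst[OF i] AE_space
  proof eventually_elim
    case (elim z)
    have m: "(\<lambda>w. tensor (y w) (y w) z) \<in> borel_measurable M"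
      using measurable_compose[OF measurable_Pair1'[OF elim(2)] joint_tensor] by simp
    have "\<bar>kernel z\<bar> \<le> (\<integral>w. \<bar>1 * tensor (y w) (y w) z\<bar> \<partial>M)"
      unfolding kernel_def using integral_abs_bound[of M "\<lambda>w. tensor (y w) (y w) z"] by simp
    also have "\<dots> \<le> sqrt (\<integral>w. 1\<^sup>2 \<partial>M) * sqrt (\<integral>w. (tensor (y w) (y w) z)\<^sup>2 \<partial>M)"
      using elim(1) m by (intro integral_Cauchy_Schwarz(2)) simp_all
    finally have "\<bar>kernel z\<bar> \<le> sqrt (\<integral>w. (tensor (y w) (y w) z)\<^sup>2 \<partial>M)"
      using prob_space by simp
    then have "\<bar>kernel z\<bar>\<^sup>2 \<le> (sqrt (\<integral>w. (tensor (y w) (y w) z)\<^sup>2 \<partial>M))\<^sup>2"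
      by (rule power_mono) simp
    then show ?case by simp
  qed
qed (use kernel_measurable in simp)

lemma kernel_form:
  assumes "g \<in> L2" "h \<in> L2"
  shows "integrable Sq (\<lambda>z. tensor g h z * kernel z)"
    "(\<integral>z. tensor g h z * kernel z \<partial>Sq) = (\<integral>w. ip g (y w) * ip h (y w) \<partial>M)"
    "integrable M (\<lambda>w. ip g (y w) * ip h (y w))"
proof -
  note k = kernel_pairing[OF measurable_tensor tensor_square(1)[OF assms], OF L2_measurable L2_measurable,
      OF assms]
  show "integrable Sq (\<lambda>z. tensor g h z * kernel z)" by (rule k(1))
  have eq: "(\<integral>z. tensor g h z * tensor (y w) (y w) z \<partial>Sq) = ip g (y w) * ip h (y w)" if "w \<in> space M" for w
    by (intro tensor_pairing assms L2 that)
  show "(\<integral>z. tensor g h z * kernel z \<partial>Sq) = (\<integral>w. ip g (y w) * ip h (y w) \<partial>M)"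
    unfolding k(3) by (intro Bochner_Integration.integral_cong eq refl)
  show "integrable M (\<lambda>w. ip g (y w) * ip h (y w))"
    using k(2) by (rule Bochner_Integration.integrable_cong[THEN iffD1, rotated -1]) (simp_all add: eq)
qed

text \<open>Applying \<open>kernel_pairing\<close> to the kernel itself, and then once more inside, expresses its
  Hilbert--Schmidt norm through two independent copies of the random function.\<close>

lemma kernel_norm:
  "(\<integral>z. (kernel z)\<^sup>2 \<partial>Sq) = (\<integral>w. (\<integral>w'. (ip (y w) (y w'))\<^sup>2 \<partial>M) \<partial>M)"
proof -
  have "(\<integral>z. (kernel z)\<^sup>2 \<partial>Sq) = (\<integral>w. (\<integral>z. tensor (y w) (y w) z * kernel z \<partial>Sq) \<partial>M)"
    using kernel_pairing(3)[OF kernel_measurable kernel_square_integrable]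
    by (simp add: power2_eq_square mult.commute)
  also have "\<dots> = (\<integral>w. (\<integral>w'. (ip (y w) (y w'))\<^sup>2 \<partial>M) \<partial>M)"
    by (intro Bochner_Integration.integral_cong refl) (simp add: kernel_form L2 power2_eq_square)
  finally show ?thesis .
qed

lemma iterated_kernel:
  assumes g: "g \<in> L2" and h: "h \<in> L2"
  shows "(\<integral>t. (\<integral>s. kernel (t, s) * g s \<partial>I01) * h t \<partial>I01) = (\<integral>w. ip g (y w) * ip h (y w) \<partial>M)"
proof -
  have "(\<integral>t. (\<integral>s. kernel (t, s) * g s \<partial>I01) * h t \<partial>I01)
      = (\<integral>t. (\<integral>s. tensor h g (t, s) * kernel (t, s) \<partial>I01) \<partial>I01)"
  proof (intro Bochner_Integration.integral_cong refl)
    fix t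
    have "(\<integral>s. kernel (t, s) * g s \<partial>I01) * h t = (\<integral>s. kernel (t, s) * g s * h t \<partial>I01)" by simp
    then show "(\<integral>s. kernel (t, s) * g s \<partial>I01) * h t = (\<integral>s. tensor h g (t, s) * kernel (t, s) \<partial>I01)"
      by (simp only: tensor_def fst_conv snd_conv mult_ac)
  qed
  also have "\<dots> = (\<integral>z. tensor h g z * kernel z \<partial>Sq)"
    by (rule Sq.integral_fst'[OF kernel_form(1)[OF h g]])
  finally show ?thesis unfolding kernel_form(2)[OF h g] by (simp only: mult.commute)
qed

end

text \<open>Passage from an eigensystem of an operator on representatives to the form that it induces on
  classes. The almost-everywhere identities of the eigensystem can be integrated against any square-integrable function.\<close>

lemma eigen_formI:
  assumes sys: "eigensystem T lam v"
    and form: "\<And>g h. g \<in> L2 \<Longrightarrow> h \<in> L2 \<Longrightarrow>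
      B (L2_class_of g) (L2_class_of h) = (\<integral>t. T g t * h t \<partial>I01)"
    and meas: "\<And>g. g \<in> L2 \<Longrightarrow> T g \<in> borel_measurable I01"
    and B: "bounded_bilinear B" "\<And>x y. B x y = B y x" "\<And>x. 0 \<le> B x x"
  shows "eigen_form B lam (\<lambda>i. L2_class_of (v i))"
proof (rule eigen_form.intro)
  have v: "v i \<in> L2" for i using sys by (simp add: eigensystem_def)
  show "inner (L2_class_of (v i)) (L2_class_of (v j)) = (if i = j then 1 else 0)" for i j
    using sys by (simp add: inner_L2_class_of v eigensystem_def)
  show "decseq lam" using sys by (simp add: eigensystem_def)
  show "B (L2_class_of (v i)) y = lam i * inner (L2_class_of (v i)) y" for i y
  proof -
    obtain h where h: "h \<in> L2" "y = L2_class_of h" using L2_class_of_surj by blast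
    have ae: "AE t in I01. T (v i) t = lam i * v i t" using sys by (simp add: eigensystem_def)
    have "(\<integral>t. T (v i) t * h t \<partial>I01) = (\<integral>t. lam i * (v i t * h t) \<partial>I01)"
      using ae meas[OF v] L2_measurable[OF v] L2_measurable[OF h(1)]
      by (intro integral_cong_AE) auto
    then show ?thesis by (simp add: h form v inner_L2_class_of ip_def)
  qed
  show "B x y = 0" if "\<And>i. inner x (L2_class_of (v i)) = 0" for x y
  proof -
    obtain g where g: "g \<in> L2" "x = L2_class_of g" using L2_class_of_surj by blast
    obtain h where h: "h \<in> L2" "y = L2_class_of h" using L2_class_of_surj by blast
    have "\<forall>i. ip g (v i) = 0" using that by (simp add: g inner_L2_class_of v)
    then have ae: "AE t in I01. T g t = 0" using sys g(1) by (simp add: eigensystem_def)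
    have "(\<integral>t. T g t * h t \<partial>I01) = (\<integral>t. 0 \<partial>I01)"
      using ae meas[OF g(1)] L2_measurable[OF h(1)] by (intro integral_cong_AE) auto
    then show ?thesis by (simp add: g h form)
  qed
qed (rule B)+

section \<open>The centred series\<close>

context coupled_innovations begin

text \<open>The product measure is the law of two independent pasts, but here the second past may be taken from
  a second run of the whole probability space. This connects the coupled quantities with
  the iterated expectations produced by Fubini's theorem for kernels.\<close>

lemma expectation_independent_copies:
  fixes F :: "(nat \<Rightarrow> 's) \<Rightarrow> 'h :: {real_inner, second_countable_topology}" and \<phi> :: "'h \<Rightarrow> 'h \<Rightarrow> real"
  assumes F [measurable]: "F \<in> borel_measurable seqs"
    and \<phi>: "case_prod \<phi> \<in> borel_measurable (borel \<Otimes>\<^sub>M borel)"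
    and int: "integrable (seqs \<Otimes>\<^sub>M seqs) (\<lambda>z. \<phi> (F (fst z)) (F (snd z)))"
  shows "(\<integral>z. \<phi> (F (fst z)) (F (snd z)) \<partial>(seqs \<Otimes>\<^sub>M seqs))
    = expectation (\<lambda>w. expectation (\<lambda>w'. \<phi> (F (past n w)) (F (past m w'))))"
proof -
  interpret Q: prob_space seqs by (intro prob_space_PiM prob_space_P)
  interpret QQ: pair_sigma_finite seqs seqs ..
  have \<phi>m: "(\<lambda>z. \<phi> (F (fst z)) (F (snd z))) \<in> borel_measurable (seqs \<Otimes>\<^sub>M seqs)" using int by blast
  have 1: "expectation (\<lambda>w'. \<phi> u (F (past m w'))) = (\<integral>x. \<phi> u (F x) \<partial>seqs)" for u
  proof -
    have "(\<lambda>x. (u, F x)) \<in> seqs \<rightarrow>\<^sub>M borel \<Otimes>\<^sub>M borel" by measurable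
    then have "(\<lambda>x. \<phi> u (F x)) \<in> borel_measurable seqs"
      using measurable_compose[OF _ \<phi>, of "\<lambda>x. (u, F x)" seqs] by simp
    from integral_distr[OF measurable_past this, of m] show ?thesis by (simp add: distr_past)
  qed
  have "(\<lambda>x. \<integral>x'. \<phi> (F x) (F x') \<partial>seqs) \<in> borel_measurable seqs"
    using Q.borel_measurable_lebesgue_integral[of "\<lambda>x x'. \<phi> (F x) (F x')" seqs] \<phi>m
    by (simp add: case_prod_beta')
  from integral_distr[OF measurable_past this, of n]
  have "(\<integral>x. (\<integral>x'. \<phi> (F x) (F x') \<partial>seqs) \<partial>seqs) = expectation (\<lambda>w. \<integral>x'. \<phi> (F (past n w)) (F x') \<partial>seqs)"
    by (simp add: distr_past)
  then show ?thesis using QQ.integral_fst'[OF int] by (simp add: 1)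
qed

end

context short_memory begin

lemma kappa_iterated:
  "expectation (\<lambda>w. expectation (\<lambda>w'. (inner (U n w) (U m w'))\<^sup>2)) = \<kappa>"
proof -
  have \<phi>: "case_prod (\<lambda>x y :: 'h. (inner x y)\<^sup>2) \<in> borel_measurable (borel \<Otimes>\<^sub>M borel)" by measurable
  have "integrable M (\<lambda>w. (inner (U 0 w) (V 0 w))\<^sup>2)"
    by (intro product_integrable fourth_moment_U fourth_moment_V) simp_all
  then have "integrable (distr M (seqs \<Otimes>\<^sub>M seqs) (\<lambda>w. (past 0 w, coupled 0 w)))
      (\<lambda>z. (inner (F (fst z)) (F (snd z)))\<^sup>2)"
    by (subst integrable_distr_eq[OF measurable_Pair[OF measurable_past measurable_coupled] measurable_pairF[OF \<phi>]])
      (simp add: U_def V_def)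
  from expectation_independent_copies[OF measurable_F \<phi> this[unfolded distr_past_coupled], of n m]
  show ?thesis by (simp add: \<kappa>_def U_def)
qed

end

text \<open>The integral defining \<open>nu\<close> is the integral of a real function only when the norm is
  measurable; that is why measurability is a hypothesis.\<close>

lemma nu_four:
  assumes nu: "nu M 4 Z < \<infinity>"
    and meas: "(\<lambda>w. L2norm (Z w)) \<in> borel_measurable M"
  shows "integrable M (\<lambda>w. L2norm (Z w) ^ 4)"
    "nu M 4 Z = ennreal (sqrt (sqrt (\<integral>w. L2norm (Z w) ^ 4 \<partial>M)))"
proof -
  define m where "m = (\<integral>\<^sup>+w. ennreal (L2norm (Z w) powr 4) \<partial>M)"
  have pw: "L2norm g powr 4 = L2norm g ^ 4" for g
    using powr_realpow[of "L2norm g" 4] by (cases "L2norm g = 0") (simp_all add: less_le)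
  have fin: "m \<noteq> \<infinity>" using nu unfolding nu_def m_def by (auto simp: Let_def split: if_splits)
  show i: "integrable M (\<lambda>w. L2norm (Z w) ^ 4)"
    by (rule integrableI_bounded) (use fin meas in \<open>simp_all add: m_def pw less_top[symmetric] top_unique\<close>)
  have m: "m = ennreal (\<integral>w. L2norm (Z w) ^ 4 \<partial>M)"
    unfolding m_def pw by (rule nn_integral_eq_integral[OF i]) simp
  have "(c::real) powr (1 / 4) = sqrt (sqrt c)" if "0 \<le> c" for c
    using that by (simp add: powr_half_sqrt[symmetric] powr_powr)
  then show "nu M 4 Z = ennreal (sqrt (sqrt (\<integral>w. L2norm (Z w) ^ 4 \<partial>M)))"
    unfolding nu_def Let_def m_def[symmetric] using fin m by simp
qed

text \<open>The hypotheses of the theorem that concern the series alone.\<close>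

locale approximable_series = prob_space M for M :: "'w measure" +
  fixes S :: "'s measure" and X Y :: "int \<Rightarrow> 'w \<Rightarrow> real \<Rightarrow> real" and \<mu> :: "real \<Rightarrow> real"
  assumes approximable: "Lp_m_approximable M S 4 X"
    and jointly_measurable: "\<And>n. (\<lambda>(t, w). X n w t) \<in> borel_measurable (I01 \<Otimes>\<^sub>M M)"
    and second_moment: "(SUP t\<in>{0..1}. \<integral>\<^sup>+w. ennreal (\<bar>X 1 w t\<bar>\<^sup>2) \<partial>M) < \<infinity>"
    and mean_measurable: "\<mu> \<in> borel_measurable I01"
    and decomposition: "\<And>n w t. w \<in> space M \<Longrightarrow> t \<in> {0..1} \<Longrightarrow> X n w t = \<mu> t + Y n w t"
    and centered: "\<And>n. AE t in I01. (\<integral>w. Y n w t \<partial>M) = 0"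
begin

lemma X_Lp: "X n \<in> Lp_H M 4"
  using approximable by (simp add: Lp_m_approximable_def)

lemma X_measurable: "X n \<in> M \<rightarrow>\<^sub>M borel_L2"
  using X_Lp by (simp add: Lp_H_def)

lemma X_L2: "w \<in> space M \<Longrightarrow> X n w \<in> L2"
  using measurable_space[OF X_measurable] by (simp add: space_borel_L2)

lemma class_X_measurable: "(\<lambda>w. L2_class_of (X n w)) \<in> borel_measurable M"
  by (rule measurable_compose[OF X_measurable measurable_L2_class_of])

lemma X_fourth: "integrable M (\<lambda>w. L2norm (X n w) ^ 4)"
proof (rule nu_four(1))
  show "nu M 4 (X n) < \<infinity>" using X_Lp by (simp add: Lp_H_def)
  have "(\<lambda>w. norm (L2_class_of (X n w))) \<in> borel_measurable M" using class_X_measurable by simp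
  then show "(\<lambda>w. L2norm (X n w)) \<in> borel_measurable M"
    by (rule measurable_cong[THEN iffD1, rotated]) (simp add: norm_L2_class_of X_L2)
qed

lemma X_pointwise:
  assumes t: "t \<in> {0..1}"
  shows "(\<lambda>w. X n w t) \<in> borel_measurable M"
    and "integrable M (\<lambda>w. (X 1 w t)\<^sup>2)" "integrable M (\<lambda>w. X 1 w t)"
proof -
  show m: "(\<lambda>w. X n w t) \<in> borel_measurable M" for n
    using measurable_compose[OF measurable_Pair1'[of t I01] jointly_measurable] t by simp
  have "(\<integral>\<^sup>+w. ennreal (\<bar>X 1 w t\<bar>\<^sup>2) \<partial>M) < \<infinity>"
    by (rule le_less_trans[OF SUP_upper[OF t] second_moment])
  then show i: "integrable M (\<lambda>w. (X 1 w t)\<^sup>2)"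
    using m[of 1] by (intro integrableI_bounded) simp_all
  show "integrable M (\<lambda>w. X 1 w t)" using m[of 1] i by (rule square_integrable_imp_integrable)
qed

text \<open>A vanishing integral of \<open>Y 1 w t\<close> says something about the mean only because \<open>X 1\<close> is
  integrable at every \<open>t\<close>, by the second-moment hypothesis.\<close>

lemma mean_eq: "AE t in I01. \<mu> t = expectation (\<lambda>w. X 1 w t)"
  using centered[of 1] AE_space
proof eventually_elim
  case (elim t)
  then have t: "t \<in> {0..1}" by simp
  have "expectation (\<lambda>w. Y 1 w t) = expectation (\<lambda>w. X 1 w t - \<mu> t)"
    using decomposition t by (intro Bochner_Integration.integral_cong) auto
  also have "\<dots> = expectation (\<lambda>w. X 1 w t) - \<mu> t"
    using X_pointwise(3)[OF t] prob_space by simp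
  finally show ?case using elim(1) by simp
qed

lemma mean_L2: "\<mu> \<in> L2"
proof -
  obtain c where c: "0 \<le> c" "(SUP t\<in>{0..1}. \<integral>\<^sup>+w. ennreal (\<bar>X 1 w t\<bar>\<^sup>2) \<partial>M) = ennreal c"
    using second_moment by (auto simp: less_top_ennreal)
  have "AE t in I01. norm ((\<mu> t)\<^sup>2) \<le> c"
    using mean_eq AE_space
  proof eventually_elim
    case (elim t)
    then have t: "t \<in> {0..1}" by simp
    have "(\<mu> t)\<^sup>2 \<le> expectation (\<lambda>w. (X 1 w t)\<^sup>2)"
      unfolding elim(1) using X_pointwise(2,3)[OF t] variance_positive[of "\<lambda>w. X 1 w t"]
      by (simp add: variance_eq)
    moreover have "ennreal (expectation (\<lambda>w. (X 1 w t)\<^sup>2)) \<le> ennreal c"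
      using X_pointwise(2)[OF t] SUP_upper[OF t, of "\<lambda>t. \<integral>\<^sup>+w. ennreal (\<bar>X 1 w t\<bar>\<^sup>2) \<partial>M"]
      unfolding c(2) by (simp add: nn_integral_eq_integral)
    ultimately show ?case using c(1) by simp
  qed
  then have "integrable I01 (\<lambda>t. (\<mu> t)\<^sup>2)"
    using mean_measurable by (intro I01.integrable_const_bound[of _ c]) simp_all
  then show ?thesis using mean_measurable by (simp add: L2_def)
qed

text \<open>The functions \<open>y n w\<close> and \<open>Y n w\<close> agree on the unit interval for every sample point; \<open>y\<close> is
  defined by a total formula, which makes its joint measurability immediate.\<close>

definition y :: "int \<Rightarrow> 'w \<Rightarrow> real \<Rightarrow> real" where "y n w t = X n w t - \<mu> t"
definition Yv :: "int \<Rightarrow> 'w \<Rightarrow> L2_class" where "Yv n w = L2_class_of (y n w)"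

lemma y_L2: "w \<in> space M \<Longrightarrow> y n w \<in> L2"
  using L2_diff[OF X_L2 mean_L2] by (simp add: y_def[abs_def])

lemma Yv_eq: "w \<in> space M \<Longrightarrow> Yv n w = L2_class_of (X n w) - L2_class_of \<mu>"
  by (simp add: Yv_def y_def[abs_def] L2_class_of_diff X_L2 mean_L2)

lemma Yv_measurable [measurable]: "Yv n \<in> borel_measurable M"
proof -
  have "(\<lambda>w. L2_class_of (X n w) - L2_class_of \<mu>) \<in> borel_measurable M"
    using class_X_measurable by (intro borel_measurable_diff) simp_all
  then show ?thesis by (rule measurable_cong[THEN iffD1, rotated]) (simp add: Yv_eq)
qed

lemma inner_Yv: "w \<in> space M \<Longrightarrow> g \<in> L2 \<Longrightarrow> inner (Yv n w) (L2_class_of g) = ip (y n w) g"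
  by (simp add: Yv_def inner_L2_class_of y_L2)

lemma Yv_fourth: "integrable M (\<lambda>w. norm (Yv n w) ^ 4)"
proof (rule Bochner_Integration.integrable_bound)
  show "integrable M (\<lambda>w. 8 * (L2norm (X n w) ^ 4 + L2norm \<mu> ^ 4))" using X_fourth by simp
  have "norm (Yv n w) ^ 4 \<le> 8 * (L2norm (X n w) ^ 4 + L2norm \<mu> ^ 4)" if "w \<in> space M" for w
  proof -
    have "norm (Yv n w) \<le> L2norm (X n w) + L2norm \<mu>"
      using norm_triangle_ineq4[of "L2_class_of (X n w)" "L2_class_of \<mu>"]
      by (simp add: Yv_eq that norm_L2_class_of X_L2 mean_L2)
    then have "norm (Yv n w) ^ 4 \<le> (L2norm (X n w) + L2norm \<mu>) ^ 4" by (intro power_mono) simp_all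
    also have "\<dots> \<le> 8 * (L2norm (X n w) ^ 4 + L2norm \<mu> ^ 4)" by (rule fourth_power_add_le)
    finally show ?thesis .
  qed
  then show "AE w in M. norm (norm (Yv n w) ^ 4) \<le> norm (8 * (L2norm (X n w) ^ 4 + L2norm \<mu> ^ 4))"
    by (intro AE_I2) (simp add: order_trans[OF _ abs_ge_self])
qed simp

sublocale RY: random_L2_function M "y n" for n
proof
  have "(\<lambda>p. (case p of (t, w) \<Rightarrow> X n w t) - \<mu> (fst p)) \<in> borel_measurable (I01 \<Otimes>\<^sub>M M)"
    by (intro borel_measurable_diff jointly_measurable measurable_compose[OF measurable_fst mean_measurable])
  then show "(\<lambda>(t, w). y n w t) \<in> borel_measurable (I01 \<Otimes>\<^sub>M M)"
    by (simp add: y_def case_prod_beta')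
  show "y n w \<in> L2" if "w \<in> space M" for w using that by (rule y_L2)
  show "integrable M (\<lambda>w. L2norm (y n w) ^ 4)"
    using Yv_fourth[of n] by (rule Bochner_Integration.integrable_cong[THEN iffD1, rotated -1])
      (simp_all add: Yv_def norm_L2_class_of y_L2)
qed

lemma Yv_second: "integrable M (\<lambda>w. (norm (Yv n w))\<^sup>2)"
  using Yv_fourth by (intro second_le_fourth_moment) simp_all

text \<open>Weak form of \<open>E Y = 0\<close>, by Fubini's theorem.\<close>

lemma Yv_mean_zero: "expectation (\<lambda>w. inner x (Yv 1 w)) = 0"
proof -
  obtain g where g: "g \<in> L2" "x = L2_class_of g" using L2_class_of_surj by blast
  note [measurable] = L2_measurable[OF g(1)]
  interpret P: pair_sigma_finite I01 M ..
  have jm: "(\<lambda>p. y 1 (snd p) (fst p)) \<in> borel_measurable (I01 \<Otimes>\<^sub>M M)"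
    using RY.joint[of 1] by (simp add: case_prod_beta')
  have y2: "integrable (I01 \<Otimes>\<^sub>M M) (\<lambda>p. (y 1 (snd p) (fst p))\<^sup>2)"
  proof (rule integrableI_bounded)
    show m: "(\<lambda>p. (y 1 (snd p) (fst p))\<^sup>2) \<in> borel_measurable (I01 \<Otimes>\<^sub>M M)" using jm by simp
    have "(\<integral>\<^sup>+p. ennreal (norm ((y 1 (snd p) (fst p))\<^sup>2)) \<partial>(I01 \<Otimes>\<^sub>M M))
        = (\<integral>\<^sup>+w. (\<integral>\<^sup>+t. ennreal ((y 1 w t)\<^sup>2) \<partial>I01) \<partial>M)"
      using m by (subst P.nn_integral_snd[symmetric]) (simp_all add: case_prod_beta)
    also have "\<dots> = (\<integral>\<^sup>+w. ennreal ((norm (Yv 1 w))\<^sup>2) \<partial>M)"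
      by (intro nn_integral_cong) (simp add: nn_integral_square_L2 y_L2 Yv_def norm_L2_class_of)
    also have "\<dots> < \<infinity>" using Yv_second by (subst nn_integral_eq_integral) auto
    finally show "(\<integral>\<^sup>+p. ennreal (norm ((y 1 (snd p) (fst p))\<^sup>2)) \<partial>(I01 \<Otimes>\<^sub>M M)) < \<infinity>" .
  qed
  have g2: "integrable (I01 \<Otimes>\<^sub>M M) (\<lambda>p. (g (fst p))\<^sup>2)"
    using P.integrable_tensor(1)[OF L2_square_integrable[OF g(1)], of "\<lambda>_. 1"] by simp
  have gm: "(\<lambda>p. g (fst p)) \<in> borel_measurable (I01 \<Otimes>\<^sub>M M)"
    by (rule measurable_compose[OF measurable_fst L2_measurable[OF g(1)]])
  have i: "integrable (I01 \<Otimes>\<^sub>M M) (case_prod (\<lambda>t w. g t * y 1 w t))"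
    using integral_Cauchy_Schwarz(1)[OF gm jm g2 y2] by (simp add: case_prod_beta')
  have "expectation (\<lambda>w. inner x (Yv 1 w)) = expectation (\<lambda>w. \<integral>t. g t * y 1 w t \<partial>I01)"
    by (intro Bochner_Integration.integral_cong refl)
      (simp add: g(2) inner_commute[of "L2_class_of g"] inner_Yv g(1), simp add: ip_def mult.commute)
  also have "\<dots> = (\<integral>t. expectation (\<lambda>w. g t * y 1 w t) \<partial>I01)" by (rule P.Fubini_integral[OF i])
  also have "\<dots> = (\<integral>t. 0 \<partial>I01)"
  proof (rule integral_cong_AE)
    show "AE t in I01. expectation (\<lambda>w. g t * y 1 w t) = 0"
      using mean_eq AE_space
    proof eventually_elim
      case (elim t)
      then have t: "t \<in> {0..1}" by simp
      show ?case using X_pointwise(3)[OF t] elim(1) prob_space by (simp add: y_def)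
    qed
    show "(\<lambda>t. expectation (\<lambda>w. g t * y 1 w t)) \<in> borel_measurable I01"
      by (rule borel_measurable_integrable[OF P.integrable_fst[OF i]])
  qed simp
  finally show ?thesis by simp
qed

end

section \<open>The Hilbert--Schmidt distance of the covariance kernels\<close>

context approximable_series begin

text \<open>The function \<open>F\<close> is the class of the generating function minus the mean. The summability of the coupling
  errors is the approximability hypothesis: those errors are measurable because the space of classes
  is separable, and then \<open>nu\<close> is their fourth-moment norm. Independent copies are uncorrelated because, with one of them
  fixed, the other has weak mean zero.\<close>

lemma short_memory_representation:
  obtains eps :: "int \<Rightarrow> 'w \<Rightarrow> 's" and eps' and F :: "(nat \<Rightarrow> 's) \<Rightarrow> L2_class"
  where "short_memory M S eps eps' F"
    and "\<And>n. AE w in M. Yv n w = F (\<lambda>j. eps (n - int j) w)"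
proof -
  obtain f :: "(nat \<Rightarrow> 's) \<Rightarrow> real \<Rightarrow> real" and eps :: "int \<Rightarrow> 'w \<Rightarrow> 's"
    and eps' :: "int \<Rightarrow> int \<Rightarrow> 'w \<Rightarrow> 's" where
    f: "f \<in> measurable (PiM UNIV (\<lambda>_. S)) borel_L2" and
    indep: "indep_vars (\<lambda>_. S) eps UNIV" and
    ident: "\<forall>i. distr M S (eps i) = distr M S (eps 0)" and
    copy: "\<forall>n. distr M (PiM UNIV (\<lambda>_. S)) (\<lambda>w k. eps' n k w)
           = distr M (PiM UNIV (\<lambda>_. S)) (\<lambda>w k. eps k w)" and
    copies: "indep_vars (\<lambda>_. PiM UNIV (\<lambda>_. S))
          (\<lambda>j w k. case j of None \<Rightarrow> eps k w | Some n \<Rightarrow> eps' n k w) (UNIV :: int option set)" and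
    rep: "\<forall>n. AE w in M. AE t in I01. X n w t = f (\<lambda>j. eps (n - int j) w) t" and
    sum: "(\<Sum>k. let m = Suc k in
           nu M 4 (\<lambda>w t. X (int m) w t
             - f (\<lambda>j. if j < m then eps (int m - int j) w
                       else eps' (int m) (int m - int j) w) t)) < \<infinity>"
    using approximable unfolding Lp_m_approximable_def by (elim conjE exE) blast
  interpret C: coupled_innovations M S eps eps'
    by unfold_locales (use indep ident copy copies in blast)+
  define F where "F \<omega> = L2_class_of (f \<omega>) - L2_class_of \<mu>" for \<omega>
  have fm: "f \<in> C.seqs \<rightarrow>\<^sub>M borel_L2"
    using f by (subst measurable_cong_sets[OF C.sets_PiM_P refl])
  have fL2: "f \<omega> \<in> L2" if "\<omega> \<in> space C.seqs" for \<omega>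
    using measurable_space[OF fm that] by (simp add: space_borel_L2)
  have Fm [measurable]: "F \<in> borel_measurable C.seqs"
    unfolding F_def[abs_def]
    by (intro borel_measurable_diff measurable_compose[OF fm measurable_L2_class_of]) simp_all
  have past_space: "C.past n w \<in> space C.seqs" if "w \<in> space M" for n w
    using measurable_space[OF C.measurable_past that] .
  have coupled_space: "C.coupled m w \<in> space C.seqs" if "w \<in> space M" for m w
    using measurable_space[OF C.measurable_coupled that] .
  have YF: "AE w in M. Yv n w = F (C.past n w)" for n
  proof -
    have "AE w in M. AE t in I01. X n w t = f (C.past n w) t"
      using rep by (simp add: C.past_def[abs_def])
    then show ?thesis
      using AE_space
    proof eventually_elim
      case (elim w)
      then have "L2_class_of (X n w) = L2_class_of (f (C.past n w))"
        by (subst L2_class_of_eq_iff) (simp_all add: X_L2 fL2 past_space)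
      then show ?case using elim(2) by (simp add: Yv_eq F_def)
    qed
  qed
  have pm: "(\<lambda>w. F (C.past n w)) \<in> borel_measurable M" for n
    by (rule measurable_compose[OF C.measurable_past Fm])
  have cm: "(\<lambda>w. F (C.coupled m w)) \<in> borel_measurable M" for m
    by (rule measurable_compose[OF C.measurable_coupled Fm])
  have "short_memory M S eps eps' F"
  proof
    show "integrable M (\<lambda>w. norm (F (C.past 0 w)) ^ 4)"
      by (rule integrable_cong_AE_imp[OF Yv_fourth[of 0]])
        (use pm[of 0] YF[of 0] in \<open>auto elim: AE_mp\<close>)
    let ?Z = "\<lambda>m w t. X (int m) w t - f (C.coupled m w) t"
    have normZ: "L2norm (?Z m w) = norm (Yv (int m) w - F (C.coupled m w))" if "w \<in> space M" for m w
    proof -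
      have 1: "X (int m) w \<in> L2" "f (C.coupled m w) \<in> L2"
        using that by (simp_all add: X_L2 fL2 coupled_space)
      have "Yv (int m) w - F (C.coupled m w) = L2_class_of (?Z m w)"
        using that by (simp add: Yv_eq F_def L2_class_of_diff 1)
      then show ?thesis by (simp add: norm_L2_class_of L2_diff 1)
    qed
    have Zm: "(\<lambda>w. L2norm (?Z m w)) \<in> borel_measurable M" for m
    proof -
      have "(\<lambda>w. norm (Yv (int m) w - F (C.coupled m w))) \<in> borel_measurable M" using cm[of m] by simp
      then show ?thesis by (rule measurable_cong[THEN iffD1, rotated]) (simp add: normZ)
    qed
    have sum': "(\<Sum>k. nu M 4 (?Z (Suc k))) < \<infinity>"
      using sum by (simp add: Let_def C.coupled_def[abs_def])
    have fin: "nu M 4 (?Z (Suc k)) < \<infinity>" for k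
      using sum' by (intro le_less_trans[OF _ sum']) (use sum_le_suminf[of "\<lambda>k. nu M 4 (?Z (Suc k))" "{k}"] in simp)
    let ?r = "\<lambda>k. sqrt (sqrt (expectation (\<lambda>w. L2norm (?Z (Suc k) w) ^ 4)))"
    have "(\<Sum>k. ennreal (?r k)) < \<infinity>" using sum' unfolding nu_four(2)[OF fin Zm] .
    then have "summable ?r" by (intro summable_suminf_not_top) (simp_all add: less_top[symmetric])
    moreover have "expectation (\<lambda>w. L2norm (?Z (Suc k) w) ^ 4)
        = expectation (\<lambda>w. norm (F (C.past (int (Suc k)) w) - F (C.coupled (Suc k) w)) ^ 4)" for k
    proof (rule integral_cong_AE)
      show "AE w in M. L2norm (?Z (Suc k) w) ^ 4 = norm (F (C.past (int (Suc k)) w) - F (C.coupled (Suc k) w)) ^ 4"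
        using YF[of "int (Suc k)"] AE_space
      proof eventually_elim
        case (elim w)
        show ?case unfolding normZ[OF elim(2)] elim(1) ..
      qed
    qed (use Zm[of "Suc k"] pm[of "int (Suc k)"] cm[of "Suc k"] in simp_all)
    ultimately show "summable (\<lambda>m. sqrt (sqrt (expectation
          (\<lambda>w. norm (F (C.past (int (Suc m)) w) - F (C.coupled (Suc m) w)) ^ 4))))" by simp
    show "(\<integral>z. inner (F (fst z)) (F (snd z)) \<partial>(C.seqs \<Otimes>\<^sub>M C.seqs)) = 0"
    proof (cases "integrable (C.seqs \<Otimes>\<^sub>M C.seqs) (\<lambda>z. inner (F (fst z)) (F (snd z)))")
      case True
      have 0: "expectation (\<lambda>w'. inner u (F (C.past 1 w'))) = 0" for u
      proof -
        have "expectation (\<lambda>w'. inner u (F (C.past 1 w'))) = expectation (\<lambda>w'. inner u (Yv 1 w'))"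
        proof (rule integral_cong_AE)
          show "AE w' in M. inner u (F (C.past 1 w')) = inner u (Yv 1 w')"
            using YF[of 1] by eventually_elim simp
        qed (use pm[of 1] in simp_all)
        then show ?thesis by (simp add: Yv_mean_zero)
      qed
      have "(\<integral>z. inner (F (fst z)) (F (snd z)) \<partial>(C.seqs \<Otimes>\<^sub>M C.seqs))
          = expectation (\<lambda>w. expectation (\<lambda>w'. inner (F (C.past 1 w)) (F (C.past 1 w'))))"
        by (rule C.expectation_independent_copies[OF Fm _ True]) measurable
      then show ?thesis by (simp add: 0)
    qed (rule not_integrable_integral_eq)
  qed (rule Fm)
  then show thesis using YF by (intro that) (simp_all add: C.past_def[abs_def])
qed

definition Ybar :: "nat \<Rightarrow> 'w \<Rightarrow> L2_class" where
  "Ybar N w = (1 / real N) *\<^sub>R (\<Sum>n=1..N. Yv (int n) w)"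

text \<open>The kernel of the sample covariance about the true mean. Centring at the sample mean
  subtracts a rank-one kernel of norm \<open>\<parallel>Ybar\<parallel>\<^sup>2\<close>, accounted for separately.\<close>

definition emp_kernel :: "nat \<Rightarrow> 'w \<Rightarrow> real \<times> real \<Rightarrow> real" where
  "emp_kernel N w z = (\<Sum>n=1..N. tensor (y (int n) w) (y (int n) w) z) / real N"

definition HS :: "nat \<Rightarrow> 'w \<Rightarrow> real" where
  "HS N w = sqrt (\<integral>z. (emp_kernel N w z - RY.kernel 1 z)\<^sup>2 \<partial>Sq)"

lemma Ybar_measurable [measurable]: "Ybar N \<in> borel_measurable M"
  unfolding Ybar_def[abs_def] by measurable

lemma tensor_y_measurable: "w \<in> space M \<Longrightarrow> tensor (y n w) (y n w) \<in> borel_measurable Sq"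
  by (intro measurable_tensor L2_measurable y_L2)

lemma emp_kernel_measurable: "w \<in> space M \<Longrightarrow> emp_kernel N w \<in> borel_measurable Sq"
  unfolding emp_kernel_def[abs_def]
  by (intro borel_measurable_divide borel_measurable_sum tensor_y_measurable) simp_all

lemma kernel_Yv:
  assumes w: "w \<in> space M"
  shows "(\<integral>z. tensor (y n w) (y n w) z * RY.kernel 1 z \<partial>Sq) = expectation (\<lambda>w'. (inner (Yv n w) (Yv 1 w'))\<^sup>2)"
proof -
  have "(\<integral>z. tensor (y n w) (y n w) z * RY.kernel 1 z \<partial>Sq)
      = expectation (\<lambda>w'. ip (y n w) (y 1 w') * ip (y n w) (y 1 w'))"
    by (intro RY.kernel_form y_L2 w)
  also have "\<dots> = expectation (\<lambda>w'. (inner (Yv n w) (Yv 1 w'))\<^sup>2)"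
    by (intro Bochner_Integration.integral_cong refl)
      (simp add: Yv_def inner_L2_class_of y_L2 w power2_eq_square)
  finally show ?thesis .
qed

text \<open>Besides the norm of the covariance kernel, the square expands into pairings of rank-one kernels with each
  other and with the covariance kernel. These are squared inner products, the latter averaged over an
  independent copy.\<close>

lemma HS_square_expansion:
  assumes w: "w \<in> space M"
  shows "integrable Sq (\<lambda>z. (emp_kernel N w z - RY.kernel 1 z)\<^sup>2)"
    and "(HS N w)\<^sup>2 = (\<Sum>n=1..N. \<Sum>m=1..N. (inner (Yv (int n) w) (Yv (int m) w))\<^sup>2) / (real N)\<^sup>2
      - 2 * ((\<Sum>n=1..N. expectation (\<lambda>w'. (inner (Yv (int n) w) (Yv 1 w'))\<^sup>2)) / real N)
      + (\<integral>z. (RY.kernel 1 z)\<^sup>2 \<partial>Sq)" (is "_ = ?rhs")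
proof -
  let ?T = "\<lambda>n. tensor (y n w) (y n w)" and ?k = "RY.kernel 1"
  have TT: "integrable Sq (\<lambda>z. ?T n z * ?T m z)"
    "(\<integral>z. ?T n z * ?T m z \<partial>Sq) = (inner (Yv n w) (Yv m w))\<^sup>2" for n m
    using tensor_pairing[OF y_L2[OF w] y_L2[OF w] y_L2[OF w] y_L2[OF w], of n n m m]
    by (simp_all add: power2_eq_square Yv_def inner_L2_class_of y_L2 w)
  have Tk: "integrable Sq (\<lambda>z. ?T n z * ?k z)"
    "(\<integral>z. ?T n z * ?k z \<partial>Sq) = expectation (\<lambda>w'. (inner (Yv n w) (Yv 1 w'))\<^sup>2)" for n
    by (intro RY.kernel_form y_L2 w) (rule kernel_Yv[OF w])
  have k2: "integrable Sq (\<lambda>z. (?k z)\<^sup>2)" by (rule RY.kernel_square_integrable)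
  have eq: "(emp_kernel N w z - ?k z)\<^sup>2 = (\<Sum>n=1..N. \<Sum>m=1..N. ?T (int n) z * ?T (int m) z) / (real N)\<^sup>2
      - 2 * ((\<Sum>n=1..N. ?T (int n) z * ?k z) / real N) + (?k z)\<^sup>2" for z
  proof -
    have "(\<Sum>n=1..N. ?T (int n) z) * (\<Sum>n=1..N. ?T (int n) z) = (\<Sum>n=1..N. \<Sum>m=1..N. ?T (int n) z * ?T (int m) z)"
      by (rule sum_product)
    then show ?thesis
      by (simp add: emp_kernel_def power2_diff power_divide sum_distrib_right[symmetric])
        (simp add: power2_eq_square)
  qed
  have i1: "integrable Sq (\<lambda>z. (\<Sum>n=1..N. \<Sum>m=1..N. ?T (int n) z * ?T (int m) z) / (real N)\<^sup>2)"
    and i2: "integrable Sq (\<lambda>z. 2 * ((\<Sum>n=1..N. ?T (int n) z * ?k z) / real N))"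
    by (intro integrable_divide_zero integrable_mult_right Bochner_Integration.integrable_sum TT Tk)+
  show "integrable Sq (\<lambda>z. (emp_kernel N w z - ?k z)\<^sup>2)"
    unfolding eq by (intro Bochner_Integration.integrable_add Bochner_Integration.integrable_diff i1 i2 k2)
  have "(HS N w)\<^sup>2 = (\<integral>z. (emp_kernel N w z - ?k z)\<^sup>2 \<partial>Sq)" by (simp add: HS_def)
  also have "\<dots> = (\<integral>z. (\<Sum>n=1..N. \<Sum>m=1..N. ?T (int n) z * ?T (int m) z) / (real N)\<^sup>2 \<partial>Sq)
      - (\<integral>z. 2 * ((\<Sum>n=1..N. ?T (int n) z * ?k z) / real N) \<partial>Sq) + (\<integral>z. (?k z)\<^sup>2 \<partial>Sq)"
    unfolding eq using i1 i2 k2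
    by (subst Bochner_Integration.integral_add) (auto intro: Bochner_Integration.integrable_diff
        simp: Bochner_Integration.integral_diff)
  also have "\<dots> = ?rhs"
    by (simp add: TT Tk Bochner_Integration.integral_sum Bochner_Integration.integrable_sum)
  finally show "(HS N w)\<^sup>2 = ?rhs" .
qed

lemma HS_nonneg: "0 \<le> HS N w" by (simp add: HS_def)

end

section \<open>Rates of the moments and convergence in probability\<close>

lemma outer_measure_le_emeasure: "A \<subseteq> B \<Longrightarrow> B \<in> sets M \<Longrightarrow> outer_measure_of M A \<le> emeasure M B"
  unfolding outer_measure_of_def by (rule INF_lower) simp

text \<open>Markov's inequality is applied to the square root of the product. Its expectation is at most
  \<open>\<surd>(E A \<cdot> E D)\<close>, so first moments of \<open>A\<close> and \<open>D\<close> suffice although the product itself need not be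
  integrable. The variables \<open>Z N\<close> may be non-measurable; the majorant is measurable, and this bounds the outer
  probability.\<close>

lemma (in prob_space) oP1_by_products:
  fixes A D :: "nat \<Rightarrow> 'a \<Rightarrow> real" and r :: "nat \<Rightarrow> real"
  assumes A: "\<And>N. 1 \<le> N \<Longrightarrow> integrable M (A N)" "\<And>N w. 0 \<le> A N w" "\<And>N. 1 \<le> N \<Longrightarrow> expectation (A N) \<le> a"
    and D: "\<And>N. 1 \<le> N \<Longrightarrow> integrable M (D N)" "\<And>N w. 0 \<le> D N w"
      "\<And>N. 1 \<le> N \<Longrightarrow> expectation (D N) \<le> c / sqrt (real N)"
    and r: "\<And>N. 0 \<le> r N" "(\<lambda>N. r N / sqrt (real N)) \<longlonglongrightarrow> 0"
    and Z: "\<And>N w. 1 \<le> N \<Longrightarrow> w \<in> space M \<Longrightarrow> \<bar>Z N w\<bar> \<le> r N * (A N w * D N w)"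
  shows "oP1 M Z"
  unfolding oP1_def
proof (intro allI impI)
  fix e :: real assume e: "e > 0"
  let ?b = "\<lambda>N. sqrt (a * c * (r N / sqrt (real N))) / sqrt e"
  have bound: "outer_measure_of M {w \<in> space M. e < \<bar>Z N w\<bar>} \<le> ennreal (?b N)" if N: "1 \<le> N" for N
  proof -
    have [measurable]: "A N \<in> borel_measurable M" "D N \<in> borel_measurable M"
      using A(1)[OF N] D(1)[OF N] by simp_all
    let ?W = "\<lambda>w. sqrt (A N w) * sqrt (D N w)"
    have sq: "integrable M (\<lambda>w. (sqrt (A N w))\<^sup>2)" "integrable M (\<lambda>w. (sqrt (D N w))\<^sup>2)"
      using A(1)[OF N] D(1)[OF N] A(2) D(2) by simp_all
    have W: "integrable M ?W" by (intro integral_Cauchy_Schwarz sq) simp_all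
    have "expectation ?W \<le> expectation (\<lambda>w. \<bar>?W w\<bar>)"
      by (intro integral_mono W integrable_abs) simp
    also have "\<dots> \<le> sqrt (expectation (\<lambda>w. (sqrt (A N w))\<^sup>2)) * sqrt (expectation (\<lambda>w. (sqrt (D N w))\<^sup>2))"
      by (intro integral_Cauchy_Schwarz sq) simp_all
    also have "\<dots> = sqrt (expectation (A N)) * sqrt (expectation (D N))" by (simp add: A(2) D(2))
    also have "\<dots> \<le> sqrt a * sqrt (c / sqrt (real N))"
    proof (intro mult_mono real_sqrt_le_mono A(3) D(3) N)
      have "0 \<le> expectation (A N)" using A(2) by simp
      then show "0 \<le> sqrt a" using A(3)[OF N] by simp
    qed (use D(2) in simp)
    finally have EW: "expectation ?W \<le> sqrt (a * c / sqrt (real N))" by (simp flip: real_sqrt_mult)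
    have "{w \<in> space M. e < \<bar>Z N w\<bar>} \<subseteq> {w \<in> space M. sqrt e \<le> sqrt (r N) * ?W w}"
    proof safe
      fix w assume w: "w \<in> space M" "e < \<bar>Z N w\<bar>"
      then have "e \<le> r N * (A N w * D N w)" using Z[OF N w(1)] by linarith
      then have "sqrt e \<le> sqrt (r N * (A N w * D N w))" by simp
      then show "sqrt e \<le> sqrt (r N) * ?W w" by (simp add: real_sqrt_mult)
    qed
    then have "outer_measure_of M {w \<in> space M. e < \<bar>Z N w\<bar>} \<le> emeasure M {w \<in> space M. sqrt e \<le> sqrt (r N) * ?W w}"
      by (rule outer_measure_le_emeasure) measurable
    also have "\<dots> \<le> ennreal ((1 / sqrt e) * expectation (\<lambda>w. sqrt (r N) * ?W w))"
      using e A(2) D(2) r(1) by (intro integral_Markov_inequality integrable_mult_right W) (auto intro!: AE_I2)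
    also have "\<dots> \<le> ennreal (?b N)"
    proof (rule ennreal_leI)
      have "expectation (\<lambda>w. sqrt (r N) * ?W w) = sqrt (r N) * expectation ?W" by simp
      also have "\<dots> \<le> sqrt (r N) * sqrt (a * c / sqrt (real N))"
        by (intro mult_left_mono EW) (simp add: r(1))
      also have "\<dots> = sqrt (a * c * (r N / sqrt (real N)))"
        by (simp add: mult_ac flip: real_sqrt_mult)
      finally show "(1 / sqrt e) * expectation (\<lambda>w. sqrt (r N) * ?W w) \<le> ?b N"
        using e by (simp add: divide_right_mono)
    qed
    finally show ?thesis .
  qed
  have "(\<lambda>N. sqrt (a * c * (r N / sqrt (real N))) / sqrt e) \<longlonglongrightarrow> sqrt (a * c * 0) / sqrt e"
    using e by (intro tendsto_intros r) simp
  then have "(\<lambda>N. ennreal (?b N)) \<longlonglongrightarrow> ennreal 0" by (intro tendsto_ennrealI) simp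
  then have lim: "(\<lambda>N. ennreal (?b N)) \<longlonglongrightarrow> 0" by simp
  show "(\<lambda>N. outer_measure_of M {w \<in> space M. e < \<bar>Z N w\<bar>}) \<longlonglongrightarrow> 0"
  proof (rule tendsto_sandwich[OF _ _ tendsto_const lim])
    show "\<forall>\<^sub>F N in sequentially. outer_measure_of M {w \<in> space M. e < \<bar>Z N w\<bar>} \<le> ennreal (?b N)"
      by (rule eventually_sequentiallyI[of 1]) (rule bound)
  qed simp
qed

lemma (in prob_space) expectation_le_sqrt_second_moment:
  fixes f :: "'a \<Rightarrow> real"
  assumes "f \<in> borel_measurable M" "integrable M (\<lambda>w. (f w)\<^sup>2)"
  shows "integrable M f" "expectation f \<le> sqrt (expectation (\<lambda>w. (f w)\<^sup>2))"
proof -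
  show i: "integrable M f" by (rule square_integrable_imp_integrable[OF assms])
  have "expectation f \<le> expectation (\<lambda>w. \<bar>f w * 1\<bar>)" by (intro integral_mono) (use i in auto)
  also have "\<dots> \<le> sqrt (expectation (\<lambda>w. (f w)\<^sup>2)) * sqrt (expectation (\<lambda>w. 1\<^sup>2))"
    by (intro integral_Cauchy_Schwarz(2) assms) simp_all
  finally show "expectation f \<le> sqrt (expectation (\<lambda>w. (f w)\<^sup>2))" using prob_space by simp
qed

context approximable_series begin

text \<open>The summand \<open>1\<close> makes the amplitude dominate also the average of the norms, through
  \<open>x \<le> 1 + x\<^sup>2\<close>.\<close>

definition amplitude :: "nat \<Rightarrow> 'w \<Rightarrow> real" where
  "amplitude N w = 1 + (\<Sum>n=1..N. (norm (Yv (int n) w))\<^sup>2) / real N"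

definition deviation :: "nat \<Rightarrow> 'w \<Rightarrow> real" where
  "deviation N w = HS N w + (norm (Ybar N w))\<^sup>2 + norm (Ybar N w)"

lemma amplitude_nonneg: "0 \<le> amplitude N w"
  by (simp add: amplitude_def sum_nonneg add_nonneg_nonneg)

lemma deviation_nonneg: "0 \<le> deviation N w"
  by (simp add: deviation_def HS_nonneg)

lemma amplitude_integrable: "integrable M (amplitude N)"
  unfolding amplitude_def[abs_def]
  by (intro Bochner_Integration.integrable_add integrable_divide_zero Bochner_Integration.integrable_sum Yv_second) simp_all

lemma square_covariance_integrable: "integrable M (\<lambda>w. (inner (Yv n w) (Yv m w))\<^sup>2)"
proof (rule Bochner_Integration.integrable_bound)
  show "integrable M (\<lambda>w. (norm (Yv n w))\<^sup>2 * (norm (Yv m w))\<^sup>2)"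
    using Yv_fourth by (intro integral_Cauchy_Schwarz(1)) simp_all
qed (auto simp: power2_norm_eq_inner Cauchy_Schwarz_ineq)

lemma iterated_covariance_integrable:
  "integrable M (\<lambda>w. expectation (\<lambda>w'. (inner (Yv n w) (Yv 1 w'))\<^sup>2))"
proof -
  have i: "integrable M (\<lambda>w. \<integral>z. tensor (y n w) (y n w) z * RY.kernel 1 z \<partial>Sq)"
    using RY.kernel_pairing(2)[OF RY.kernel_measurable RY.kernel_square_integrable, of 1 n]
    by (simp only: mult.commute)
  show ?thesis
    using i by (rule Bochner_Integration.integrable_cong[THEN iffD1, rotated -1]) (simp_all only: kernel_Yv)
qed

lemma HS_moments:
  "HS N \<in> borel_measurable M" "integrable M (\<lambda>w. (HS N w)\<^sup>2)"
  "expectation (\<lambda>w. (HS N w)\<^sup>2)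
    = (\<Sum>n=1..N. \<Sum>m=1..N. expectation (\<lambda>w. (inner (Yv (int n) w) (Yv (int m) w))\<^sup>2)) / (real N)\<^sup>2
      - 2 * ((\<Sum>n=1..N. expectation (\<lambda>w. expectation (\<lambda>w'. (inner (Yv (int n) w) (Yv 1 w'))\<^sup>2))) / real N)
      + (\<integral>z. (RY.kernel 1 z)\<^sup>2 \<partial>Sq)" (is "_ = ?A - ?B + ?c")
proof -
  let ?a = "\<lambda>w. (\<Sum>n=1..N. \<Sum>m=1..N. (inner (Yv (int n) w) (Yv (int m) w))\<^sup>2) / (real N)\<^sup>2"
  let ?b = "\<lambda>w. 2 * ((\<Sum>n=1..N. expectation (\<lambda>w'. (inner (Yv (int n) w) (Yv 1 w'))\<^sup>2)) / real N)"
  have a: "integrable M ?a"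
    by (intro integrable_divide_zero Bochner_Integration.integrable_sum square_covariance_integrable)
  have b: "integrable M ?b"
    by (intro integrable_mult_right integrable_divide_zero Bochner_Integration.integrable_sum
        iterated_covariance_integrable)
  have abc: "integrable M (\<lambda>w. ?a w - ?b w + ?c)"
    by (intro Bochner_Integration.integrable_add Bochner_Integration.integrable_diff a b) simp
  have eq: "(HS N w)\<^sup>2 = ?a w - ?b w + ?c" if "w \<in> space M" for w
    by (rule HS_square_expansion(2)[OF that])
  show "integrable M (\<lambda>w. (HS N w)\<^sup>2)"
    using abc by (rule Bochner_Integration.integrable_cong[THEN iffD1, rotated -1]) (simp_all only: eq)
  then have "(\<lambda>w. sqrt ((HS N w)\<^sup>2)) \<in> borel_measurable M"
    by (intro measurable_compose[OF borel_measurable_integrable borel_measurable_sqrt])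
  then show "HS N \<in> borel_measurable M" by (simp add: HS_nonneg)
  have "expectation (\<lambda>w. (HS N w)\<^sup>2) = expectation (\<lambda>w. ?a w - ?b w + ?c)"
    by (intro Bochner_Integration.integral_cong refl eq)
  also have "\<dots> = expectation ?a - expectation ?b + ?c"
    using a b prob_space by simp
  also have "expectation ?a = ?A"
    by (simp add: Bochner_Integration.integrable_sum square_covariance_integrable)
  also have "expectation ?b = ?B"
    by (simp add: iterated_covariance_integrable)
  finally show "expectation (\<lambda>w. (HS N w)\<^sup>2) = ?A - ?B + ?c" .
qed

lemma kernel_norm_Yv:
  "(\<integral>z. (RY.kernel 1 z)\<^sup>2 \<partial>Sq) = expectation (\<lambda>w. expectation (\<lambda>w'. (inner (Yv 1 w) (Yv 1 w'))\<^sup>2))"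
  unfolding RY.kernel_norm
  by (intro Bochner_Integration.integral_cong refl) (simp add: Yv_def inner_L2_class_of y_L2)

text \<open>The expectation of \<open>HS\<^sup>2\<close> is the average of \<open>E \<langle>Y\<^sub>n, Y\<^sub>m\<rangle>\<^sup>2\<close> minus \<open>2 \<kappa>\<close> plus \<open>\<kappa>\<close>: the
  cross terms and the norm of the covariance kernel both involve independent copies. Both rates then
  come from the decay of lagged covariances.\<close>

lemma moment_rates:
  obtains K where "0 \<le> K" "\<And>N. 1 \<le> N \<Longrightarrow> expectation (\<lambda>w. (norm (Ybar N w))\<^sup>2) \<le> K / real N"
    "\<And>N. 1 \<le> N \<Longrightarrow> expectation (\<lambda>w. (HS N w)\<^sup>2) \<le> K / real N"
    "\<And>N. 1 \<le> N \<Longrightarrow> expectation (amplitude N) \<le> 1 + K"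
proof -
  obtain eps eps' F where sm: "short_memory M S eps eps' F"
    and rep: "\<And>n. AE w in M. Yv n w = F (\<lambda>j. eps (n - int j) w)"
    using short_memory_representation by blast
  interpret F: short_memory M S eps eps' F by fact
  have YU: "AE w in M. Yv n w = F.U n w" for n
    using rep[of n] by (simp add: F.U_def F.past_def[abs_def])
  obtain K1 where K1: "0 \<le> K1" "\<And>N. 1 \<le> N \<Longrightarrow>
      expectation (\<lambda>w. (norm ((1 / real N) *\<^sub>R (\<Sum>n=1..N. F.U (int n) w)))\<^sup>2) \<le> K1 / real N"
    using F.mean_square_average by blast
  obtain K2 where K2: "0 \<le> K2" "\<And>N. 1 \<le> N \<Longrightarrow> (\<Sum>n=1..N. \<Sum>m=1..N.
      expectation (\<lambda>w. (inner (F.U (int n) w) (F.U (int m) w))\<^sup>2) - F.\<kappa>) / (real N)\<^sup>2 \<le> K2 / real N"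
    using F.mean_squared_covariances by blast
  have cov: "expectation (\<lambda>w. (inner (Yv n w) (Yv m w))\<^sup>2) = expectation (\<lambda>w. (inner (F.U n w) (F.U m w))\<^sup>2)" for n m
  proof (rule integral_cong_AE)
    show "AE w in M. (inner (Yv n w) (Yv m w))\<^sup>2 = (inner (F.U n w) (F.U m w))\<^sup>2"
      using YU[of n] YU[of m] by eventually_elim simp
  qed simp_all
  have kap: "expectation (\<lambda>w. expectation (\<lambda>w'. (inner (Yv n w) (Yv m w'))\<^sup>2)) = F.\<kappa>" for n m
  proof -
    have 1: "expectation (\<lambda>w'. (inner u (Yv m w'))\<^sup>2) = expectation (\<lambda>w'. (inner u (F.U m w'))\<^sup>2)" for u
    proof (rule integral_cong_AE)
      show "AE w' in M. (inner u (Yv m w'))\<^sup>2 = (inner u (F.U m w'))\<^sup>2"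
        using YU[of m] by eventually_elim simp
    qed simp_all
    have m: "(\<lambda>w. expectation (\<lambda>w'. (inner (Z w) (F.U m w'))\<^sup>2)) \<in> borel_measurable M"
      if [measurable]: "Z \<in> borel_measurable M" for Z
      by measurable
    have "expectation (\<lambda>w. expectation (\<lambda>w'. (inner (Yv n w) (F.U m w'))\<^sup>2))
        = expectation (\<lambda>w. expectation (\<lambda>w'. (inner (F.U n w) (F.U m w'))\<^sup>2))"
    proof (rule integral_cong_AE)
      show "AE w in M. expectation (\<lambda>w'. (inner (Yv n w) (F.U m w'))\<^sup>2) = expectation (\<lambda>w'. (inner (F.U n w) (F.U m w'))\<^sup>2)"
        using YU[of n] by eventually_elim simp
    qed (intro m; simp)+
    then show ?thesis by (simp add: 1 F.kappa_iterated)
  qed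
  show thesis
  proof (rule that)
    let ?K = "max (max K1 K2) (sqrt F.m4)"
    show "0 \<le> ?K" using K1(1) by simp
    fix N :: nat assume N: "1 \<le> N"
    have "AE w in M. \<forall>n\<in>{1..N}. Yv (int n) w = F.U (int n) w"
      by (rule AE_finite_allI) (use YU in auto)
    then have "AE w in M. (norm (Ybar N w))\<^sup>2 = (norm ((1 / real N) *\<^sub>R (\<Sum>n=1..N. F.U (int n) w)))\<^sup>2"
      by eventually_elim (simp add: Ybar_def)
    then have "expectation (\<lambda>w. (norm (Ybar N w))\<^sup>2)
        = expectation (\<lambda>w. (norm ((1 / real N) *\<^sub>R (\<Sum>n=1..N. F.U (int n) w)))\<^sup>2)"
      by (intro integral_cong_AE) simp_all
    also have "\<dots> \<le> K1 / real N" by (rule K1(2)[OF N])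
    also have "\<dots> \<le> ?K / real N" by (intro divide_right_mono) simp_all
    finally show "expectation (\<lambda>w. (norm (Ybar N w))\<^sup>2) \<le> ?K / real N" .
    have "expectation (\<lambda>w. (HS N w)\<^sup>2)
        = (\<Sum>n=1..N. \<Sum>m=1..N. expectation (\<lambda>w. (inner (F.U (int n) w) (F.U (int m) w))\<^sup>2)) / (real N)\<^sup>2 - F.\<kappa>"
      using N by (simp add: HS_moments(3) kernel_norm_Yv kap cov)
    also have "\<dots> = (\<Sum>n=1..N. \<Sum>m=1..N. expectation (\<lambda>w. (inner (F.U (int n) w) (F.U (int m) w))\<^sup>2) - F.\<kappa>) / (real N)\<^sup>2"
      using N by (simp add: sum_subtractf diff_divide_distrib power2_eq_square)
    also have "\<dots> \<le> K2 / real N" by (rule K2(2)[OF N])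
    also have "\<dots> \<le> ?K / real N" by (intro divide_right_mono) simp_all
    finally show "expectation (\<lambda>w. (HS N w)\<^sup>2) \<le> ?K / real N" .
    have e2: "expectation (\<lambda>w. (norm (Yv n w))\<^sup>2) \<le> ?K" for n
    proof -
      have "expectation (\<lambda>w. (norm (Yv n w))\<^sup>2) = expectation (\<lambda>w. (norm (F.U n w))\<^sup>2)"
      proof (rule integral_cong_AE)
        show "AE w in M. (norm (Yv n w))\<^sup>2 = (norm (F.U n w))\<^sup>2" using YU[of n] by eventually_elim simp
      qed simp_all
      then show ?thesis using F.second_moment_U(2)[of n] by simp
    qed
    have "expectation (amplitude N) = 1 + (\<Sum>n=1..N. expectation (\<lambda>w. (norm (Yv (int n) w))\<^sup>2)) / real N"
      unfolding amplitude_def[abs_def]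
      using prob_space by (subst Bochner_Integration.integral_add)
        (auto simp: Yv_second intro!: Bochner_Integration.integrable_sum integrable_divide_zero)
    also have "\<dots> \<le> 1 + (\<Sum>n=1..N. ?K) / real N" by (intro add_left_mono divide_right_mono sum_mono e2) simp
    also have "\<dots> = 1 + ?K" using N by simp
    finally show "expectation (amplitude N) \<le> 1 + ?K" .
  qed
qed

lemma Ybar_second: "integrable M (\<lambda>w. (norm (Ybar N w))\<^sup>2)"
proof -
  have i: "integrable M (\<lambda>w. inner (Yv n w) (Yv m w))" for n m
  proof (rule Bochner_Integration.integrable_bound)
    show "integrable M (\<lambda>w. norm (Yv n w) * norm (Yv m w))"
      by (intro integral_Cauchy_Schwarz(1) Yv_second) simp_all
  qed (auto simp: Cauchy_Schwarz_ineq2)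
  show ?thesis
    unfolding Ybar_def norm_average_square by (intro integrable_divide_zero Bochner_Integration.integrable_sum i)
qed

lemma deviation_integrable: "integrable M (deviation N)"
  unfolding deviation_def[abs_def]
  using expectation_le_sqrt_second_moment(1)[OF HS_moments(1,2)[of N]] Ybar_second[of N]
    expectation_le_sqrt_second_moment(1)[of "\<lambda>w. norm (Ybar N w)"]
  by (intro Bochner_Integration.integrable_add) simp_all

lemma deviation_rate:
  obtains c where "\<And>N. 1 \<le> N \<Longrightarrow> expectation (deviation N) \<le> c / sqrt (real N)"
proof -
  obtain K where K: "0 \<le> K" "\<And>N. 1 \<le> N \<Longrightarrow> expectation (\<lambda>w. (norm (Ybar N w))\<^sup>2) \<le> K / real N"
    "\<And>N. 1 \<le> N \<Longrightarrow> expectation (\<lambda>w. (HS N w)\<^sup>2) \<le> K / real N"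
    using moment_rates by metis
  have "expectation (deviation N) \<le> (2 * sqrt K + K) / sqrt (real N)" if N: "1 \<le> N" for N
  proof -
    have "expectation (deviation N) = expectation (HS N) + expectation (\<lambda>w. (norm (Ybar N w))\<^sup>2) + expectation (\<lambda>w. norm (Ybar N w))"
      unfolding deviation_def[abs_def]
      using expectation_le_sqrt_second_moment(1)[OF HS_moments(1,2)[of N]] Ybar_second[of N]
        expectation_le_sqrt_second_moment(1)[of "\<lambda>w. norm (Ybar N w)"] by simp
    also have "expectation (HS N) \<le> sqrt (K / real N)"
      using expectation_le_sqrt_second_moment(2)[OF HS_moments(1,2)[of N]] K(3)[OF N]
      by (meson order_trans real_sqrt_le_mono)
    also have "expectation (\<lambda>w. norm (Ybar N w)) \<le> sqrt (K / real N)"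
      using expectation_le_sqrt_second_moment(2)[of "\<lambda>w. norm (Ybar N w)"] Ybar_second[of N] K(2)[OF N]
      by (simp, meson order_trans real_sqrt_le_mono)
    also have "expectation (\<lambda>w. (norm (Ybar N w))\<^sup>2) \<le> K / sqrt (real N)"
    proof -
      have "sqrt (real N) \<le> real N"
        using N by (intro real_le_lsqrt) (auto simp: power2_eq_square)
      then have "K / real N \<le> K / sqrt (real N)" using N K(1) by (intro divide_left_mono) auto
      then show ?thesis using K(2)[OF N] by simp
    qed
    finally show ?thesis by (simp add: real_sqrt_divide add_divide_distrib)
  qed
  then show thesis by (rule that)
qed

end

section \<open>Covariance operators as quadratic forms\<close>

context approximable_series begin

definition cov_form :: "L2_class \<Rightarrow> L2_class \<Rightarrow> real" where
  "cov_form x x' = expectation (\<lambda>w. inner (Yv 1 w) x * inner (Yv 1 w) x')"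

definition emp_form :: "nat \<Rightarrow> 'w \<Rightarrow> L2_class \<Rightarrow> L2_class \<Rightarrow> real" where
  "emp_form N w x x' = (\<Sum>n=1..N. inner (Yv (int n) w - Ybar N w) x * inner (Yv (int n) w - Ybar N w) x') / real N"

lemma cov_form_integrable: "integrable M (\<lambda>w. inner (Yv 1 w) x * inner (Yv 1 w) x')"
proof (rule Bochner_Integration.integrable_bound)
  show "integrable M (\<lambda>w. (norm (Yv 1 w))\<^sup>2 * (norm x * norm x'))" using Yv_second by simp
  show "AE w in M. norm (inner (Yv 1 w) x * inner (Yv 1 w) x') \<le> norm ((norm (Yv 1 w))\<^sup>2 * (norm x * norm x'))"
    using inner_mult_inner_le by (intro AE_I2) simp
qed simp

lemma cov_form_bilinear: "bounded_bilinear cov_form"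
proof
  fix a a' b b' :: L2_class and r :: real
  show "cov_form (a + a') b = cov_form a b + cov_form a' b"
    unfolding cov_form_def inner_add_right distrib_right
    by (intro Bochner_Integration.integral_add cov_form_integrable)
  show "cov_form a (b + b') = cov_form a b + cov_form a b'"
    unfolding cov_form_def inner_add_right distrib_left
    by (intro Bochner_Integration.integral_add cov_form_integrable)
  show "cov_form (r *\<^sub>R a) b = r *\<^sub>R cov_form a b" by (simp add: cov_form_def mult.assoc)
  show "cov_form a (r *\<^sub>R b) = r *\<^sub>R cov_form a b" by (simp add: cov_form_def mult.left_commute)
next
  show "\<exists>K. \<forall>a b. norm (cov_form a b) \<le> norm a * norm b * K"
  proof (intro exI allI)
    fix a b
    have "\<bar>cov_form a b\<bar> \<le> expectation (\<lambda>w. (norm (Yv 1 w))\<^sup>2 * (norm a * norm b))"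
      unfolding cov_form_def
      by (intro order_trans[OF integral_abs_bound integral_mono] integrable_abs cov_form_integrable
          integrable_mult_left Yv_second inner_mult_inner_le)
    then show "norm (cov_form a b) \<le> norm a * norm b * expectation (\<lambda>w. (norm (Yv 1 w))\<^sup>2)"
      by (simp add: mult_ac)
  qed
qed

text \<open>The covariance kernel is centred at the pointwise means of \<open>X 1\<close>, which agree with \<open>\<mu>\<close> only almost
  everywhere.\<close>

lemma cov_kernel_eq:
  "AE t in I01. AE s in I01. cov_kernel M (X 1) t s = RY.kernel 1 (t, s)"
  using mean_eq AE_space
proof eventually_elim
  case (elim t)
  note t = elim
  show ?case using mean_eq AE_space
  proof eventually_elim
    case (elim s)
    show ?case
      unfolding cov_kernel_def RY.kernel_def tensor_def
      by (simp add: y_def t(1)[symmetric] elim(1)[symmetric])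
  qed
qed

lemma cov_kernel_measurable: "(\<lambda>z. cov_kernel M (X 1) (fst z) (snd z)) \<in> borel_measurable Sq"
proof -
  have X1: "(\<lambda>p. case p of (t, w) \<Rightarrow> X 1 w t) \<in> borel_measurable (I01 \<Otimes>\<^sub>M M)" by (rule jointly_measurable)
  have m: "(\<lambda>t. expectation (\<lambda>w. X 1 w t)) \<in> borel_measurable I01"
    by (rule borel_measurable_lebesgue_integral[OF X1])
  have "(\<lambda>p. (case (fst (fst p), snd p) of (t, w) \<Rightarrow> X 1 w t)) \<in> borel_measurable (Sq \<Otimes>\<^sub>M M)"
    by (rule measurable_compose[OF _ X1]) (intro measurable_Pair measurable_compose[OF measurable_fst] measurable_fst measurable_snd)
  moreover have "(\<lambda>p. (case (snd (fst p), snd p) of (t, w) \<Rightarrow> X 1 w t)) \<in> borel_measurable (Sq \<Otimes>\<^sub>M M)"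
    by (rule measurable_compose[OF _ X1]) (intro measurable_Pair measurable_compose[OF measurable_fst] measurable_fst measurable_snd)
  moreover have "(\<lambda>p. expectation (\<lambda>w. X 1 w (fst (fst p)))) \<in> borel_measurable (Sq \<Otimes>\<^sub>M M)"
    by (rule measurable_compose[OF _ m]) (intro measurable_compose[OF measurable_fst] measurable_fst)
  moreover have "(\<lambda>p. expectation (\<lambda>w. X 1 w (snd (fst p)))) \<in> borel_measurable (Sq \<Otimes>\<^sub>M M)"
    by (rule measurable_compose[OF _ m]) (intro measurable_compose[OF measurable_fst] measurable_snd)
  ultimately have "(\<lambda>(z, w). (X 1 w (fst z) - expectation (\<lambda>w'. X 1 w' (fst z)))
      * (X 1 w (snd z) - expectation (\<lambda>w'. X 1 w' (snd z)))) \<in> borel_measurable (Sq \<Otimes>\<^sub>M M)"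
    by (simp add: case_prod_beta' borel_measurable_times borel_measurable_diff)
  then show ?thesis unfolding cov_kernel_def by (rule borel_measurable_lebesgue_integral)
qed

lemma int_op_cov_measurable:
  assumes g: "g \<in> L2"
  shows "int_op (cov_kernel M (X 1)) g \<in> borel_measurable I01"
  unfolding int_op_def[abs_def]
proof (rule I01.borel_measurable_lebesgue_integral)
  have "(\<lambda>z. cov_kernel M (X 1) (fst z) (snd z) * g (snd z)) \<in> borel_measurable Sq"
    by (intro borel_measurable_times cov_kernel_measurable measurable_compose[OF measurable_snd L2_measurable[OF g]])
  then show "(\<lambda>(t, s). cov_kernel M (X 1) t s * g s) \<in> borel_measurable Sq" by (simp add: case_prod_beta')
qed

lemma cov_eigen_form:
  assumes "eigensystem (int_op (cov_kernel M (X 1))) lam v"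
  shows "eigen_form cov_form lam (\<lambda>i. L2_class_of (v i))"
proof (rule eigen_formI[OF assms])
  fix g h :: "real \<Rightarrow> real" assume g: "g \<in> L2" and h: "h \<in> L2"
  have "cov_form (L2_class_of g) (L2_class_of h) = expectation (\<lambda>w. ip g (y 1 w) * ip h (y 1 w))"
    unfolding cov_form_def by (intro Bochner_Integration.integral_cong refl)
      (simp add: Yv_def inner_L2_class_of y_L2 g h, simp add: ip_def mult.commute)
  also have "\<dots> = (\<integral>t. (\<integral>s. RY.kernel 1 (t, s) * g s \<partial>I01) * h t \<partial>I01)"
    by (rule RY.iterated_kernel[OF g h, symmetric])
  also have "\<dots> = (\<integral>t. int_op (cov_kernel M (X 1)) g t * h t \<partial>I01)"
  proof (rule integral_cong_AE)
    have km: "(\<lambda>s. RY.kernel 1 (t, s) * g s) \<in> borel_measurable I01" if "t \<in> {0..1}" for t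
      using that by (intro borel_measurable_times measurable_compose[OF measurable_Pair1' RY.kernel_measurable] L2_measurable[OF g]) simp
    have cm: "(\<lambda>s. cov_kernel M (X 1) t s * g s) \<in> borel_measurable I01" if "t \<in> {0..1}" for t
      using measurable_compose[OF measurable_Pair1'[of t I01] cov_kernel_measurable] that
      by (intro borel_measurable_times L2_measurable[OF g]) simp
    have km2: "(\<lambda>(t, s). RY.kernel 1 (t, s) * g s) \<in> borel_measurable Sq"
      using borel_measurable_times[OF RY.kernel_measurable[of 1] measurable_compose[OF measurable_snd L2_measurable[OF g]]]
      by (simp add: case_prod_beta')
    show "(\<lambda>t. (\<integral>s. RY.kernel 1 (t, s) * g s \<partial>I01) * h t) \<in> borel_measurable I01"
      by (intro borel_measurable_times I01.borel_measurable_lebesgue_integral km2 L2_measurable h)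
    show "(\<lambda>t. int_op (cov_kernel M (X 1)) g t * h t) \<in> borel_measurable I01"
      by (intro borel_measurable_times int_op_cov_measurable L2_measurable g h)
    show "AE t in I01. (\<integral>s. RY.kernel 1 (t, s) * g s \<partial>I01) * h t = int_op (cov_kernel M (X 1)) g t * h t"
      using cov_kernel_eq AE_space
    proof eventually_elim
      case (elim t)
      then have t: "t \<in> {0..1}" by simp
      have "(\<integral>s. RY.kernel 1 (t, s) * g s \<partial>I01) = (\<integral>s. cov_kernel M (X 1) t s * g s \<partial>I01)"
      proof (rule integral_cong_AE[OF km[OF t] cm[OF t]])
        show "AE s in I01. RY.kernel 1 (t, s) * g s = cov_kernel M (X 1) t s * g s"
          using elim(1) by eventually_elim simp
      qed
      then show ?case by (simp add: int_op_def)
    qed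
  qed
  finally show "cov_form (L2_class_of g) (L2_class_of h) = (\<integral>t. int_op (cov_kernel M (X 1)) g t * h t \<partial>I01)" .
  show "int_op (cov_kernel M (X 1)) g \<in> borel_measurable I01" by (rule int_op_cov_measurable[OF g])
next
  show "cov_form x x' = cov_form x' x" for x x' by (simp add: cov_form_def mult.commute)
  show "0 \<le> cov_form x x" for x by (simp add: cov_form_def)
qed (rule cov_form_bilinear)

lemma centred_sample:
  assumes w: "w \<in> space M" and N: "1 \<le> N"
  shows "(\<lambda>t. X n w t - sample_mean X N w t) \<in> L2"
    and "L2_class_of (\<lambda>t. X n w t - sample_mean X N w t) = Yv n w - Ybar N w"
proof -
  let ?S = "\<lambda>t. (1 / real N) * (\<Sum>n=1..N. y (int n) w t)"
  have S: "?S \<in> L2" by (intro L2_scale L2_sum y_L2 w)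
  have "X n w t - sample_mean X N w t = y n w t - ?S t" for t
    using N by (simp add: sample_mean_def y_def sum_subtractf diff_divide_distrib)
  then have eq: "(\<lambda>t. X n w t - sample_mean X N w t) = (\<lambda>t. y n w t - ?S t)" by simp
  show "(\<lambda>t. X n w t - sample_mean X N w t) \<in> L2" unfolding eq by (intro L2_diff y_L2 S w)
  have bar: "L2_class_of ?S = Ybar N w"
    unfolding Ybar_def Yv_def
    by (subst L2_class_of_scale) (simp_all add: L2_sum y_L2 w L2_class_of_sum)
  then show "L2_class_of (\<lambda>t. X n w t - sample_mean X N w t) = Yv n w - Ybar N w"
    unfolding eq L2_class_of_diff[OF y_L2[OF w] S] bar by (simp only: Yv_def)
qed

lemma emp_form_bilinear: "bounded_bilinear (emp_form N w)"
proof
  fix a a' b b' :: L2_class and r :: real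
  show "emp_form N w (a + a') b = emp_form N w a b + emp_form N w a' b"
    by (simp add: emp_form_def inner_add_right distrib_right sum.distrib add_divide_distrib)
  show "emp_form N w a (b + b') = emp_form N w a b + emp_form N w a b'"
    by (simp add: emp_form_def inner_add_right distrib_left sum.distrib add_divide_distrib)
  show "emp_form N w (r *\<^sub>R a) b = r *\<^sub>R emp_form N w a b"
    by (simp add: emp_form_def sum_distrib_left mult.assoc)
  show "emp_form N w a (r *\<^sub>R b) = r *\<^sub>R emp_form N w a b"
    by (simp add: emp_form_def sum_distrib_left mult.left_commute)
next
  show "\<exists>K. \<forall>a b. norm (emp_form N w a b) \<le> norm a * norm b * K"
  proof (intro exI allI)
    fix a b
    let ?Z = "\<lambda>n. Yv (int n) w - Ybar N w"
    have "\<bar>\<Sum>n=1..N. inner (?Z n) a * inner (?Z n) b\<bar> \<le> (\<Sum>n=1..N. (norm (?Z n))\<^sup>2 * (norm a * norm b))"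
      by (rule order_trans[OF sum_abs sum_mono]) (rule inner_mult_inner_le)
    then have "\<bar>\<Sum>n=1..N. inner (?Z n) a * inner (?Z n) b\<bar> / real N
        \<le> (norm a * norm b * (\<Sum>n=1..N. (norm (?Z n))\<^sup>2)) / real N"
      by (intro divide_right_mono) (simp_all add: sum_distrib_left mult_ac)
    then show "norm (emp_form N w a b) \<le> norm a * norm b * ((\<Sum>n=1..N. (norm (?Z n))\<^sup>2) / real N)"
      by (simp add: emp_form_def)
  qed
qed

lemma emp_eigen_form:
  assumes w: "w \<in> space M" and N: "1 \<le> N" and sys: "eigensystem (int_op (emp_cov_kernel X N w)) lam v"
  shows "eigen_form (emp_form N w) lam (\<lambda>i. L2_class_of (v i))"
proof -
  let ?Z = "\<lambda>n t. X (int n) w t - sample_mean X N w t"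
  have Z: "?Z n \<in> L2" for n by (rule centred_sample[OF w N])
  have op: "int_op (emp_cov_kernel X N w) g = (\<lambda>t. (\<Sum>n=1..N. ?Z n t * ip (?Z n) g) / real N)" if g: "g \<in> L2" for g
  proof
    fix t
    have "int_op (emp_cov_kernel X N w) g t = (\<integral>s. (\<Sum>n=1..N. ?Z n t * (?Z n s * g s)) / real N \<partial>I01)"
      unfolding int_op_def emp_cov_kernel_def
      by (intro Bochner_Integration.integral_cong refl) (simp add: sum_distrib_left sum_distrib_right mult_ac)
    also have "\<dots> = (\<Sum>n=1..N. ?Z n t * ip (?Z n) g) / real N"
      using L2_mult_integrable[OF Z g] by (simp add: ip_def Bochner_Integration.integral_sum)
    finally show "int_op (emp_cov_kernel X N w) g t = (\<Sum>n=1..N. ?Z n t * ip (?Z n) g) / real N" .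
  qed
  show ?thesis
  proof (rule eigen_formI[OF sys])
    fix g h :: "real \<Rightarrow> real" assume g: "g \<in> L2" and h: "h \<in> L2"
    have "(\<integral>t. int_op (emp_cov_kernel X N w) g t * h t \<partial>I01)
        = (\<integral>t. (\<Sum>n=1..N. ip (?Z n) g * (?Z n t * h t)) / real N \<partial>I01)"
      unfolding op[OF g]
      by (intro Bochner_Integration.integral_cong refl) (simp add: sum_distrib_left sum_distrib_right mult_ac)
    also have "\<dots> = (\<Sum>n=1..N. ip (?Z n) g * ip (?Z n) h) / real N"
      using L2_mult_integrable[OF Z h] by (simp add: ip_def Bochner_Integration.integral_sum)
    also have "\<dots> = emp_form N w (L2_class_of g) (L2_class_of h)"
      unfolding emp_form_def centred_sample(2)[OF w N, symmetric] inner_L2_class_of[OF Z g] inner_L2_class_of[OF Z h] ..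
    finally show "emp_form N w (L2_class_of g) (L2_class_of h) = (\<integral>t. int_op (emp_cov_kernel X N w) g t * h t \<partial>I01)" ..
    show "int_op (emp_cov_kernel X N w) g \<in> borel_measurable I01"
      unfolding op[OF g] using L2_measurable[OF Z]
      by (intro borel_measurable_divide borel_measurable_sum borel_measurable_times) simp_all
  next
    show "emp_form N w x x' = emp_form N w x' x" for x x' by (simp add: emp_form_def mult.commute)
    show "0 \<le> emp_form N w x x" for x by (simp add: emp_form_def sum_nonneg)
  qed (rule emp_form_bilinear)
qed

text \<open>The two forms differ by the pairing of the difference of the kernels with a rank-one kernel,
  estimated by the Cauchy--Schwarz inequality on the square, and by the rank-one correction from
  the sample mean.\<close>

lemma emp_form_close:
  assumes w: "w \<in> space M" and N: "1 \<le> N"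
  shows "\<bar>emp_form N w x x' - cov_form x x'\<bar> \<le> deviation N w * (norm x * norm x')"
proof -
  obtain g where g: "g \<in> L2" "x = L2_class_of g" using L2_class_of_surj by blast
  obtain h where h: "h \<in> L2" "x' = L2_class_of h" using L2_class_of_surj by blast
  let ?I = "\<lambda>n x. inner (Yv (int n) w) x" and ?k = "RY.kernel 1"
  let ?P = "(\<Sum>n=1..N. ?I n x * ?I n x') / real N"
  have sumY: "(\<Sum>n=1..N. ?I n x) = real N * inner (Ybar N w) x" for x
    using N by (simp add: Ybar_def inner_sum_left)
  have "(\<Sum>n=1..N. inner (Yv (int n) w - Ybar N w) x * inner (Yv (int n) w - Ybar N w) x')
      = (\<Sum>n=1..N. ?I n x * ?I n x') - (\<Sum>n=1..N. ?I n x) * inner (Ybar N w) x'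
        - inner (Ybar N w) x * (\<Sum>n=1..N. ?I n x') + real N * (inner (Ybar N w) x * inner (Ybar N w) x')"
    by (simp add: inner_diff_left left_diff_distrib right_diff_distrib sum_subtractf sum.distrib
        sum_distrib_left sum_distrib_right algebra_simps)
  also have "\<dots> = (\<Sum>n=1..N. ?I n x * ?I n x') - real N * (inner (Ybar N w) x * inner (Ybar N w) x')"
    unfolding sumY by (simp add: algebra_simps)
  finally have emp: "emp_form N w x x' = ?P - inner (Ybar N w) x * inner (Ybar N w) x'"
    using N by (simp add: emp_form_def diff_divide_distrib)
  have TT: "integrable Sq (\<lambda>z. tensor (y n w) (y n w) z * tensor g h z)"
    "(\<integral>z. tensor (y n w) (y n w) z * tensor g h z \<partial>Sq) = inner (Yv n w) x * inner (Yv n w) x'" for n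
    using tensor_pairing[OF y_L2[OF w] y_L2[OF w] g(1) h(1), of n n]
    by (simp_all add: Yv_def inner_L2_class_of y_L2 w g h)
  have emp_int: "integrable Sq (\<lambda>z. emp_kernel N w z * tensor g h z)"
    "(\<integral>z. emp_kernel N w z * tensor g h z \<partial>Sq) = ?P"
  proof -
    have eq: "emp_kernel N w z * tensor g h z = (\<Sum>n=1..N. tensor (y (int n) w) (y (int n) w) z * tensor g h z) / real N" for z
      by (simp add: emp_kernel_def sum_distrib_right)
    show "integrable Sq (\<lambda>z. emp_kernel N w z * tensor g h z)"
      unfolding eq by (intro integrable_divide_zero Bochner_Integration.integrable_sum TT)
    show "(\<integral>z. emp_kernel N w z * tensor g h z \<partial>Sq) = ?P"
      unfolding eq by (simp add: TT Bochner_Integration.integral_sum)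
  qed
  have cov_int: "integrable Sq (\<lambda>z. ?k z * tensor g h z)" "(\<integral>z. ?k z * tensor g h z \<partial>Sq) = cov_form x x'"
  proof -
    show "integrable Sq (\<lambda>z. ?k z * tensor g h z)" using RY.kernel_form(1)[OF g(1) h(1)] by (simp only: mult.commute)
    have "(\<integral>z. ?k z * tensor g h z \<partial>Sq) = expectation (\<lambda>w. ip g (y 1 w) * ip h (y 1 w))"
      using RY.kernel_form(2)[OF g(1) h(1), of 1] by (simp only: mult.commute)
    also have "\<dots> = cov_form x x'"
      unfolding cov_form_def g(2) h(2) by (intro Bochner_Integration.integral_cong refl)
        (simp add: Yv_def inner_L2_class_of y_L2 g h, simp add: ip_def mult.commute)
    finally show "(\<integral>z. ?k z * tensor g h z \<partial>Sq) = cov_form x x'" .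
  qed
  have gh: "tensor g h \<in> borel_measurable Sq" by (intro measurable_tensor L2_measurable g h)
  have dm: "(\<lambda>z. emp_kernel N w z - ?k z) \<in> borel_measurable Sq"
    by (intro borel_measurable_diff emp_kernel_measurable w RY.kernel_measurable)
  have "?P - cov_form x x' = (\<integral>z. (emp_kernel N w z - ?k z) * tensor g h z \<partial>Sq)"
    unfolding left_diff_distrib using emp_int cov_int by simp
  then have "\<bar>?P - cov_form x x'\<bar> \<le> (\<integral>z. \<bar>(emp_kernel N w z - ?k z) * tensor g h z\<bar> \<partial>Sq)"
    by (simp only: integral_abs_bound)
  also have "\<dots> \<le> HS N w * sqrt (\<integral>z. (tensor g h z)\<^sup>2 \<partial>Sq)"
    unfolding HS_def
    by (intro integral_Cauchy_Schwarz(2) gh dm HS_square_expansion w tensor_square g h)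
  also have "\<dots> = HS N w * (norm x * norm x')"
    by (simp add: tensor_square g h norm_L2_class_of)
  finally have 1: "\<bar>?P - cov_form x x'\<bar> \<le> HS N w * (norm x * norm x')" .
  have 2: "\<bar>inner (Ybar N w) x * inner (Ybar N w) x'\<bar> \<le> (norm (Ybar N w))\<^sup>2 * (norm x * norm x')"
    by (rule inner_mult_inner_le)
  have "\<bar>emp_form N w x x' - cov_form x x'\<bar> \<le> (HS N w + (norm (Ybar N w))\<^sup>2) * (norm x * norm x')"
    using 1 2 unfolding emp distrib_right by linarith
  also have "\<dots> \<le> deviation N w * (norm x * norm x')"
    by (intro mult_right_mono) (simp_all add: deviation_def)
  finally show ?thesis .
qed

end

section \<open>Kernel estimators of the long-run covariance\<close>

text \<open>The norm is subadditive along the expansion of a matrix in matrix units, so it is at most the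
  largest entry times the sum of the norms of the matrix units.\<close>

lemma matrix_norm_le_entries:
  assumes nm: "matrix_norm d nm"
  obtains K where "0 \<le> K"
    "\<And>A R. A \<in> carrier_mat d d \<Longrightarrow> (\<And>i j. i < d \<Longrightarrow> j < d \<Longrightarrow> \<bar>A $$ (i, j)\<bar> \<le> R) \<Longrightarrow> nm A \<le> K * R"
proof
  define E where "E p = Matrix.mat d d (\<lambda>p'. if p' = p then 1 else (0::real))" for p
  have E: "E p \<in> carrier_mat d d" for p by (simp add: E_def)
  have nonneg: "0 \<le> nm A" and scale: "nm (a \<cdot>\<^sub>m A) = \<bar>a\<bar> * nm A"
    and tri: "B \<in> carrier_mat d d \<Longrightarrow> nm (A + B) \<le> nm A + nm B"
    and zero: "nm (0\<^sub>m d d) = 0" if "A \<in> carrier_mat d d" for A B a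
    using nm that unfolding matrix_norm_def by auto
  let ?I = "{..<d} \<times> {..<d}"
  show "0 \<le> (\<Sum>p\<in>?I. nm (E p))" by (intro sum_nonneg nonneg E)
  fix A :: "real mat" and R
  assume A: "A \<in> carrier_mat d d" and R: "\<And>i j. i < d \<Longrightarrow> j < d \<Longrightarrow> \<bar>A $$ (i, j)\<bar> \<le> R"
  have "nm (Matrix.mat d d (\<lambda>p. if p \<in> P then A $$ p else 0)) \<le> (\<Sum>p\<in>P. \<bar>A $$ p\<bar> * nm (E p))" if "finite P" for P
    using that
  proof (induction P rule: finite_induct)
    case empty
    have "Matrix.mat d d (\<lambda>p. if p \<in> {} then A $$ p else 0) = 0\<^sub>m d d" by auto
    then show ?case using zero[OF E] by simp
  next
    case (insert p P)
    let ?B = "Matrix.mat d d (\<lambda>p. if p \<in> P then A $$ p else 0)"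
    have "Matrix.mat d d (\<lambda>p'. if p' \<in> insert p P then A $$ p' else 0) = (A $$ p) \<cdot>\<^sub>m E p + ?B"
      using insert.hyps by (intro eq_matI) (auto simp: E_def)
    also have "nm \<dots> \<le> nm ((A $$ p) \<cdot>\<^sub>m E p) + nm ?B" by (intro tri smult_carrier_mat E) simp
    also have "\<dots> \<le> \<bar>A $$ p\<bar> * nm (E p) + (\<Sum>p\<in>P. \<bar>A $$ p\<bar> * nm (E p))"
      using insert.IH by (simp add: scale[OF E])
    finally show ?case using insert.hyps by simp
  qed
  from this[of ?I] have "nm (Matrix.mat d d (\<lambda>p. if p \<in> ?I then A $$ p else 0)) \<le> (\<Sum>p\<in>?I. \<bar>A $$ p\<bar> * nm (E p))" by simp
  also have "Matrix.mat d d (\<lambda>p. if p \<in> ?I then A $$ p else 0) = A"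
    using A by (intro eq_matI) auto
  also have "(\<Sum>p\<in>?I. \<bar>A $$ p\<bar> * nm (E p)) \<le> (\<Sum>p\<in>?I. R * nm (E p))"
  proof (rule sum_mono)
    fix p assume "p \<in> ?I"
    then have "\<bar>A $$ p\<bar> \<le> R" using R[of "fst p" "snd p"] by (cases p) simp
    then show "\<bar>A $$ p\<bar> * nm (E p) \<le> R * nm (E p)" by (rule mult_right_mono[OF _ nonneg[OF E]])
  qed
  finally show "nm A \<le> (\<Sum>p\<in>?I. nm (E p)) * R" by (simp add: sum_distrib_left mult.commute)
qed

text \<open>The common form of the entries of the lagged autocovariance matrices for both signs of the lag; a negative
  lag interchanges the two scalar sequences.\<close>

definition lag_product :: "nat \<Rightarrow> nat \<Rightarrow> (nat \<Rightarrow> real) \<Rightarrow> (nat \<Rightarrow> real) \<Rightarrow> real" where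
  "lag_product N k a a' = (\<Sum>n=1..N - k. a n * a' (n + k)) / real N"

lemma lag_product_diff:
  "\<bar>lag_product N k a a' - lag_product N k c c'\<bar>
    = \<bar>\<Sum>n=1..N - k. a n * a' (n + k) - c n * c' (n + k)\<bar> / real N"
  unfolding lag_product_def sum_subtractf diff_divide_distrib[symmetric] abs_divide by simp

lemma Sigma_hat_diff_le:
  assumes \<omega>: "\<And>j. \<bar>\<omega> q j\<bar> \<le> b" and ij: "i < d" "j < d"
    and R: "\<And>k i j. i < d \<Longrightarrow> j < d \<Longrightarrow>
      \<bar>lag_product N k (\<lambda>n. \<xi> n $ i) (\<lambda>n. \<xi> n $ j) - lag_product N k (\<lambda>n. \<zeta> n $ i) (\<lambda>n. \<zeta> n $ j)\<bar> \<le> R"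
  shows "\<bar>(Sigma_hat d N q \<omega> \<xi> - Sigma_hat d N q \<omega> \<zeta>) $$ (i, j)\<bar> \<le> b * (2 * real q + 1) * R"
proof -
  have b: "0 \<le> b" using \<omega>[of 0] by linarith
  have pos: "Gamma_hat d N xi r $$ (i, j) = lag_product N (nat r) (\<lambda>n. xi n $ i) (\<lambda>n. xi n $ j)"
    if "0 \<le> r" for r xi
    using ij that by (simp add: Gamma_hat_def lag_product_def)
  have neg: "Gamma_hat d N xi r $$ (i, j) = lag_product N (nat \<bar>r\<bar>) (\<lambda>n. xi n $ j) (\<lambda>n. xi n $ i)"
    if "\<not> 0 \<le> r" for r xi
  proof -
    have "Gamma_hat d N xi r $$ (i, j) = (\<Sum>n=1..N - nat \<bar>r\<bar>. xi (n + nat \<bar>r\<bar>) $ i * xi n $ j) / real N"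
      using ij that by (simp add: Gamma_hat_def)
    also have "(\<Sum>n=1..N - nat \<bar>r\<bar>. xi (n + nat \<bar>r\<bar>) $ i * xi n $ j)
        = (\<Sum>n=1..N - nat \<bar>r\<bar>. xi n $ j * xi (n + nat \<bar>r\<bar>) $ i)"
      by (rule sum.cong[OF refl mult.commute])
    finally show ?thesis unfolding lag_product_def .
  qed
  have \<Gamma>: "\<bar>Gamma_hat d N \<xi> r $$ (i, j) - Gamma_hat d N \<zeta> r $$ (i, j)\<bar> \<le> R" for r
  proof (cases "0 \<le> r")
    case True
    show ?thesis unfolding pos[OF True] by (rule R[OF ij])
  next
    case False
    show ?thesis unfolding neg[OF False] by (rule R[OF ij(2,1)])
  qed
  have "(Sigma_hat d N q \<omega> \<xi> - Sigma_hat d N q \<omega> \<zeta>) $$ (i, j)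
      = (\<Sum>r\<in>{- int q..int q}. \<omega> q r * (Gamma_hat d N \<xi> r $$ (i, j) - Gamma_hat d N \<zeta> r $$ (i, j)))"
    using ij by (simp add: Sigma_hat_def sum_subtractf right_diff_distrib)
  also have "\<bar>\<dots>\<bar> \<le> (\<Sum>r\<in>{- int q..int q}. b * R)"
  proof (rule order_trans[OF sum_abs sum_mono])
    fix r
    show "\<bar>\<omega> q r * (Gamma_hat d N \<xi> r $$ (i, j) - Gamma_hat d N \<zeta> r $$ (i, j))\<bar> \<le> b * R"
      unfolding abs_mult by (intro mult_mono \<omega> \<Gamma> b) simp
  qed
  also have "\<dots> = b * (2 * real q + 1) * R" by simp
  finally show ?thesis .
qed

lemma shifted_sum_le:
  fixes f :: "nat \<Rightarrow> real"
  assumes "\<And>n. 0 \<le> f n"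
  shows "(\<Sum>n=1..N - k. f (n + k)) \<le> (\<Sum>n=1..N. f n)" "(\<Sum>n=1..N - k. f n) \<le> (\<Sum>n=1..N. f n)"
proof -
  have "(\<Sum>n=1..N - k. f (n + k)) = sum f ((\<lambda>n. n + k) ` {1..N - k})"
    by (subst sum.reindex) (auto intro: inj_onI)
  also have "\<dots> \<le> (\<Sum>n=1..N. f n)" using assms by (intro sum_mono2) auto
  finally show "(\<Sum>n=1..N - k. f (n + k)) \<le> (\<Sum>n=1..N. f n)" .
  show "(\<Sum>n=1..N - k. f n) \<le> (\<Sum>n=1..N. f n)" using assms by (intro sum_mono2) auto
qed

lemma inner_product_diff_le:
  fixes a a' p p' u u' :: "'h :: real_inner"
  assumes "norm p \<le> 1" "norm u' \<le> 1" "norm (p - u) \<le> \<tau>" "norm (p' - u') \<le> \<tau>"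
  shows "\<bar>inner a p * inner a' p' - inner a u * inner a' u'\<bar> \<le> \<tau> * ((norm a)\<^sup>2 + (norm a')\<^sup>2)"
proof -
  have t0: "0 \<le> \<tau>" using assms(3) norm_ge_zero order_trans by blast
  have "inner a p * inner a' p' - inner a u * inner a' u' = inner a p * inner a' (p' - u') + inner a (p - u) * inner a' u'"
    by (simp add: inner_diff_right algebra_simps)
  also have "\<bar>\<dots>\<bar> \<le> \<bar>inner a p\<bar> * \<bar>inner a' (p' - u')\<bar> + \<bar>inner a (p - u)\<bar> * \<bar>inner a' u'\<bar>"
    using abs_triangle_ineq by (simp add: abs_mult[symmetric])
  also have "\<dots> \<le> (norm a * 1) * (norm a' * \<tau>) + (norm a * \<tau>) * (norm a' * 1)"
    using t0 assms by (intro add_mono mult_mono order_trans[OF Cauchy_Schwarz_ineq2] mult_left_mono) simp_all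
  also have "\<dots> = \<tau> * (2 * norm a * norm a')" by simp
  also have "\<dots> \<le> \<tau> * ((norm a)\<^sup>2 + (norm a')\<^sup>2)"
    using zero_le_power2[of "norm a - norm a'"] by (intro mult_left_mono t0) (simp add: power2_diff)
  finally show ?thesis .
qed

lemma lag_product_direction_diff:
  fixes P :: "nat \<Rightarrow> 'h :: real_inner"
  assumes pu: "norm p \<le> 1" "norm u' \<le> 1" "norm (p - u) \<le> \<tau>" "norm (p' - u') \<le> \<tau>"
  shows "\<bar>lag_product N k (\<lambda>n. inner (P n) p) (\<lambda>n. inner (P n) p')
      - lag_product N k (\<lambda>n. inner (P n) u) (\<lambda>n. inner (P n) u')\<bar>
    \<le> 2 * \<tau> * ((\<Sum>n=1..N. (norm (P n))\<^sup>2) / real N)"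
proof -
  have t0: "0 \<le> \<tau>" using assms(3) norm_ge_zero order_trans by blast
  have "\<bar>\<Sum>n=1..N - k. inner (P n) p * inner (P (n + k)) p' - inner (P n) u * inner (P (n + k)) u'\<bar>
      \<le> (\<Sum>n=1..N - k. \<tau> * ((norm (P n))\<^sup>2 + (norm (P (n + k)))\<^sup>2))"
    by (rule order_trans[OF sum_abs sum_mono]) (rule inner_product_diff_le[OF pu])
  also have "\<dots> = \<tau> * ((\<Sum>n=1..N - k. (norm (P n))\<^sup>2) + (\<Sum>n=1..N - k. (norm (P (n + k)))\<^sup>2))"
    by (simp add: sum_distrib_left sum.distrib distrib_left)
  also have "\<dots> \<le> \<tau> * ((\<Sum>n=1..N. (norm (P n))\<^sup>2) + (\<Sum>n=1..N. (norm (P n))\<^sup>2))"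
    using shifted_sum_le[of "\<lambda>n. (norm (P n))\<^sup>2"] by (intro mult_left_mono t0 add_mono) simp_all
  finally have "\<bar>\<Sum>n=1..N - k. inner (P n) p * inner (P (n + k)) p' - inner (P n) u * inner (P (n + k)) u'\<bar>
      \<le> 2 * \<tau> * (\<Sum>n=1..N. (norm (P n))\<^sup>2)" by simp
  from divide_right_mono[OF this, of "real N"] show ?thesis
    unfolding lag_product_diff by simp
qed

text \<open>Each product changes by at most \<open>\<parallel>c\<parallel> (\<parallel>P\<^sub>n\<parallel> + \<parallel>P\<^sub>n\<^sub>+\<^sub>k\<parallel> + \<parallel>c\<parallel>)\<close>, and each of the three terms in
  the bracket is on average at most one plus the mean square of the \<open>P\<^sub>n\<close>.\<close>

lemma lag_product_centring_diff:
  fixes P :: "nat \<Rightarrow> 'h :: real_inner"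
  assumes u: "norm u \<le> 1" "norm u' \<le> 1" and N: "1 \<le> N"
    and c: "c = (1 / real N) *\<^sub>R (\<Sum>n=1..N. P n)"
  shows "\<bar>lag_product N k (\<lambda>n. inner (P n - c) u) (\<lambda>n. inner (P n - c) u')
      - lag_product N k (\<lambda>n. inner (P n) u) (\<lambda>n. inner (P n) u')\<bar>
    \<le> 3 * norm c * (1 + (\<Sum>n=1..N. (norm (P n))\<^sup>2) / real N)"
proof -
  let ?A = "1 + (\<Sum>n=1..N. (norm (P n))\<^sup>2) / real N"
  have sq: "norm x \<le> 1 + (norm x)\<^sup>2" for x :: 'h
  proof -
    have "2 * norm x \<le> 1 + (norm x)\<^sup>2"
      using zero_le_power2[of "norm x - 1"] by (simp add: power2_diff)
    then show ?thesis using norm_ge_zero[of x] by linarith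
  qed
  have sumA: "(\<Sum>n=1..N. 1 + (norm (P n))\<^sup>2) = real N * ?A"
    using N by (simp add: sum.distrib distrib_left)
  have cA: "norm c \<le> ?A"
  proof -
    have "norm (\<Sum>n=1..N. P n) \<le> (\<Sum>n=1..N. 1 + (norm (P n))\<^sup>2)"
      by (rule order_trans[OF norm_sum sum_mono]) (rule sq)
    then have "norm (\<Sum>n=1..N. P n) / real N \<le> (real N * ?A) / real N"
      unfolding sumA by (rule divide_right_mono) simp
    then show ?thesis using N by (simp add: c)
  qed
  have term_le: "\<bar>inner (a - c) u * inner (a' - c) u' - inner a u * inner a' u'\<bar>
      \<le> norm c * ((1 + (norm a)\<^sup>2) + (1 + (norm a')\<^sup>2) + norm c)" for a a' :: 'h
  proof -
    have *: "\<bar>inner x u\<bar> \<le> norm x" "\<bar>inner x u'\<bar> \<le> norm x" for x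
      using Cauchy_Schwarz_ineq2[of x u] Cauchy_Schwarz_ineq2[of x u'] u
        mult_left_mono[OF u(1) norm_ge_zero[of x]] mult_left_mono[OF u(2) norm_ge_zero[of x]] by simp_all
    have "inner (a - c) u * inner (a' - c) u' - inner a u * inner a' u'
        = inner c u * inner c u' - inner c u * inner a' u' - inner a u * inner c u'"
      by (simp add: inner_diff_left algebra_simps)
    also have "\<bar>\<dots>\<bar> \<le> \<bar>inner c u\<bar> * \<bar>inner c u'\<bar> + \<bar>inner c u\<bar> * \<bar>inner a' u'\<bar> + \<bar>inner a u\<bar> * \<bar>inner c u'\<bar>"
      unfolding abs_mult[symmetric] by linarith
    also have "\<dots> \<le> norm c * norm c + norm c * norm a' + norm a * norm c"
      by (intro add_mono mult_mono *) simp_all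
    also have "\<dots> = norm c * (norm a + norm a' + norm c)" by (simp add: algebra_simps)
    also have "\<dots> \<le> norm c * ((1 + (norm a)\<^sup>2) + (1 + (norm a')\<^sup>2) + norm c)"
      by (intro mult_left_mono add_mono sq) simp_all
    finally show ?thesis .
  qed
  have "\<bar>\<Sum>n=1..N - k. inner (P n - c) u * inner (P (n + k) - c) u' - inner (P n) u * inner (P (n + k)) u'\<bar>
      \<le> (\<Sum>n=1..N - k. norm c * ((1 + (norm (P n))\<^sup>2) + (1 + (norm (P (n + k)))\<^sup>2) + norm c))"
    by (rule order_trans[OF sum_abs sum_mono]) (rule term_le)
  also have "\<dots> = norm c * ((\<Sum>n=1..N - k. 1 + (norm (P n))\<^sup>2) + (\<Sum>n=1..N - k. 1 + (norm (P (n + k)))\<^sup>2)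
      + real (N - k) * norm c)"
    by (simp only: sum_distrib_left[symmetric] sum.distrib sum_constant card_atLeastAtMost) simp
  also have "\<dots> \<le> norm c * (real N * ?A + real N * ?A + real N * ?A)"
    using shifted_sum_le[where f="\<lambda>n. 1 + (norm (P n))\<^sup>2" and N=N and k=k] unfolding sumA
    by (intro mult_left_mono add_mono mult_mono cA) simp_all
  also have "\<dots> = (3 * norm c * ?A) * real N" by (simp only: mult_ac) simp
  finally have "\<bar>\<Sum>n=1..N - k. inner (P n - c) u * inner (P (n + k) - c) u' - inner (P n) u * inner (P (n + k)) u'\<bar>
      \<le> (3 * norm c * ?A) * real N" .
  from divide_right_mono[OF this, of "real N"] show ?thesis
    using N unfolding lag_product_diff by simp
qed

text \<open>Once \<open>q \<ge> 1\<close>, \<open>2 q + 1 \<le> 3 q\<^sup>2\<close>, and \<open>q\<^sup>2 / \<surd>N\<close> is the square root of \<open>q\<^sup>4 / N\<close>.\<close>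

lemma bandwidth_rate:
  assumes "filterlim q at_top sequentially" "(\<lambda>N. real (q N) ^ 4 / real N) \<longlonglongrightarrow> 0"
  shows "(\<lambda>N. (2 * real (q N) + 1) / sqrt (real N)) \<longlonglongrightarrow> 0"
proof (rule tendsto_sandwich[OF _ _ tendsto_const])
  have "(\<lambda>N. 3 * sqrt (real (q N) ^ 4 / real N)) \<longlonglongrightarrow> 3 * sqrt 0"
    by (intro tendsto_intros assms)
  then show "(\<lambda>N. 3 * sqrt (real (q N) ^ 4 / real N)) \<longlonglongrightarrow> 0" by simp
  have "eventually (\<lambda>N. 1 \<le> q N) sequentially" using assms(1) by (simp add: filterlim_at_top)
  then show "eventually (\<lambda>N. (2 * real (q N) + 1) / sqrt (real N) \<le> 3 * sqrt (real (q N) ^ 4 / real N)) sequentially"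
  proof eventually_elim
    case (elim N)
    have "2 * real (q N) + 1 \<le> 3 * real (q N)" using elim by simp
    also have "\<dots> \<le> 3 * (real (q N))\<^sup>2" using elim by (simp add: power2_eq_square)
    finally have "(2 * real (q N) + 1) / sqrt (real N) \<le> 3 * (real (q N))\<^sup>2 / sqrt (real N)"
      by (rule divide_right_mono) simp
    moreover have "sqrt (real (q N) ^ 4) = (real (q N))\<^sup>2"
      using real_sqrt_abs[of "(real (q N))\<^sup>2"] by simp
    ultimately show ?case by (simp add: real_sqrt_divide)
  qed
qed simp

theorem proposition4p1:
  fixes M :: "'w measure" and S :: "'s measure"
    and X Y :: "int \<Rightarrow> 'w \<Rightarrow> real \<Rightarrow> real" and \<mu> :: "real \<Rightarrow> real"
    and d :: nat and lam :: "nat \<Rightarrow> real" and v :: "nat \<Rightarrow> real \<Rightarrow> real"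
    and lam_hat :: "nat \<Rightarrow> 'w \<Rightarrow> nat \<Rightarrow> real" and v_hat :: "nat \<Rightarrow> 'w \<Rightarrow> nat \<Rightarrow> real \<Rightarrow> real"
    and q :: "nat \<Rightarrow> nat" and \<omega> :: "nat \<Rightarrow> int \<Rightarrow> real" and b :: real
    and nm :: "real mat \<Rightarrow> real"
  assumes "prob_space M"
    and approximable: "Lp_m_approximable M S 4 X"
    and jointly_measurable:
      "\<And>n. (\<lambda>(t, w). X n w t) \<in> borel_measurable (I01 \<Otimes>\<^sub>M M)"
    and second_moment: "(SUP t\<in>{0..1}. \<integral>\<^sup>+w. ennreal (\<bar>X 1 w t\<bar>\<^sup>2) \<partial>M) < \<infinity>"
    and mean_measurable: "\<mu> \<in> borel_measurable I01"
    and decomposition: "\<And>n w t. w \<in> space M \<Longrightarrow> t \<in> {0..1} \<Longrightarrow> X n w t = \<mu> t + Y n w t"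
    and centered: "\<And>n. AE t in I01. (\<integral>w. Y n w t \<partial>M) = 0"
    and eigen: "eigensystem (int_op (cov_kernel M (X 1))) lam v"
    and d: "1 \<le> d"
    and eigen_gaps: "\<And>i. i < d \<Longrightarrow> lam (Suc i) < lam i"
    and sample_eigen: "\<And>N w. 1 \<le> N \<Longrightarrow> w \<in> space M \<Longrightarrow>
      eigensystem (int_op (emp_cov_kernel X N w)) (lam_hat N w) (v_hat N w)"
    and bandwidth: "filterlim q at_top sequentially"
      "(\<lambda>N. real (q N) ^ 4 / real N) \<longlonglongrightarrow> 0"
    and weights_sym: "\<And>k j. \<omega> k j = \<omega> k (- j)"
    and weights_bounded: "\<And>k j. \<bar>\<omega> k j\<bar> \<le> b"
    and weights_lim: "\<And>j. (\<lambda>k. \<omega> k j) \<longlonglongrightarrow> 1"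
    and norm: "matrix_norm d nm"
  shows "let
      \<beta> = (\<lambda>w n. score_vec d v (Y (int n) w));
      \<beta>_hat = (\<lambda>N w n. score_vec d (v_hat N w) (Y (int n) w));
      \<eta>_hat = (\<lambda>N w n. score_vec d (v_hat N w) (\<lambda>t. X (int n) w t - sample_mean X N w t));
      C_hat = (\<lambda>N w. mat_diag d (\<lambda>i. sgn (ip (v i) (v_hat N w i))))
    in
      oP1 M (\<lambda>N w. nm (Sigma_hat d N (q N) \<omega> (\<beta> w)
            - Sigma_hat d N (q N) \<omega> (\<lambda>n. C_hat N w *\<^sub>v \<beta>_hat N w n))) \<and>
      oP1 M (\<lambda>N w. nm (Sigma_hat d N (q N) \<omega> (\<eta>_hat N w)
            - Sigma_hat d N (q N) \<omega> (\<beta>_hat N w)))"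
proof -
  interpret approximable_series M S X Y \<mu>
    by (intro approximable_series.intro approximable_series_axioms.intro assms)
  obtain K where K: "0 \<le> K" "\<And>A R. A \<in> carrier_mat d d \<Longrightarrow>
      (\<And>i j. i < d \<Longrightarrow> j < d \<Longrightarrow> \<bar>A $$ (i, j)\<bar> \<le> R) \<Longrightarrow> nm A \<le> K * R"
    using matrix_norm_le_entries[OF norm] by blast
  obtain a where a: "\<And>N. 1 \<le> N \<Longrightarrow> expectation (amplitude N) \<le> a" using moment_rates by metis
  obtain c where c: "\<And>N. 1 \<le> N \<Longrightarrow> expectation (deviation N) \<le> c / sqrt (real N)"
    using deviation_rate by blast
  \<comment> \<open>The smallest of the gaps below the first \<open>d\<close> eigenvalues serves every index at once.\<close>
  define \<gamma> where "\<gamma> = Min ((\<lambda>j. lam j - lam (Suc j)) ` {..<d})"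
  have "{..<d} \<noteq> {}" using d by (auto simp: lessThan_empty_iff)
  then have \<gamma>: "\<gamma> > 0" unfolding \<gamma>_def using eigen_gaps by (subst Min_gr_iff) auto
  have gap: "\<gamma> \<le> lam j - lam (Suc j)" if "j < d" for j
    unfolding \<gamma>_def using that by (intro Min_le) auto
  have b: "0 \<le> b" using weights_bounded[of 0 0] by linarith
  have v: "v i \<in> L2" for i using eigen by (simp add: eigensystem_def)
  have vh: "v_hat N w i \<in> L2" if "1 \<le> N" "w \<in> space M" for N w i
    using sample_eigen[OF that] by (simp add: eigensystem_def)
  let ?V = "\<lambda>i. L2_class_of (v i)" and ?Vh = "\<lambda>N w i. L2_class_of (v_hat N w i)"
  have V1: "norm (?V i) = 1" for i
    using eigen_form.norm_v[OF cov_eigen_form[OF eigen]] .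
  have Vh1: "norm (?Vh N w i) = 1" if "1 \<le> N" "w \<in> space M" for N w i
    using eigen_form.norm_v[OF emp_eigen_form[OF that(2,1) sample_eigen[OF that]]] .
  \<comment> \<open>A vanishing sign gives the zero vector, whence only \<open>\<le> 1\<close> for the norm of \<open>?U\<close>.\<close>
  let ?U = "\<lambda>N w i. sgn (ip (v i) (v_hat N w i)) *\<^sub>R ?Vh N w i"
  have U1: "norm (?U N w i) \<le> 1" if "1 \<le> N" "w \<in> space M" for N w i
    using Vh1[OF that] by (simp add: abs_sgn_eq)
  have close: "norm (?V i - ?U N w i) \<le> 3 / \<gamma> * deviation N w"
    if "1 \<le> N" "w \<in> space M" "i < d" for N w i
    using eigenvector_perturbation[OF cov_eigen_form[OF eigen] emp_eigen_form[OF that(2,1) sample_eigen[OF that(1,2)]]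
        emp_form_close[OF that(2,1)] \<gamma>, of i] gap that
    by (simp add: inner_L2_class_of v vh)
  have Y_y: "ip (Y n w) g = inner (Yv n w) (L2_class_of g)" if "w \<in> space M" "g \<in> L2" for n w g
  proof -
    have "ip (Y n w) g = ip (y n w) g"
      unfolding ip_def using decomposition[OF that(1)]
      by (intro Bochner_Integration.integral_cong) (auto simp: y_def)
    then show ?thesis by (simp add: inner_Yv that)
  qed
  let ?\<beta> = "\<lambda>w n. score_vec d v (Y (int n) w)"
  let ?\<beta>h = "\<lambda>N w n. score_vec d (v_hat N w) (Y (int n) w)"
  let ?\<eta>h = "\<lambda>N w n. score_vec d (v_hat N w) (\<lambda>t. X (int n) w t - sample_mean X N w t)"
  let ?C = "\<lambda>N w. mat_diag d (\<lambda>i. sgn (ip (v i) (v_hat N w i)))"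
  have \<beta>: "?\<beta> w n $ i = inner (Yv (int n) w) (?V i)" if "w \<in> space M" "i < d" for w n i
    using that by (simp add: score_vec_def Y_y v)
  have \<beta>h: "?\<beta>h N w n $ i = inner (Yv (int n) w) (?Vh N w i)"
    if "1 \<le> N" "w \<in> space M" "i < d" for N w n i
    using that by (simp add: score_vec_def Y_y vh)
  have C\<beta>h: "(?C N w *\<^sub>v ?\<beta>h N w n) $ i = inner (Yv (int n) w) (?U N w i)"
    if "1 \<le> N" "w \<in> space M" "i < d" for N w n i
  proof -
    have "(?C N w *\<^sub>v ?\<beta>h N w n) $ i
        = (\<Sum>j=0..<d. (if i = j then sgn (ip (v j) (v_hat N w j)) else 0) * ?\<beta>h N w n $ j)"
      using that by (auto simp: scalar_prod_def mat_diag_def score_vec_def intro!: sum.cong)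
    also have "\<dots> = sgn (ip (v i) (v_hat N w i)) * ?\<beta>h N w n $ i"
      using that by (simp add: if_distrib[of "\<lambda>x. x * _"] sum.delta cong: if_cong)
    finally show ?thesis using \<beta>h[OF that] by simp
  qed
  have \<eta>h: "?\<eta>h N w n $ i = inner (Yv (int n) w - Ybar N w) (?Vh N w i)"
    if "1 \<le> N" "w \<in> space M" "i < d" for N w n i
    unfolding centred_sample(2)[OF that(2,1), symmetric]
      inner_L2_class_of[OF centred_sample(1)[OF that(2,1)] vh[OF that(1,2)]]
    using that(3) by (simp add: score_vec_def)
  have carrier: "Sigma_hat d N k \<omega> \<xi> - Sigma_hat d N k \<omega> \<zeta> \<in> carrier_mat d d" for N k \<xi> \<zeta>
    unfolding Sigma_hat_def by (intro minus_carrier_mat mat_carrier)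
  have nm_abs: "\<bar>nm A\<bar> = nm A" if "A \<in> carrier_mat d d" for A
    using norm that unfolding matrix_norm_def by simp
  let ?r = "\<lambda>C N. K * (b * C) * (2 * real (q N) + 1)"
  have rate: "(\<lambda>N. ?r C N / sqrt (real N)) \<longlonglongrightarrow> 0" for C
    using tendsto_mult_left[OF bandwidth_rate[OF bandwidth], of "K * (b * C)"] by simp
  have r0: "0 \<le> ?r C N" if "0 \<le> C" for C N using K(1) b that by simp
  have "oP1 M (\<lambda>N w. nm (Sigma_hat d N (q N) \<omega> (?\<beta> w) - Sigma_hat d N (q N) \<omega> (\<lambda>n. ?C N w *\<^sub>v ?\<beta>h N w n)))"
  proof (rule oP1_by_products[OF amplitude_integrable amplitude_nonneg a deviation_integrable deviation_nonneg c
        r0 rate])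
    show "0 \<le> 2 * (3 / \<gamma>)" using \<gamma> by simp
    fix N :: nat and w assume N: "1 \<le> N" and w: "w \<in> space M"
    have "nm (Sigma_hat d N (q N) \<omega> (?\<beta> w) - Sigma_hat d N (q N) \<omega> (\<lambda>n. ?C N w *\<^sub>v ?\<beta>h N w n))
        \<le> K * (b * (2 * real (q N) + 1) * (2 * (3 / \<gamma> * deviation N w) * amplitude N w))"
    proof (rule K(2)[OF carrier], rule Sigma_hat_diff_le)
      fix k i j assume ij: "i < d" "j < d"
      show "\<bar>lag_product N k (\<lambda>n. ?\<beta> w n $ i) (\<lambda>n. ?\<beta> w n $ j)
          - lag_product N k (\<lambda>n. (?C N w *\<^sub>v ?\<beta>h N w n) $ i) (\<lambda>n. (?C N w *\<^sub>v ?\<beta>h N w n) $ j)\<bar>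
        \<le> 2 * (3 / \<gamma> * deviation N w) * amplitude N w"
        unfolding \<beta>[OF w ij(1)] \<beta>[OF w ij(2)] C\<beta>h[OF N w ij(1)] C\<beta>h[OF N w ij(2)]
      proof (rule order_trans[OF lag_product_direction_diff[OF _ U1[OF N w] close[OF N w ij(1)] close[OF N w ij(2)]]])
        show "2 * (3 / \<gamma> * deviation N w) * ((\<Sum>n=1..N. (norm (Yv (int n) w))\<^sup>2) / real N)
            \<le> 2 * (3 / \<gamma> * deviation N w) * amplitude N w"
          using \<gamma> deviation_nonneg[of N w] by (intro mult_left_mono) (simp_all add: amplitude_def)
      qed (simp add: V1)
    qed (rule weights_bounded)
    then show "\<bar>nm (Sigma_hat d N (q N) \<omega> (?\<beta> w) - Sigma_hat d N (q N) \<omega> (\<lambda>n. ?C N w *\<^sub>v ?\<beta>h N w n))\<bar>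
        \<le> ?r (2 * (3 / \<gamma>)) N * (amplitude N w * deviation N w)"
      unfolding nm_abs[OF carrier] by (simp only: mult_ac)
  qed
  moreover have "oP1 M (\<lambda>N w. nm (Sigma_hat d N (q N) \<omega> (?\<eta>h N w) - Sigma_hat d N (q N) \<omega> (?\<beta>h N w)))"
  proof (rule oP1_by_products[OF amplitude_integrable amplitude_nonneg a deviation_integrable deviation_nonneg c
        r0 rate])
    show "0 \<le> (3 :: real)" by simp
    fix N :: nat and w assume N: "1 \<le> N" and w: "w \<in> space M"
    have "nm (Sigma_hat d N (q N) \<omega> (?\<eta>h N w) - Sigma_hat d N (q N) \<omega> (?\<beta>h N w))
        \<le> K * (b * (2 * real (q N) + 1) * (3 * deviation N w * amplitude N w))"
    proof (rule K(2)[OF carrier], rule Sigma_hat_diff_le)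
      fix k i j assume ij: "i < d" "j < d"
      show "\<bar>lag_product N k (\<lambda>n. ?\<eta>h N w n $ i) (\<lambda>n. ?\<eta>h N w n $ j)
          - lag_product N k (\<lambda>n. ?\<beta>h N w n $ i) (\<lambda>n. ?\<beta>h N w n $ j)\<bar>
        \<le> 3 * deviation N w * amplitude N w"
        unfolding \<eta>h[OF N w ij(1)] \<eta>h[OF N w ij(2)] \<beta>h[OF N w ij(1)] \<beta>h[OF N w ij(2)] amplitude_def
      proof (rule order_trans[OF lag_product_centring_diff[OF _ _ N Ybar_def]])
        show "3 * norm (Ybar N w) * (1 + (\<Sum>n=1..N. (norm (Yv (int n) w))\<^sup>2) / real N)
            \<le> 3 * deviation N w * (1 + (\<Sum>n=1..N. (norm (Yv (int n) w))\<^sup>2) / real N)"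
          using amplitude_nonneg[of N w]
          by (intro mult_right_mono) (simp_all add: deviation_def HS_nonneg amplitude_def)
      qed (simp_all only: Vh1[OF N w])
    qed (rule weights_bounded)
    then show "\<bar>nm (Sigma_hat d N (q N) \<omega> (?\<eta>h N w) - Sigma_hat d N (q N) \<omega> (?\<beta>h N w))\<bar>
        \<le> ?r 3 N * (amplitude N w * deviation N w)"
      unfolding nm_abs[OF carrier] by (simp only: mult_ac)
  qed
  ultimately show ?thesis unfolding Let_def by blast
qed

end
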